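(* Let $\rho$ be a state on $S$ and $\rho'$ a state on $S'$ with $\mathcal{C}(\rho')\subseteq\mathcal{C}(\rho)$. Then for every $\delta>0$ and $\varepsilon>0$ there exist a finite-dimensional catalytic system $C$ (with some Hamiltonian), a state $c$ on $C$, and a covariant operation $\Lambda:S\otimes C\to S'\otimes C$ such that $\tau=\Lambda(\rho\otimes c)$ satisfies $\|\mathrm{Tr}_C\tau-\rho'\|_1<\delta$, $\mathrm{Tr}_{S'}\tau=c$, and $\|\tau-\rho'\otimes c\|_1<\varepsilon$. Moreover, if $\rho'$ is full rank, this can be achieved with $\mathrm{Tr}_C\tau=\rho'$ exactly (still with $\mathrm{Tr}_{S'}\tau=c$ and $\|\tau-\rho'\otimes c\|_1<\varepsilon$).
   Context: All systems are finite-dimensional quantum systems $X$ with Hamiltonians $H_X$; composites carry the sum Hamiltonian. A channel $\Lambda:X\to Y$ is covariant if $\Lambda(e^{-iH_Xt}\sigma e^{iH_Xt})=e^{-iH_Yt}\Lambda(\sigma)e^{iH_Yt}$ for all states $\sigma$ and $t\in\mathbb{R}$. Writing $H_X=\sum_k E_k\Pi_k$ (distinct eigenvalues, spectral projectors), $\mathcal{D}(\sigma)=\{E_k-E_l:\Pi_k\sigma\Pi_l\ne0\}$ and $\mathcal{C}(\sigma)$ is the set of all finite integer linear combinations of elements of $\mathcal{D}(\sigma)$. *)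

theory Defs
  imports "Jordan_Normal_Form.DL_Rank"
begin

text \<open>Finite-dimensional quantum systems are modelled by a dimension n and a
Hamiltonian, i.e. a Hermitian n x n complex matrix. Operators are complex matrices
(Jordan_Normal_Form). The tensor product uses the index convention
(i,a) |-> i * dim_B + a (first factor = more significant index).\<close>

definition adj :: "complex mat \<Rightarrow> complex mat" where
  "adj A = mat (dim_col A) (dim_row A) (\<lambda>(i,j). cnj (A $$ (j,i)))"

definition mtrace :: "complex mat \<Rightarrow> complex" where
  "mtrace A = (\<Sum>i<dim_row A. A $$ (i,i))"

definition hermitian :: "nat \<Rightarrow> complex mat \<Rightarrow> bool" where
  "hermitian n A \<longleftrightarrow> A \<in> carrier_mat n n \<and> adj A = A"

definition psd :: "nat \<Rightarrow> complex mat \<Rightarrow> bool" where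
  "psd n A \<longleftrightarrow> A \<in> carrier_mat n n \<and>
     (\<forall>v\<in>carrier_vec n. Im (map_vec cnj v \<bullet> (A *\<^sub>v v)) = 0 \<and>
                          Re (map_vec cnj v \<bullet> (A *\<^sub>v v)) \<ge> 0)"

definition state :: "nat \<Rightarrow> complex mat \<Rightarrow> bool" where
  "state n \<rho> \<longleftrightarrow> psd n \<rho> \<and> mtrace \<rho> = 1"

definition kron :: "complex mat \<Rightarrow> complex mat \<Rightarrow> complex mat" where
  "kron A B = mat (dim_row A * dim_row B) (dim_col A * dim_col B)
     (\<lambda>(r,s). A $$ (r div dim_row B, s div dim_col B) * B $$ (r mod dim_row B, s mod dim_col B))"

definition ptrace_B :: "nat \<Rightarrow> nat \<Rightarrow> complex mat \<Rightarrow> complex mat" where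
  "ptrace_B dA dB M = mat dA dA (\<lambda>(i,j). \<Sum>a<dB. M $$ (i*dB + a, j*dB + a))"

definition ptrace_A :: "nat \<Rightarrow> nat \<Rightarrow> complex mat \<Rightarrow> complex mat" where
  "ptrace_A dA dB M = mat dB dB (\<lambda>(a,b). \<Sum>i<dA. M $$ (i*dB + a, i*dB + b))"

definition ham_sum :: "nat \<Rightarrow> complex mat \<Rightarrow> nat \<Rightarrow> complex mat \<Rightarrow> complex mat" where
  "ham_sum dA HA dB HB = kron HA (1\<^sub>m dB) + kron (1\<^sub>m dA) HB"

definition trace_norm :: "complex mat \<Rightarrow> real" where
  "trace_norm A = Re (mtrace (THE B. psd (dim_col A) B \<and> B * B = adj A * A))"

definition mexp :: "nat \<Rightarrow> complex mat \<Rightarrow> complex mat" where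
  "mexp n A = mat n n (\<lambda>(i,j). \<Sum>k. (A ^\<^sub>m k) $$ (i,j) / of_nat (fact k))"

definition evol :: "nat \<Rightarrow> complex mat \<Rightarrow> real \<Rightarrow> complex mat" where
  "evol n H t = mexp n ((- \<i> * complex_of_real t) \<cdot>\<^sub>m H)"

text \<open>Quantum channels dX -> dY: linear, completely positive, trace-preserving maps.
Complete positivity: (Lambda \<otimes> id_k) maps psd operators to psd operators, for all k.\<close>
definition ext_id :: "nat \<Rightarrow> nat \<Rightarrow> nat \<Rightarrow> (complex mat \<Rightarrow> complex mat) \<Rightarrow> complex mat \<Rightarrow> complex mat" where
  "ext_id dX dY k \<Lambda> M = mat (dY*k) (dY*k) (\<lambda>(r,s).
      \<Lambda> (mat dX dX (\<lambda>(i,j). M $$ (i*k + r mod k, j*k + s mod k))) $$ (r div k, s div k))"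

definition channel :: "nat \<Rightarrow> nat \<Rightarrow> (complex mat \<Rightarrow> complex mat) \<Rightarrow> bool" where
  "channel dX dY \<Lambda> \<longleftrightarrow>
     (\<forall>A\<in>carrier_mat dX dX. \<Lambda> A \<in> carrier_mat dY dY) \<and>
     (\<forall>A\<in>carrier_mat dX dX. \<forall>B\<in>carrier_mat dX dX. \<Lambda> (A + B) = \<Lambda> A + \<Lambda> B) \<and>
     (\<forall>A\<in>carrier_mat dX dX. \<forall>z. \<Lambda> (z \<cdot>\<^sub>m A) = z \<cdot>\<^sub>m \<Lambda> A) \<and>
     (\<forall>A\<in>carrier_mat dX dX. mtrace (\<Lambda> A) = mtrace A) \<and>
     (\<forall>k M. psd (dX*k) M \<longrightarrow> psd (dY*k) (ext_id dX dY k \<Lambda> M))"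

definition covariant :: "nat \<Rightarrow> complex mat \<Rightarrow> nat \<Rightarrow> complex mat \<Rightarrow> (complex mat \<Rightarrow> complex mat) \<Rightarrow> bool" where
  "covariant dX HX dY HY \<Lambda> \<longleftrightarrow>
     (\<forall>\<sigma> t. state dX \<sigma> \<longrightarrow>
        \<Lambda> (evol dX HX t * \<sigma> * adj (evol dX HX t)) = evol dY HY t * \<Lambda> \<sigma> * adj (evol dY HY t))"

text \<open>Spectral projector of H for the value E (zero if E is not an eigenvalue).\<close>
definition spec_proj :: "nat \<Rightarrow> complex mat \<Rightarrow> real \<Rightarrow> complex mat" where
  "spec_proj n H E = (THE P. P \<in> carrier_mat n n \<and> P * P = P \<and> adj P = P \<and>
      (\<forall>v\<in>carrier_vec n. P *\<^sub>v v = v \<longleftrightarrow> H *\<^sub>v v = complex_of_real E \<cdot>\<^sub>v v))"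

definition modes :: "nat \<Rightarrow> complex mat \<Rightarrow> complex mat \<Rightarrow> real set" where
  "modes n H \<sigma> = {E - F | E F. spec_proj n H E * \<sigma> * spec_proj n H F \<noteq> 0\<^sub>m n n}"

definition coh_group :: "nat \<Rightarrow> complex mat \<Rightarrow> complex mat \<Rightarrow> real set" where
  "coh_group n H \<sigma> = {(\<Sum>x\<in>F. of_int (k x) * x) | F k. finite F \<and> F \<subseteq> modes n H \<sigma>}"

definition full_rank :: "nat \<Rightarrow> complex mat \<Rightarrow> bool" where
  "full_rank n A \<longleftrightarrow> vec_space.rank n A = n"

end

theory Submission
  imports Defs "Jordan_Normal_Form.Spectral_Radius" "HOL-Library.FuncSet"
begin

text \<open>The idea is to use many copies of \<rho> as a measured phase reference. In the energy
  eigenbasis, measure n copies with the rank-one POVM whose vectors have independent q-th roots of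
  unity as entries; the empirical mean of the products u_i * cnj u_j estimates \<rho>_ij, so the
  argument of the mean estimates the phase of every nonzero coherence with error of order
  1 / sqrt n. The hypothesis on coherence groups writes every energy difference occurring in \<rho>'
  as an integer combination of energy differences occurring in \<rho>, so from the estimated phases
  one can prepare arbitrarily many rotated copies of \<rho>', with rotation tending to the identity.
  All degrees involved are bounded, so for large q equivariance under q-th roots of unity already is
  exact covariance under time evolution.

  The catalyst spreads this n-copy protocol over time: it is the uniform mixture over k < n of k
  collected copies of \<rho> and n - 1 - k stored copies of the output. Each round either stores
  the new input and releases one output, or, when n inputs are available, measures them and prepares n new outputs. The
  catalyst marginal is exactly preserved, and conditioned on the estimate u the released system is
  in the product state \<rho>'_u \<otimes> c_u with \<rho>'_u close to \<rho>' on average; no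
  closeness of the joint outputs to a product state is needed.

  On average over u the entries of \<rho>'_u are those of \<rho>' multiplied by factors \<chi>_rs
  near 1. If \<rho>' has full rank, \<rho>'_rs / \<chi>_rs is still a state, and aiming at it
  makes the marginal exact.\<close>

section \<open>The spectral theorem\<close>

text \<open>Time evolution may be non-periodic, so it offers no finite group by which a measurement
  could be indexed. The symmetry imposed instead rephases each level of an eigenbasis separately by
  \<open>q\<close>-th roots of unity. A matrix element of the measure-and-prepare map survives only
  if, level by level, the occupations of the inputs balance the integer weights of the outputs
  modulo \<open>q\<close>; for \<open>q\<close> above the largest possible imbalance they balance
  exactly, and weighting by energies gives conservation. The error bounds do not involve
  \<open>q\<close>, so the number of copies is fixed before \<open>q\<close>.

  The rotated outputs have to be states, so the rotation is conjugation by a diagonal unitary; this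
  is why the integer coordinates of energy differences must have the form \<open>k r - k s\<close>.

  The catalyst grows with the number of copies, so the bound on the joint state must be free of its
  dimension. The joint error is exactly the average over \<open>u\<close> of (rotated output minus
  target) tensored with the normalised \<open>c_u\<close>; hence its trace norm is controlled by the
  error on the output alone.\<close>

lemma adj_carrier [simp, intro]: "A \<in> carrier_mat n m \<Longrightarrow> adj A \<in> carrier_mat m n"
  by (auto simp: adj_def)

lemma dim_adj [simp]: "dim_row (adj A) = dim_col A" "dim_col (adj A) = dim_row A"
  by (auto simp: adj_def)

lemma adj_index [simp]: "i < dim_col A \<Longrightarrow> j < dim_row A \<Longrightarrow> adj A $$ (i,j) = cnj (A $$ (j,i))"
  by (simp add: adj_def)

lemma adj_adj [simp]: "adj (adj A) = A"
  by (rule eq_matI) auto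

lemma adj_one [simp]: "adj (1\<^sub>m n) = 1\<^sub>m n"
  by (rule eq_matI) auto

lemma mult_index:
  assumes "A \<in> carrier_mat n m" "B \<in> carrier_mat m k" "i < n" "j < k"
  shows "(A * B) $$ (i,j) = (\<Sum>l<m. A $$ (i,l) * B $$ (l,j))"
  using assms by (simp add: scalar_prod_def lessThan_atLeast0)

lemma mult_mult_index:
  assumes "A \<in> carrier_mat n m" "B \<in> carrier_mat m k" "C \<in> carrier_mat k l" "i < n" "j < l"
  shows "(A * B * C) $$ (i,j) = (\<Sum>b<k. \<Sum>a<m. A $$ (i,a) * B $$ (a,b) * C $$ (b,j))"
proof -
  have AB: "A * B \<in> carrier_mat n k" using assms by auto
  show ?thesis
    by (simp add: mult_index[OF AB assms(3,4,5)] mult_index[OF assms(1,2,4)] sum_distrib_right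
        del: index_mult_mat)
qed

lemma adj_mult:
  assumes "A \<in> carrier_mat n m" "B \<in> carrier_mat m k"
  shows "adj (A * B) = adj B * adj A"
proof (rule eq_matI)
  fix i j assume "i < dim_row (adj B * adj A)" "j < dim_col (adj B * adj A)"
  then have i: "i < k" and j: "j < n" using assms by auto
  have *: "adj (A * B) $$ (i,j) = cnj ((A * B) $$ (j,i))"
    using assms i j by simp
  show "adj (A * B) $$ (i,j) = (adj B * adj A) $$ (i,j)"
    unfolding * mult_index[OF assms j i]
      mult_index[OF adj_carrier[OF assms(2)] adj_carrier[OF assms(1)] i j]
    using assms i j by (simp add: mult.commute)
qed (use assms in auto)

definition diagm :: "nat \<Rightarrow> (nat \<Rightarrow> complex) \<Rightarrow> complex mat" where
  "diagm n f = mat n n (\<lambda>(i,j). if i = j then f i else 0)"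

lemma diagm_carrier [simp, intro]: "diagm n f \<in> carrier_mat n n"
  by (simp add: diagm_def)

lemma dim_diagm [simp]: "dim_row (diagm n f) = n" "dim_col (diagm n f) = n"
  by (auto simp: diagm_def)

lemma diagm_index [simp]: "i < n \<Longrightarrow> j < n \<Longrightarrow> diagm n f $$ (i,j) = (if i = j then f i else 0)"
  by (simp add: diagm_def)

lemma diagm_conj_index:
  assumes "U \<in> carrier_mat m n" "W \<in> carrier_mat k n" "i < m" "j < k"
  shows "(U * diagm n f * adj W) $$ (i,j) = (\<Sum>l<n. U $$ (i,l) * f l * cnj (W $$ (j,l)))"
  unfolding mult_mult_index[OF assms(1) diagm_carrier adj_carrier[OF assms(2)] assms(3,4)]
proof (rule sum.cong)
  fix b assume "b \<in> {..<n}"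
  then have b: "b < n" by simp
  have "(\<Sum>a<n. U $$ (i, a) * diagm n f $$ (a, b) * adj W $$ (b, j))
      = (\<Sum>a<n. if a = b then U $$ (i,a) * f a * cnj (W $$ (j,a)) else 0)"
    by (rule sum.cong) (use assms b in auto)
  also have "\<dots> = U $$ (i,b) * f b * cnj (W $$ (j,b))"
    using b by (subst sum.delta) auto
  finally show "(\<Sum>a<n. U $$ (i, a) * diagm n f $$ (a, b) * adj W $$ (b, j))
      = U $$ (i,b) * f b * cnj (W $$ (j,b))" .
qed simp

lemma diagm_mult: "diagm n f * diagm n g = diagm n (\<lambda>i. f i * g i)"
proof (rule eq_matI)
  fix i j assume "i < dim_row (diagm n (\<lambda>i. f i * g i))" "j < dim_col (diagm n (\<lambda>i. f i * g i))"
  then have i: "i < n" and j: "j < n" by auto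
  have "(diagm n f * diagm n g) $$ (i,j) = (\<Sum>l<n. if l = i then (if i = j then f i * g i else 0) else 0)"
    unfolding mult_index[OF diagm_carrier diagm_carrier i j]
    by (rule sum.cong) (use i j in auto)
  also have "\<dots> = diagm n (\<lambda>i. f i * g i) $$ (i,j)"
    using i j by (subst sum.delta) auto
  finally show "(diagm n f * diagm n g) $$ (i,j) = diagm n (\<lambda>i. f i * g i) $$ (i,j)" .
qed auto

lemma adj_diagm: "adj (diagm n f) = diagm n (\<lambda>i. cnj (f i))"
  by (rule eq_matI) auto

definition unitary :: "nat \<Rightarrow> complex mat \<Rightarrow> bool" where
  "unitary n U \<longleftrightarrow> U \<in> carrier_mat n n \<and> adj U * U = 1\<^sub>m n"

text \<open>For square matrices a left inverse is a right inverse, so the definition asks for one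
  identity only.\<close>

lemma unitaryD:
  assumes "unitary n U"
  shows "U \<in> carrier_mat n n" "adj U * U = 1\<^sub>m n" "U * adj U = 1\<^sub>m n"
proof -
  show U: "U \<in> carrier_mat n n" and UU: "adj U * U = 1\<^sub>m n" using assms by (auto simp: unitary_def)
  show "U * adj U = 1\<^sub>m n" by (rule mat_mult_left_right_inverse[OF adj_carrier[OF U] U UU])
qed

lemma unitary_adj: "unitary n U \<Longrightarrow> unitary n (adj U)"
  using unitaryD(1,3) unfolding unitary_def by (simp add: adj_carrier)

lemma unitary_one: "unitary n (1\<^sub>m n)"
  by (simp add: unitary_def)

lemma unitary_mult:
  assumes "unitary n U" "unitary n W"
  shows "unitary n (U * W)"
proof -
  note U = unitaryD[OF assms(1)] and W = unitaryD[OF assms(2)]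
  have "adj (U * W) * (U * W) = adj W * (adj U * U) * W"
    using assoc_mult_mat[of "adj W" n n "adj U" n "U * W" n] assoc_mult_mat[of "adj U" n n U n W n]
      assoc_mult_mat[of "adj W" n n "adj U * U" n W n] U(1) W(1) 
    by (simp add: adj_mult[OF U(1) W(1)] mult_carrier_mat[of _ n n _ n])
  also have "\<dots> = 1\<^sub>m n" using U W adj_carrier[OF W(1)] by simp
  finally show ?thesis using U(1) W(1) by (auto simp: unitary_def)
qed

lemma unitary_orthonormal_cols:
  assumes "unitary n U" "i < n" "j < n"
  shows "(\<Sum>l<n. cnj (U $$ (l,i)) * U $$ (l,j)) = (if i = j then 1 else 0)"
proof -
  note U = unitaryD[OF assms(1)]
  have "(adj U * U) $$ (i,j) = (\<Sum>l<n. adj U $$ (i,l) * U $$ (l,j))"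
    by (rule mult_index) (use U assms in auto)
  then show ?thesis using U assms by (simp del: index_mult_mat)
qed

lemma unitary_orthonormal_rows:
  assumes "unitary n U" "i < n" "j < n"
  shows "(\<Sum>l<n. U $$ (i,l) * cnj (U $$ (j,l))) = (if i = j then 1 else 0)"
  using unitary_orthonormal_cols[OF unitary_adj[OF assms(1)] assms(2,3)] unitaryD(1)[OF assms(1)] assms(2,3)
  by simp

lemma hermitianD: "hermitian n A \<Longrightarrow> i < n \<Longrightarrow> j < n \<Longrightarrow> A $$ (i,j) = cnj (A $$ (j,i))"
  unfolding hermitian_def by (metis adj_index carrier_matD)

lemma hermitian_conj:
  assumes "hermitian n A" "W \<in> carrier_mat m n"
  shows "hermitian m (W * A * adj W)"
proof -
  have A: "A \<in> carrier_mat n n" "adj A = A" using assms by (auto simp: hermitian_def)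
  have "adj (W * A * adj W) = W * (adj A * adj W)"
    using A(1) assms(2) adj_mult[of "W * A" m n "adj W" m] adj_mult[of W m n A n] by auto
  also have "\<dots> = W * A * adj W" using A assms(2) by (simp add: assoc_mult_mat[of _ m n _ n _ m])
  finally show ?thesis using A(1) assms(2) by (auto simp: hermitian_def)
qed

text \<open>The deflation step: over the complex numbers an eigenvector exists, and
  \<open>gram_schmidt\<close> applied to a basis completion of it keeps the head, so the eigenvector
  becomes, up to normalisation, the first column of \<open>U\<close>.\<close>

lemma unitary_with_eigenvector:
  assumes A: "A \<in> carrier_mat (Suc n) (Suc n)"
  shows "\<exists>U e. unitary (Suc n) U \<and>
    (\<forall>i<Suc n. (adj U * A * U) $$ (i,0) = (if i = 0 then e else 0))"
proof -
  let ?m = "Suc n"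
  obtain e where "eigenvalue A e"
    using spectrum_non_empty[OF A] by (auto simp: spectrum_def)
  then obtain v where "eigenvector A v e" by (auto simp: eigenvalue_def)
  then have v: "v \<in> carrier_vec ?m" and v0: "v \<noteq> 0\<^sub>v ?m" and Av: "A *\<^sub>v v = e \<cdot>\<^sub>v v"
    using A by (auto simp: eigenvector_def)
  interpret cof_vec_space ?m "TYPE(complex)" .
  define b where "b = basis_completion v"
  define ws where "ws = gram_schmidt ?m b"
  note bc = basis_completion[OF v v0, folded b_def]
  have len_b: "length b = ?m" and hdb: "hd b = v" using bc by auto
  then obtain vs where bv: "b = v # vs" by (cases b) auto
  have ws: "set ws \<subseteq> carrier_vec ?m" "corthogonal ws" "length ws = ?m"
    using gram_schmidt_result[OF bc(2,4,5) refl, folded ws_def] len_b by auto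
  have hdws: "ws ! 0 = v"
    using gram_schmidt_hd[OF v, of vs, folded bv] ws(3) hd_conv_nth[of ws]
    unfolding ws_def[symmetric] by (cases ws) auto
  have wi: "ws ! i \<in> carrier_vec ?m" if "i < ?m" for i using ws that by (auto dest: nth_mem)
  \<comment> \<open>\<open>gram_schmidt\<close> returns orthogonal but unnormalised vectors;
    \<open>nr\<close> holds their lengths.\<close>
  define nr where "nr i = sqrt (\<Sum>l<?m. (cmod (ws ! i $ l))\<^sup>2)" for i
  have ip: "ws ! j \<bullet>c ws ! i = (\<Sum>l<?m. cnj (ws ! i $ l) * ws ! j $ l)" if "i < ?m" "j < ?m" for i j
    using wi[OF that(1)] wi[OF that(2)]
    by (simp add: scalar_prod_def lessThan_atLeast0 mult.commute)
  have sq: "(\<Sum>l<?m. cnj (ws ! i $ l) * ws ! i $ l) = complex_of_real ((nr i)\<^sup>2)" for i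
  proof -
    have "(nr i)\<^sup>2 = (\<Sum>l<?m. (cmod (ws ! i $ l))\<^sup>2)"
      unfolding nr_def by (rule real_sqrt_pow2) (simp add: sum_nonneg)
    then show ?thesis by (simp only: of_real_sum complex_norm_square mult.commute)
  qed
  have nr0: "nr i \<noteq> 0" if "i < ?m" for i
    using corthogonalD[OF ws(2), of i i] ws(3) that ip[OF that that] sq[of i] by auto
  define U where "U = mat ?m ?m (\<lambda>(l,i). ws ! i $ l / nr i)"
  have U: "U \<in> carrier_mat ?m ?m" by (simp add: U_def)
  have "adj U * U = 1\<^sub>m ?m"
  proof (rule eq_matI)
    fix i j assume "i < dim_row (1\<^sub>m ?m :: complex mat)" "j < dim_col (1\<^sub>m ?m :: complex mat)"
    then have i: "i < ?m" and j: "j < ?m" by auto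
    have "(adj U * U) $$ (i,j) = (\<Sum>l<?m. cnj (ws ! i $ l) * ws ! j $ l / (nr i * nr j))"
      unfolding mult_index[OF adj_carrier[OF U] U i j]
      by (rule sum.cong) (use i j in \<open>auto simp: U_def\<close>)
    also have "\<dots> = (\<Sum>l<?m. cnj (ws ! i $ l) * ws ! j $ l) / (nr i * nr j)"
      by (simp only: sum_divide_distrib)
    also have "\<dots> = (if i = j then 1 else 0)"
    proof (cases "i = j")
      case True
      then show ?thesis using nr0[OF i] unfolding True sq by (simp add: power2_eq_square)
    next
      case False
      then show ?thesis using corthogonalD[OF ws(2), of j i] ws(3) i j ip[OF i j] by auto
    qed
    finally show "(adj U * U) $$ (i,j) = 1\<^sub>m ?m $$ (i,j)" using i j by simp
  qed (use U in auto)
  then have uU: "unitary ?m U" using U by (simp add: unitary_def)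
  have "(adj U * A * U) $$ (i,0) = (if i = 0 then e else 0)" if i: "i < ?m" for i
  proof -
    have AU: "(A * U) $$ (k,0) = e * U $$ (k,0)" if k: "k < ?m" for k
    proof -
      have "(A * U) $$ (k,0) = (\<Sum>l<?m. A $$ (k,l) * v $ l) / nr 0"
        unfolding mult_index[OF A U k zero_less_Suc] sum_divide_distrib
        by (rule sum.cong) (auto simp: U_def hdws)
      also have "(\<Sum>l<?m. A $$ (k,l) * v $ l) = (A *\<^sub>v v) $ k"
        using A v k by (simp add: scalar_prod_def lessThan_atLeast0)
      also have "\<dots> = e * v $ k" unfolding Av using v k by simp
      finally show ?thesis using k by (simp add: U_def hdws)
    qed
    have "(adj U * A * U) $$ (i,0) = (adj U * (A * U)) $$ (i,0)"
      using A U by (simp add: assoc_mult_mat[of _ ?m ?m _ ?m _ ?m])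
    also have "\<dots> = (\<Sum>k<?m. adj U $$ (i,k) * (A * U) $$ (k,0))"
      by (rule mult_index) (use A U i in auto)
    also have "\<dots> = (\<Sum>k<?m. e * (cnj (U $$ (k,i)) * U $$ (k,0)))"
      by (rule sum.cong) (use U i AU in \<open>auto simp del: index_mult_mat\<close>)
    also have "\<dots> = (if i = 0 then e else 0)"
      using unitary_orthonormal_cols[OF uU i zero_less_Suc] by (simp add: sum_distrib_left[symmetric])
    finally show ?thesis .
  qed
  with uU show ?thesis by (intro exI conjI allI impI)
qed

lemma conj_conj:
  assumes A: "A \<in> carrier_mat n n" and U: "U \<in> carrier_mat m n" and W: "W \<in> carrier_mat k m"
  shows "W * (U * A * adj U) * adj W = (W * U) * A * adj (W * U)"
proof -
  have UA: "U * A \<in> carrier_mat m n" using U A by auto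
  have "W * (U * A * adj U) = W * (U * A) * adj U"
    by (rule assoc_mult_mat[symmetric, OF W UA adj_carrier[OF U]])
  also have "\<dots> * adj W = W * (U * A) * (adj U * adj W)"
    by (rule assoc_mult_mat[OF mult_carrier_mat[OF W UA] adj_carrier[OF U] adj_carrier[OF W]])
  also have "W * (U * A) = W * U * A"
    by (rule assoc_mult_mat[symmetric, OF W U A])
  finally show ?thesis by (simp add: adj_mult[OF W U])
qed

lemma unitary_cancel:
  assumes "unitary n U" "A \<in> carrier_mat n n"
  shows "U * (adj U * A * U) * adj U = A" "adj U * (U * A * adj U) * U = A"
proof -
  note U = unitaryD[OF assms(1)]
  show "U * (adj U * A * U) * adj U = A" 
    using conj_conj[OF assms(2) adj_carrier[OF U(1)] U(1)] U assms(2) by simp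
  show "adj U * (U * A * adj U) * U = A"
    using conj_conj[OF assms(2) U(1) adj_carrier[OF U(1)]] U assms(2) by simp
qed

text \<open>Induction by deflation. Conjugation with the unitary of
  \<open>unitary_with_eigenvector\<close> clears the first column below the corner; hermiticity then
  clears the first row and makes the corner entry real, and the remaining block is Hermitian of size
  \<open>n\<close>.\<close>

theorem spectral_theorem:
  assumes "hermitian n A"
  obtains U d where "unitary n U" "A = U * diagm n (\<lambda>i. complex_of_real (d i)) * adj U"
  using assms
proof (induction n arbitrary: A thesis)
  case 0
  have "A = 1\<^sub>m 0 * diagm 0 (\<lambda>i. complex_of_real 0) * adj (1\<^sub>m 0)"
    using 0(2) by (auto simp: hermitian_def)
  then show ?case using 0(1)[OF unitary_one, of "\<lambda>_. 0"] by simp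
next
  case (Suc n)
  let ?m = "Suc n"
  have A: "A \<in> carrier_mat ?m ?m" using Suc.prems by (auto simp: hermitian_def)
  obtain U e where U: "unitary ?m U"
    and col0': "\<forall>i<?m. (adj U * A * U) $$ (i,0) = (if i = 0 then e else 0)"
    using unitary_with_eigenvector[OF A] by (elim exE conjE)
  have col0: "(adj U * A * U) $$ (i,0) = (if i = 0 then e else 0)" if "i < ?m" for i
    using col0'[rule_format, OF that] .
  note Uc = unitaryD(1)[OF U]
  define B where "B = adj U * A * U"
  have hB: "hermitian ?m B"
    unfolding B_def using hermitian_conj[OF Suc.prems(2) adj_carrier[OF Uc]] by simp
  then have B: "B \<in> carrier_mat ?m ?m" by (auto simp: hermitian_def)
  define B' where "B' = mat n n (\<lambda>(i,j). B $$ (Suc i, Suc j))"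
  have "hermitian n B'"
    unfolding hermitian_def
  proof
    show "adj B' = B'"
      by (rule eq_matI) (auto simp: B'_def intro: hermitianD[OF hB, symmetric])
  qed (simp add: B'_def)
  then obtain W d where W: "unitary n W" and B'W: "B' = W * diagm n (\<lambda>i. complex_of_real (d i)) * adj W"
    using Suc.IH by blast
  note Wc = unitaryD(1)[OF W]
  define W' where "W' = mat ?m ?m (\<lambda>(i,j). if i = 0 \<and> j = 0 then 1 else if i = 0 \<or> j = 0 then 0 
      else W $$ (i - 1, j - 1))"
  \<comment> \<open>The eigenvalues are typed as reals, so the corner enters as \<open>Re e\<close>;
    \<open>Ime\<close> below shows that nothing is lost.\<close>
  define d' where "d' i = (case i of 0 \<Rightarrow> Re e | Suc k \<Rightarrow> d k)" for i
  have W'c: "W' \<in> carrier_mat ?m ?m" by (simp add: W'_def)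
  have "adj W' * W' = 1\<^sub>m ?m"
  proof (rule eq_matI)
    fix i j assume "i < dim_row (1\<^sub>m ?m :: complex mat)" "j < dim_col (1\<^sub>m ?m :: complex mat)"
    then have i: "i < ?m" and j: "j < ?m" by auto
    have "(adj W' * W') $$ (i,j) = (\<Sum>l<?m. cnj (W' $$ (l,i)) * W' $$ (l,j))"
      unfolding mult_index[OF adj_carrier[OF W'c] W'c i j]
      by (rule sum.cong) (use i j W'c in auto)
    also have "\<dots> = cnj (W' $$ (0,i)) * W' $$ (0,j) + (\<Sum>l<n. cnj (W' $$ (Suc l,i)) * W' $$ (Suc l,j))"
      by (rule sum.lessThan_Suc_shift)
    also have "\<dots> = (if i = j then 1 else 0)"
      using unitary_orthonormal_cols[OF W, of "i - 1" "j - 1"] i j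
      by (cases i; cases j) (auto simp: W'_def)
    finally show "(adj W' * W') $$ (i,j) = 1\<^sub>m ?m $$ (i,j)" using i j by simp
  qed (use W'c in auto)
  then have uW': "unitary ?m W'" using W'c by (simp add: unitary_def)
  have Ime: "Im e = 0"
    using hermitianD[OF hB, of 0 0] col0[of 0] unfolding B_def[symmetric] by (simp add: complex_eq_iff)
  have "B = W' * diagm ?m (\<lambda>i. complex_of_real (d' i)) * adj W'"
  proof (rule eq_matI)
    fix i j assume "i < dim_row (W' * diagm ?m (\<lambda>i. complex_of_real (d' i)) * adj W')"
      "j < dim_col (W' * diagm ?m (\<lambda>i. complex_of_real (d' i)) * adj W')"
    then have i: "i < ?m" and j: "j < ?m" using W'c by auto
    have *: "B' $$ (k,l) = (\<Sum>a<n. W $$ (k,a) * complex_of_real (d a) * cnj (W $$ (l,a)))"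
      if "k < n" "l < n" for k l
      unfolding B'W using diagm_conj_index[OF Wc Wc that] .
    have "(W' * diagm ?m (\<lambda>i. complex_of_real (d' i)) * adj W') $$ (i,j)
      = (\<Sum>l<?m. W' $$ (i,l) * complex_of_real (d' l) * cnj (W' $$ (j,l)))"
      by (rule diagm_conj_index[OF W'c W'c i j])
    also have "\<dots> = W' $$ (i,0) * complex_of_real (d' 0) * cnj (W' $$ (j,0))
      + (\<Sum>l<n. W' $$ (i,Suc l) * complex_of_real (d' (Suc l)) * cnj (W' $$ (j,Suc l)))"
      by (rule sum.lessThan_Suc_shift)
    also have "\<dots> = B $$ (i,j)"
      using *[of "i - 1" "j - 1"] i j col0[of i, folded B_def] col0[of j, folded B_def] Ime
        hermitianD[OF hB, of 0 j]
      by (cases i; cases j) (auto simp: W'_def d'_def B'_def complex_eq_iff)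
    finally show "B $$ (i,j) = (W' * diagm ?m (\<lambda>i. complex_of_real (d' i)) * adj W') $$ (i,j)" by simp
  qed (use B W'c in auto)
  moreover have "A = U * B * adj U"
    unfolding B_def using unitary_cancel(1)[OF U A] by simp
  ultimately have "A = (U * W') * diagm ?m (\<lambda>i. complex_of_real (d' i)) * adj (U * W')"
    using conj_conj[OF diagm_carrier W'c Uc] by simp
  then show ?case using Suc.prems(1)[OF unitary_mult[OF U uW']] by blast
qed

section \<open>Positive kernels and the trace norm\<close>

text \<open>Positive semidefiniteness for a kernel on any index set, so that pairs and catalyst
  configurations can serve as indices without being numbered first. In the order on complex numbers
  \<open>0 \<le> z\<close> includes \<open>Im z = 0\<close>, so the condition also carries
  hermiticity.\<close>

definition pos :: "'a set \<Rightarrow> ('a \<Rightarrow> 'a \<Rightarrow> complex) \<Rightarrow> bool" where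
  "pos X K \<longleftrightarrow> (\<forall>f. 0 \<le> (\<Sum>x\<in>X. \<Sum>y\<in>X. cnj (f x) * K x y * f y))"

lemma cnj_mult_self_nonneg: "0 \<le> cnj z * z"
  by (simp add: less_eq_complex_def)

lemma complex_of_real_nonneg: "0 \<le> r \<Longrightarrow> 0 \<le> complex_of_real r"
  by (simp add: less_eq_complex_def)

lemma pos_cong:
  assumes "\<And>x y. x \<in> X \<Longrightarrow> y \<in> X \<Longrightarrow> K x y = L x y"
  shows "pos X K \<longleftrightarrow> pos X L"
  unfolding pos_def using assms by (auto intro!: arg_cong[where f="\<lambda>z. 0 \<le> z"] sum.cong cong: sum.cong)

lemma psd_iff_pos: "psd n A \<longleftrightarrow> A \<in> carrier_mat n n \<and> pos {..<n} (\<lambda>i j. A $$ (i,j))"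
proof (cases "A \<in> carrier_mat n n")
  case A: True
  have eq: "map_vec cnj v \<bullet> (A *\<^sub>v v) = (\<Sum>i<n. \<Sum>j<n. cnj (v $ i) * A $$ (i,j) * v $ j)"
    if "v \<in> carrier_vec n" for v
    using A that by (simp add: scalar_prod_def lessThan_atLeast0 sum_distrib_left mult.assoc)
  have "(\<forall>v\<in>carrier_vec n. 0 \<le> (\<Sum>i<n. \<Sum>j<n. cnj (v $ i) * A $$ (i,j) * v $ j)) \<longleftrightarrow>
    (\<forall>f. 0 \<le> (\<Sum>i<n. \<Sum>j<n. cnj (f i) * A $$ (i,j) * f j))" (is "?L \<longleftrightarrow> ?R")
  proof
    assume L: ?L
    show ?R
    proof
      fix f :: "nat \<Rightarrow> complex"
      show "0 \<le> (\<Sum>i<n. \<Sum>j<n. cnj (f i) * A $$ (i,j) * f j)"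
        using L[rule_format, of "vec n f"] by simp
    qed
  qed blast
  then show ?thesis using A unfolding psd_def pos_def
    by (auto simp: eq less_eq_complex_def)
qed (simp add: psd_def)

lemma pos_gram:
  assumes "\<And>x y. x \<in> X \<Longrightarrow> y \<in> X \<Longrightarrow> K x y = (\<Sum>a\<in>I. g x a * cnj (g y a))"
  shows "pos X K"
  unfolding pos_def
proof
  fix f
  have "(\<Sum>x\<in>X. \<Sum>y\<in>X. cnj (f x) * K x y * f y)
      = (\<Sum>x\<in>X. \<Sum>y\<in>X. \<Sum>a\<in>I. (cnj (f x) * g x a) * (cnj (g y a) * f y))"
    by (simp add: assms sum_distrib_left sum_distrib_right mult.assoc)
  also have "\<dots> = (\<Sum>a\<in>I. \<Sum>x\<in>X. \<Sum>y\<in>X. (cnj (f x) * g x a) * (cnj (g y a) * f y))"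
    by (simp only: sum.swap[of _ I X])
  also have "\<dots> = (\<Sum>a\<in>I. cnj (\<Sum>y\<in>X. cnj (g y a) * f y) * (\<Sum>y\<in>X. cnj (g y a) * f y))"
    by (subst sum.swap[of _ X X]) (simp add: sum_product mult_ac)
  finally show "0 \<le> (\<Sum>x\<in>X. \<Sum>y\<in>X. cnj (f x) * K x y * f y)"
    by (simp only: sum_nonneg cnj_mult_self_nonneg)
qed

lemma pos_sum:
  assumes "\<And>u. u \<in> U \<Longrightarrow> pos X (K u)"
  shows "pos X (\<lambda>x y. \<Sum>u\<in>U. K u x y)"
  unfolding pos_def
proof
  fix f
  have "(\<Sum>x\<in>X. \<Sum>y\<in>X. cnj (f x) * (\<Sum>u\<in>U. K u x y) * f y)
      = (\<Sum>x\<in>X. \<Sum>y\<in>X. \<Sum>u\<in>U. cnj (f x) * K u x y * f y)"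
    by (simp add: sum_distrib_left sum_distrib_right)
  also have "\<dots> = (\<Sum>u\<in>U. \<Sum>x\<in>X. \<Sum>y\<in>X. cnj (f x) * K u x y * f y)"
    by (simp only: sum.swap[of _ U X])
  finally show "0 \<le> (\<Sum>x\<in>X. \<Sum>y\<in>X. cnj (f x) * (\<Sum>u\<in>U. K u x y) * f y)"
    using assms by (simp add: pos_def sum_nonneg)
qed

lemma pos_scale:
  assumes "0 \<le> c" "pos X K"
  shows "pos X (\<lambda>x y. c * K x y)"
  unfolding pos_def
proof
  fix f
  have "(\<Sum>x\<in>X. \<Sum>y\<in>X. cnj (f x) * (c * K x y) * f y) = c * (\<Sum>x\<in>X. \<Sum>y\<in>X. cnj (f x) * K x y * f y)"
    by (simp add: sum_distrib_left mult_ac)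
  then show "0 \<le> (\<Sum>x\<in>X. \<Sum>y\<in>X. cnj (f x) * (c * K x y) * f y)"
    using assms by (simp add: pos_def)
qed

lemma pos_add: "pos X K \<Longrightarrow> pos X L \<Longrightarrow> pos X (\<lambda>x y. K x y + L x y)"
  using pos_sum[of "UNIV :: bool set" X "\<lambda>b. if b then K else L"] by (simp add: UNIV_bool add.commute)

lemma pos_reindex:
  fixes K :: "'a \<Rightarrow> 'a \<Rightarrow> complex" and h :: "'b \<Rightarrow> 'a"
  assumes "bij_betw h Y X" "pos X K"
  shows "pos Y (\<lambda>a b. K (h a) (h b))"
  unfolding pos_def
proof
  fix f :: "'b \<Rightarrow> complex"
  define g where "g x = f (inv_into Y h x)" for x
  have g: "g (h a) = f a" if "a \<in> Y" for a
    unfolding g_def using assms(1) that by (simp add: bij_betw_inv_into_left)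
  have "(\<Sum>x\<in>Y. \<Sum>y\<in>Y. cnj (f x) * K (h x) (h y) * f y) = (\<Sum>x\<in>Y. \<Sum>y\<in>Y. cnj (g (h x)) * K (h x) (h y) * g (h y))"
    by (simp add: g)
  also have "\<dots> = (\<Sum>x\<in>Y. \<Sum>y\<in>X. cnj (g (h x)) * K (h x) y * g y)"
    by (simp add: sum.reindex_bij_betw[OF assms(1), of "\<lambda>y. cnj (g (h _)) * K (h _) y * g y"])
  also have "\<dots> = (\<Sum>x\<in>X. \<Sum>y\<in>X. cnj (g x) * K x y * g y)"
    by (rule sum.reindex_bij_betw[OF assms(1)])
  finally show "0 \<le> (\<Sum>x\<in>Y. \<Sum>y\<in>Y. cnj (f x) * K (h x) (h y) * f y)"
    using assms(2) by (simp add: pos_def)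
qed

text \<open>Only \<open>L\<close> is split into a Gram sum: for each \<open>a\<close> the form of
  the product kernel at \<open>f\<close> becomes the form of \<open>K\<close> at \<open>h a\<close>,
  a contraction of \<open>f\<close> with \<open>g\<close>. \<open>K\<close> may thus be any positive
  kernel, while the catalyst supplies \<open>L\<close>.\<close>

lemma pos_tensor_gram:
  assumes K: "pos Y K"
    and L: "\<And>x x'. x \<in> X \<Longrightarrow> x' \<in> X \<Longrightarrow> L x x' = (\<Sum>a\<in>I. g x a * cnj (g x' a))"
  shows "pos (Y \<times> X) (\<lambda>p q. K (fst p) (fst q) * L (snd p) (snd q))"
  unfolding pos_def
proof
  fix f :: "'a \<times> 'b \<Rightarrow> complex"
  define h where "h a y = (\<Sum>x\<in>X. cnj (g x a) * f (y,x))" for a y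
  have "(\<Sum>p\<in>Y\<times>X. \<Sum>q\<in>Y\<times>X. cnj (f p) * (K (fst p) (fst q) * L (snd p) (snd q)) * f q)
     = (\<Sum>y\<in>Y. \<Sum>x\<in>X. \<Sum>y'\<in>Y. \<Sum>x'\<in>X. \<Sum>a\<in>I. (cnj (f (y,x)) * g x a) * K y y' * (cnj (g x' a) * f (y',x')))"
    by (simp add: sum.cartesian_product' L sum_distrib_left sum_distrib_right mult_ac)
  also have "\<dots> = (\<Sum>y\<in>Y. \<Sum>y'\<in>Y. \<Sum>a\<in>I. \<Sum>x\<in>X. \<Sum>x'\<in>X. (cnj (f (y,x)) * g x a) * K y y' * (cnj (g x' a) * f (y',x')))"
    by (simp only: sum.swap[of _ I X] sum.swap[of _ Y X])
  also have "\<dots> = (\<Sum>y\<in>Y. \<Sum>y'\<in>Y. \<Sum>a\<in>I. cnj (h a y) * K y y' * h a y')"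
    by (simp add: h_def sum_distrib_left sum_distrib_right mult_ac)
  also have "\<dots> = (\<Sum>a\<in>I. \<Sum>y\<in>Y. \<Sum>y'\<in>Y. cnj (h a y) * K y y' * h a y')"
    by (simp only: sum.swap[of _ I Y])
  finally show "0 \<le> (\<Sum>p\<in>Y\<times>X. \<Sum>q\<in>Y\<times>X. cnj (f p) * (K (fst p) (fst q) * L (snd p) (snd q)) * f q)"
    using K by (simp add: pos_def sum_nonneg)
qed

text \<open>The sum of all moduli bounds the quadratic form of \<open>A\<close> relative to the
  squared norm of \<open>f\<close>, since any product of two moduli of coordinates is at most
  \<open>N\<close>. The bound is crude, but below \<open>X\<close> indexes the output system, whose
  dimension is fixed.\<close>

lemma pos_diag_dominant:
  assumes X: "finite X" and herm: "\<And>x y. x \<in> X \<Longrightarrow> y \<in> X \<Longrightarrow> A x y = cnj (A y x)"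
    and le: "(\<Sum>x\<in>X. \<Sum>y\<in>X. cmod (A x y)) \<le> \<eta>"
  shows "pos X (\<lambda>x y. (if x = y then complex_of_real \<eta> else 0) + A x y)"
  unfolding pos_def
proof
  fix f
  define N where "N = (\<Sum>x\<in>X. (cmod (f x))\<^sup>2)"
  define Q where "Q = (\<Sum>x\<in>X. \<Sum>y\<in>X. cnj (f x) * A x y * f y)"
  have "(\<Sum>x\<in>X. \<Sum>y\<in>X. cnj (f x) * ((if x = y then complex_of_real \<eta> else 0) + A x y) * f y)
      = (\<Sum>x\<in>X. \<Sum>y\<in>X. (if x = y then cnj (f x) * \<eta> * f x else 0)) + Q"
    unfolding Q_def sum.distrib[symmetric]
    by (intro sum.cong refl) (auto simp: algebra_simps)
  also have "(\<Sum>x\<in>X. \<Sum>y\<in>X. (if x = y then cnj (f x) * \<eta> * f x else 0)) = complex_of_real (\<eta> * N)"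
    using X by (simp add: N_def sum_distrib_left complex_norm_square mult_ac del: of_real_power)
  finally have eq: "(\<Sum>x\<in>X. \<Sum>y\<in>X. cnj (f x) * ((if x = y then complex_of_real \<eta> else 0) + A x y) * f y)
      = complex_of_real (\<eta> * N) + Q" .
  have "cnj Q = (\<Sum>x\<in>X. \<Sum>y\<in>X. f x * cnj (A x y) * cnj (f y))"
    by (simp add: Q_def)
  also have "\<dots> = (\<Sum>x\<in>X. \<Sum>y\<in>X. cnj (f y) * A y x * f x)"
    by (intro sum.cong refl) (simp add: herm[symmetric] mult_ac)
  also have "\<dots> = Q" unfolding Q_def by (rule sum.swap)
  finally have "Im Q = 0" by (simp add: complex_eq_iff)
  have fN: "(cmod (f x))\<^sup>2 \<le> N" if "x \<in> X" for x
    unfolding N_def using that X by (intro member_le_sum) auto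
  have N0: "0 \<le> N" by (simp add: N_def sum_nonneg)
  have ff: "cmod (f x) * cmod (f y) \<le> N" if "x \<in> X" "y \<in> X" for x y
  proof -
    have "cmod (f z) \<le> sqrt N" if "z \<in> X" for z
      using fN[OF that] by (simp add: real_le_rsqrt)
    then have "cmod (f x) * cmod (f y) \<le> sqrt N * sqrt N"
      using that by (intro mult_mono) (auto simp: N0)
    then show ?thesis using N0 by simp
  qed
  have "cmod Q \<le> (\<Sum>x\<in>X. \<Sum>y\<in>X. cmod (A x y) * N)"
    unfolding Q_def
  proof (intro order.trans[OF norm_sum] sum_mono)
    fix x y assume "x \<in> X" "y \<in> X"
    then have "cmod (A x y) * (cmod (f x) * cmod (f y)) \<le> cmod (A x y) * N"
      using ff by (intro mult_left_mono) auto
    then show "cmod (cnj (f x) * A x y * f y) \<le> cmod (A x y) * N" by (simp add: norm_mult mult_ac)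
  qed
  also have "\<dots> \<le> \<eta> * N"
    unfolding sum_distrib_right[symmetric] using le N0 by (rule mult_right_mono)
  finally have "cmod Q \<le> \<eta> * N" .
  with abs_Re_le_cmod[of Q] have "0 \<le> \<eta> * N + Re Q" by linarith
  then show "0 \<le> (\<Sum>x\<in>X. \<Sum>y\<in>X. cnj (f x) * ((if x = y then complex_of_real \<eta> else 0) + A x y) * f y)"
    unfolding eq using \<open>Im Q = 0\<close> by (simp add: less_eq_complex_def)
qed

lemma pos_diag:
  assumes "finite X" "pos X K" "x \<in> X"
  shows "0 \<le> K x x"
proof -
  have "(\<Sum>y\<in>X. \<Sum>z\<in>X. cnj (if y = x then 1 else 0) * K y z * (if z = x then 1 else 0))
    = (\<Sum>y\<in>X. if y = x then (\<Sum>z\<in>X. if z = x then K y z else 0) else 0)"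
    by (intro sum.cong refl) (auto intro: sum.cong)
  also have "\<dots> = K x x" using assms by simp
  finally show ?thesis using assms(2)[unfolded pos_def, rule_format, of "\<lambda>y. if y = x then 1 else 0"] by simp
qed

text \<open>Polarisation: testing the form on vectors supported on \<open>{x, y}\<close> with
  coefficients \<open>1, 1\<close> and \<open>1, \<i>\<close> matches the imaginary and the real
  parts. Since \<open>psd\<close> is defined through the quadratic form alone, this is what gives
  access to the spectral theorem.\<close>

lemma pos_hermitian:
  assumes X: "finite X" and K: "pos X K" and xy: "x \<in> X" "y \<in> X"
  shows "K x y = cnj (K y x)"
proof (cases "x = y")
  case True
  then show ?thesis using pos_diag[OF X K, of x] xy by (auto simp: less_eq_complex_def complex_eq_iff)
next
  case False
  have exp: "0 \<le> cnj a * K x x * a + cnj a * K x y * b + (cnj b * K y x * a + cnj b * K y y * b)" for a b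
  proof -
    define f where "f z = (if z = x then a else if z = y then b else 0)" for z
    have inner: "(\<Sum>w\<in>X. cnj (f z) * K z w * f w) = cnj (f z) * K z x * a + cnj (f z) * K z y * b" for z
    proof -
      have "(\<Sum>w\<in>X. cnj (f z) * K z w * f w) = (\<Sum>w\<in>{x,y}. cnj (f z) * K z w * f w)"
        using xy X by (intro sum.mono_neutral_right) (auto simp: f_def)
      then show ?thesis using False by (simp add: f_def)
    qed
    have "(\<Sum>z\<in>X. \<Sum>w\<in>X. cnj (f z) * K z w * f w) 
      = (\<Sum>z\<in>{x,y}. cnj (f z) * K z x * a + cnj (f z) * K z y * b)"
      unfolding inner using xy X by (intro sum.mono_neutral_right) (auto simp: f_def)
    also have "\<dots> = cnj a * K x x * a + cnj a * K x y * b + (cnj b * K y x * a + cnj b * K y y * b)"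
      using False by (simp add: f_def)
    finally show ?thesis using K[unfolded pos_def, rule_format, of f] by simp
  qed
  have d: "Im (K x x) = 0" "Im (K y y) = 0"
    using pos_diag[OF X K] xy by (auto simp: less_eq_complex_def)
  from exp[of 1 1] exp[of 1 \<i>] d show ?thesis
    by (simp add: less_eq_complex_def complex_eq_iff)
qed

lemma psd_hermitian: "psd n A \<Longrightarrow> hermitian n A"
  unfolding hermitian_def psd_iff_pos
  by (auto intro!: eq_matI intro: pos_hermitian[symmetric, of "{..<n}" "\<lambda>i j. A $$ (i,j)"])

lemma sum_swap4:
  "(\<Sum>i\<in>I. \<Sum>j\<in>J. \<Sum>b\<in>B. \<Sum>a\<in>A. F i j a b) = (\<Sum>a\<in>A. \<Sum>b\<in>B. \<Sum>i\<in>I. \<Sum>j\<in>J. F i j a b)"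
proof -
  have "(\<Sum>i\<in>I. \<Sum>j\<in>J. \<Sum>b\<in>B. \<Sum>a\<in>A. F i j a b) = (\<Sum>p\<in>I\<times>J. \<Sum>q\<in>A\<times>B. F (fst p) (snd p) (fst q) (snd q))"
    unfolding sum.cartesian_product' by (simp add: sum.swap[of _ A B])
  also have "\<dots> = (\<Sum>q\<in>A\<times>B. \<Sum>p\<in>I\<times>J. F (fst p) (snd p) (fst q) (snd q))"
    by (rule sum.swap)
  finally show ?thesis by (simp add: sum.cartesian_product')
qed

lemma psd_conj:
  assumes "psd n A" "W \<in> carrier_mat m n"
  shows "psd m (W * A * adj W)"
proof -
  have A: "A \<in> carrier_mat n n" and pA: "pos {..<n} (\<lambda>i j. A $$ (i,j))"
    using assms by (auto simp: psd_iff_pos)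
  have "pos {..<m} (\<lambda>i j. (W * A * adj W) $$ (i,j))"
    unfolding pos_def
  proof
    fix f :: "nat \<Rightarrow> complex"
    define g where "g a = (\<Sum>i<m. cnj (W $$ (i,a)) * f i)" for a
    have "(\<Sum>i<m. \<Sum>j<m. cnj (f i) * (W * A * adj W) $$ (i,j) * f j)
      = (\<Sum>i<m. \<Sum>j<m. \<Sum>b<n. \<Sum>a<n. (cnj (f i) * W $$ (i,a)) * A $$ (a,b) * (cnj (W $$ (j,b)) * f j))"
    proof (intro sum.cong refl)
      fix i j assume "i \<in> {..<m}" "j \<in> {..<m}"
      then have i: "i < m" and j: "j < m" by auto
      show "cnj (f i) * (W * A * adj W) $$ (i,j) * f j = 
        (\<Sum>b<n. \<Sum>a<n. (cnj (f i) * W $$ (i,a)) * A $$ (a,b) * (cnj (W $$ (j,b)) * f j))"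
        unfolding mult_mult_index[OF assms(2) A adj_carrier[OF assms(2)] i j]
          sum_distrib_left sum_distrib_right
        by (intro sum.cong refl) (use assms(2) i j in auto)
    qed
    also have "\<dots> = (\<Sum>a<n. \<Sum>b<n. \<Sum>i<m. \<Sum>j<m. (cnj (f i) * W $$ (i,a)) * A $$ (a,b) * (cnj (W $$ (j,b)) * f j))"
      by (rule sum_swap4)
    also have "\<dots> = (\<Sum>a<n. \<Sum>b<n. cnj (g a) * A $$ (a,b) * g b)"
      by (simp add: g_def sum_distrib_left sum_distrib_right mult_ac)
    finally show "0 \<le> (\<Sum>i<m. \<Sum>j<m. cnj (f i) * (W * A * adj W) $$ (i,j) * f j)"
      using pA by (simp add: pos_def)
  qed
  then show ?thesis using A assms(2) by (auto simp: psd_iff_pos)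
qed

lemma psd_diagm:
  assumes d: "\<And>i. i < n \<Longrightarrow> 0 \<le> d i"
  shows "psd n (diagm n (\<lambda>i. complex_of_real (d i)))"
proof -
  have "pos {..<n} (\<lambda>i j. diagm n (\<lambda>i. complex_of_real (d i)) $$ (i,j))"
  proof (rule pos_gram[where I="{..<n}" and g="\<lambda>i a. if i = a then complex_of_real (sqrt (d i)) else 0"])
    fix i j assume "i \<in> {..<n}" "j \<in> {..<n}"
    then have i: "i < n" and j: "j < n" by auto
    have dd: "complex_of_real (sqrt (d k)) * complex_of_real (sqrt (d k)) = complex_of_real (d k)"
      if "k < n" for k using d[OF that] by (simp flip: of_real_mult)
    have "(\<Sum>a<n. (if i = a then complex_of_real (sqrt (d i)) else 0) *
               cnj (if j = a then complex_of_real (sqrt (d j)) else 0))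
      = (\<Sum>a<n. if a = i then (if i = j then complex_of_real (d i) else 0) else 0)"
      by (intro sum.cong) (use i in \<open>auto simp: dd\<close>)
    also have "\<dots> = (if i = j then complex_of_real (d i) else 0)"
      using i by (subst sum.delta) auto
    finally show "diagm n (\<lambda>i. complex_of_real (d i)) $$ (i,j) = 
      (\<Sum>a<n. (if i = a then complex_of_real (sqrt (d i)) else 0) *
               cnj (if j = a then complex_of_real (sqrt (d j)) else 0))"
      using i j by simp
  qed
  then show ?thesis by (auto simp: psd_iff_pos)
qed

lemma psd_eigenvalue_nonneg:
  assumes "psd n (U * diagm n (\<lambda>i. complex_of_real (d i)) * adj U)" "unitary n U" "i < n"
  shows "0 \<le> d i"
proof -
  have "psd n (adj U * (U * diagm n (\<lambda>i. complex_of_real (d i)) * adj U) * U)"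
    using psd_conj[OF assms(1) adj_carrier[OF unitaryD(1)[OF assms(2)]]] by simp
  then have "psd n (diagm n (\<lambda>i. complex_of_real (d i)))"
    using unitary_cancel(2)[OF assms(2) diagm_carrier] by simp
  then have "pos {..<n} (\<lambda>i j. diagm n (\<lambda>i. complex_of_real (d i)) $$ (i,j))"
    by (simp add: psd_iff_pos)
  from pos_diag[OF finite_lessThan this, of i] assms(3) show ?thesis
    by (simp add: less_eq_complex_def)
qed

lemma psd_spectral:
  assumes "psd n A"
  obtains U d where "unitary n U" "A = U * diagm n (\<lambda>i. complex_of_real (d i)) * adj U"
    "\<And>i. i < n \<Longrightarrow> 0 \<le> d i"
proof -
  obtain U d where U: "unitary n U" and A: "A = U * diagm n (\<lambda>i. complex_of_real (d i)) * adj U"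
    using spectral_theorem[OF psd_hermitian[OF assms]] by metis
  from that[OF U A] psd_eigenvalue_nonneg[OF _ U] assms A show ?thesis by metis
qed

text \<open>\<open>g\<close> is \<open>U\<close> with its columns scaled by the roots of the
  eigenvalues. Gram form is the shape in which positivity passes to products over many copies, and
  its inner index labels the Kraus operators that prepare a state.\<close>

lemma psd_gram:
  assumes "psd n A"
  obtains g where "\<And>i j. i < n \<Longrightarrow> j < n \<Longrightarrow> A $$ (i,j) = (\<Sum>a<n. g i a * cnj (g j a))"
proof -
  obtain U d where U: "unitary n U" and A: "A = U * diagm n (\<lambda>i. complex_of_real (d i)) * adj U"
    and d: "\<And>i. i < n \<Longrightarrow> 0 \<le> d i" using psd_spectral[OF assms] by metis
  note Uc = unitaryD(1)[OF U]
  have "A $$ (i,j) = (\<Sum>a<n. U $$ (i,a) * sqrt (d a) * cnj (U $$ (j,a) * sqrt (d a)))"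
    if "i < n" "j < n" for i j
    unfolding A diagm_conj_index[OF Uc Uc that]
  proof (rule sum.cong)
    fix a assume "a \<in> {..<n}"
    then have "complex_of_real (d a) = complex_of_real (sqrt (d a)) * complex_of_real (sqrt (d a))"
      using d by (simp flip: of_real_mult)
    then show "U $$ (i,a) * complex_of_real (d a) * cnj (U $$ (j,a)) = 
      U $$ (i,a) * sqrt (d a) * cnj (U $$ (j,a) * sqrt (d a))" by simp
  qed simp
  then show ?thesis by (rule that)
qed

section \<open>Uniqueness of positive square roots and the trace norm\<close>

lemma conj_mult_conj:
  assumes "unitary n U" "A \<in> carrier_mat n n" "B \<in> carrier_mat n n"
  shows "(U * A * adj U) * (U * B * adj U) = U * (A * B) * adj U"
proof -
  note U = unitaryD[OF assms(1)]
  have c: "adj U \<in> carrier_mat n n" "U * A \<in> carrier_mat n n" "B * adj U \<in> carrier_mat n n"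
    "U * B * adj U \<in> carrier_mat n n" "U * B \<in> carrier_mat n n"
    using U assms by auto
  have "(U * A * adj U) * (U * B * adj U) = (U * A) * (adj U * (U * B * adj U))"
    by (rule assoc_mult_mat[OF c(2,1,4)])
  also have "adj U * (U * B * adj U) = adj U * (U * (B * adj U))"
    using assoc_mult_mat[OF U(1) assms(3) c(1)] by simp
  also have "\<dots> = adj U * U * (B * adj U)"
    by (rule assoc_mult_mat[OF c(1) U(1) c(3), symmetric])
  also have "\<dots> = B * adj U" unfolding U(2) by (rule left_mult_one_mat[OF c(3)])
  also have "U * A * (B * adj U) = U * A * B * adj U"
    by (rule assoc_mult_mat[OF c(2) assms(3) c(1), symmetric])
  also have "U * A * B = U * (A * B)"
    by (rule assoc_mult_mat[OF U(1) assms(2,3)])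
  finally show ?thesis .
qed

lemma adj_conj_diagm:
  assumes "U \<in> carrier_mat n n"
  shows "adj (U * diagm n f * adj U) = U * diagm n (\<lambda>i. cnj (f i)) * adj U"
proof -
  have "adj (U * diagm n f * adj U) = U * (adj (diagm n f) * adj U)"
    using adj_mult[of "U * diagm n f" n n "adj U" n] adj_mult[of U n n "diagm n f" n] assms by auto
  also have "\<dots> = U * diagm n (\<lambda>i. cnj (f i)) * adj U"
    unfolding adj_diagm by (rule assoc_mult_mat[OF assms diagm_carrier adj_carrier[OF assms], symmetric])
  finally show ?thesis .
qed

text \<open>With \<open>T = adj U * W\<close>, equality of the squares says that \<open>T\<close>
  intertwines the diagonals of squared eigenvalues. Wherever \<open>T $$ (i,j)\<close> is nonzero,
  nonnegativity then forces \<open>b i = c j\<close>, so \<open>T\<close> intertwines the unsquared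
  diagonals too. This makes the description inside \<open>trace_norm\<close> well defined.\<close>

lemma psd_square_inject:
  assumes "psd n B" "psd n C" "B * B = C * C"
  shows "B = C"
proof -
  obtain U b where U: "unitary n U" and B: "B = U * diagm n (\<lambda>i. complex_of_real (b i)) * adj U"
    and b: "\<And>i. i < n \<Longrightarrow> 0 \<le> b i" using psd_spectral[OF assms(1)] by metis
  obtain W c where W: "unitary n W" and C: "C = W * diagm n (\<lambda>i. complex_of_real (c i)) * adj W"
    and c: "\<And>i. i < n \<Longrightarrow> 0 \<le> c i" using psd_spectral[OF assms(2)] by metis
  define T where "T = adj U * W"
  note Uc = unitaryD(1)[OF U] and Wc = unitaryD(1)[OF W]
  have T: "T \<in> carrier_mat n n" using Uc Wc by (auto simp: T_def)
  have uT: "unitary n T" unfolding T_def by (rule unitary_mult[OF unitary_adj[OF U] W])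
  have UT: "U * T = W" unfolding T_def
    using assoc_mult_mat[OF Uc adj_carrier[OF Uc] Wc] unitaryD(3)[OF U] Wc by simp
  define D where "D f = diagm n (\<lambda>i. complex_of_real (f i))" for f :: "nat \<Rightarrow> real"
  have Dc: "D f \<in> carrier_mat n n" for f by (simp add: D_def)
  have CU: "C = U * (T * D c * adj T) * adj U"
    using conj_conj[OF Dc T Uc] unfolding UT C D_def by simp
  have eq_if: "X = Y" if "U * X * adj U = U * Y * adj U" "X \<in> carrier_mat n n" "Y \<in> carrier_mat n n" for X Y
  proof -
    have "X = adj U * (U * X * adj U) * U"
      by (rule unitary_cancel(2)[OF U that(2), symmetric])
    also have "\<dots> = Y"
      unfolding that(1) by (rule unitary_cancel(2)[OF U that(3)])
    finally show ?thesis .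
  qed
  have TDT: "T * D c * adj T \<in> carrier_mat n n" using T Dc by auto
  have "U * (D b * D b) * adj U = U * (T * (D c * D c) * adj T) * adj U"
    using assms(3) unfolding B CU D_def[symmetric]
    unfolding conj_mult_conj[OF U Dc Dc] conj_mult_conj[OF U TDT TDT] conj_mult_conj[OF uT Dc Dc] .
  then have sq: "D b * D b = T * (D c * D c) * adj T"
    by (rule eq_if[OF _ mult_carrier_mat[OF Dc Dc] mult_carrier_mat[OF mult_carrier_mat[OF T
      mult_carrier_mat[OF Dc Dc]] adj_carrier[OF T]]])
  have colT: "(T * X * adj T) * T = T * X" if X: "X \<in> carrier_mat n n" for X
  proof -
    have "(T * X * adj T) * T = T * X * (adj T * T)"
      by (rule assoc_mult_mat[OF mult_carrier_mat[OF T X] adj_carrier[OF T] T])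
    then show ?thesis using unitaryD(2)[OF uT] T X by simp
  qed
  have DT: "(D f * T) $$ (i,j) = of_real (f i) * T $$ (i,j)" 
    "(T * D f) $$ (i,j) = T $$ (i,j) * of_real (f j)" if "i < n" "j < n" for f i j
  proof -
    have "(D f * T) $$ (i,j) = (\<Sum>l<n. if l = i then of_real (f i) * T $$ (i,j) else 0)"
      unfolding mult_index[OF Dc T that] by (intro sum.cong) (use that in \<open>auto simp: D_def\<close>)
    then show "(D f * T) $$ (i,j) = of_real (f i) * T $$ (i,j)" using that by simp
    have "(T * D f) $$ (i,j) = (\<Sum>l<n. if l = j then T $$ (i,j) * of_real (f j) else 0)"
      unfolding mult_index[OF T Dc that] by (intro sum.cong) (use that in \<open>auto simp: D_def\<close>)
    then show "(T * D f) $$ (i,j) = T $$ (i,j) * of_real (f j)" using that by simp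
  qed
  have sqD: "D f * D f = D (\<lambda>i. f i * f i)" for f
    unfolding D_def diagm_mult by simp
  have "D (\<lambda>i. b i * b i) * T = T * D (\<lambda>i. c i * c i)"
    using arg_cong[OF sq, of "\<lambda>X. X * T"] colT[of "D c * D c"] Dc unfolding sqD by simp
  then have entry: "of_real (b i * b i) * T $$ (i,j) = T $$ (i,j) * of_real (c j * c j)" if "i < n" "j < n" for i j
    using DT[OF that] by metis
  have "D b * T = T * D c"
  proof (rule eq_matI)
    fix i j assume "i < dim_row (T * D c)" "j < dim_col (T * D c)"
    then have i: "i < n" and j: "j < n" using T by (auto simp: D_def)
    show "(D b * T) $$ (i,j) = (T * D c) $$ (i,j)"
    proof (cases "T $$ (i,j) = 0")
      case False
      then have "complex_of_real (b i * b i) = of_real (c j * c j)"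
        using entry[OF i j] by (simp add: mult.commute)
      then have "b i * b i = c j * c j" by (simp only: of_real_eq_iff)
      then have "b i = c j" using b[OF i] c[OF j] by (metis abs_of_nonneg abs_mult_self_eq real_sqrt_abs2)
      then show ?thesis unfolding DT[OF i j] by simp
    qed (simp only: DT[OF i j], simp)
  qed (use T in \<open>auto simp: D_def\<close>)
  then have "D b = T * D c * adj T"
    using assoc_mult_mat[OF Dc T adj_carrier[OF T], of b] unitaryD(3)[OF uT] Dc[of b] by simp
  then show ?thesis unfolding CU B D_def[symmetric] by simp
qed

lemma mtrace_conj:
  assumes U: "unitary n U" and A: "A \<in> carrier_mat n n"
  shows "mtrace (U * A * adj U) = mtrace A"
proof -
  note Uc = unitaryD(1)[OF U]
  have "mtrace (U * A * adj U) = (\<Sum>i<n. \<Sum>b<n. \<Sum>a<n. U $$ (i,a) * A $$ (a,b) * cnj (U $$ (i,b)))"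
    unfolding mtrace_def
  proof (rule sum.cong)
    show "{..<dim_row (U * A * adj U)} = {..<n}" using Uc by simp
    fix i assume "i \<in> {..<n}"
    then have i: "i < n" by simp
    show "(U * A * adj U) $$ (i,i) = (\<Sum>b<n. \<Sum>a<n. U $$ (i,a) * A $$ (a,b) * cnj (U $$ (i,b)))"
      unfolding mult_mult_index[OF Uc A adj_carrier[OF Uc] i i]
      by (intro sum.cong refl) (use Uc i in auto)
  qed
  also have "\<dots> = (\<Sum>a<n. \<Sum>b<n. \<Sum>i<n. U $$ (i,a) * A $$ (a,b) * cnj (U $$ (i,b)))"
    by (rule trans[OF sum.swap], rule trans[OF sum.cong[OF refl sum.swap]], rule sum.swap)
  also have "\<dots> = (\<Sum>a<n. \<Sum>b<n. A $$ (a,b) * (\<Sum>i<n. cnj (U $$ (i,b)) * U $$ (i,a)))"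
    by (simp add: sum_distrib_left mult_ac)
  also have "\<dots> = (\<Sum>a<n. \<Sum>b<n. if b = a then A $$ (a,a) else 0)"
    using unitary_orthonormal_cols[OF U] by (intro sum.cong refl) auto
  also have "\<dots> = mtrace A" using A by (simp add: mtrace_def)
  finally show ?thesis .
qed

lemma mtrace_diagm: "mtrace (diagm n f) = (\<Sum>i<n. f i)"
  by (simp add: mtrace_def)

lemma trace_norm_spectral:
  assumes "unitary n U"
  shows "trace_norm (U * diagm n (\<lambda>i. complex_of_real (d i)) * adj U) = (\<Sum>i<n. \<bar>d i\<bar>)"
proof -
  let ?A = "U * diagm n (\<lambda>i. complex_of_real (d i)) * adj U"
  let ?B = "U * diagm n (\<lambda>i. complex_of_real \<bar>d i\<bar>) * adj U"
  note Uc = unitaryD(1)[OF assms]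
  have "psd n ?B" by (rule psd_conj[OF psd_diagm Uc]) simp
  have sq: "?B * ?B = adj ?A * ?A"
    unfolding adj_conj_diagm[OF Uc] conj_mult_conj[OF assms diagm_carrier diagm_carrier] diagm_mult
    by (simp flip: of_real_mult)
  have dim: "dim_col ?A = n" using Uc by simp
  have "(THE B. psd (dim_col ?A) B \<and> B * B = adj ?A * ?A) = ?B"
  proof (rule the_equality)
    show "psd (dim_col ?A) ?B \<and> ?B * ?B = adj ?A * ?A"
      unfolding dim using \<open>psd n ?B\<close> sq by blast
    fix B assume "psd (dim_col ?A) B \<and> B * B = adj ?A * ?A"
    then show "B = ?B"
      unfolding dim using psd_square_inject[OF _ \<open>psd n ?B\<close>] sq by metis
  qed
  then have "trace_norm ?A = Re (mtrace ?B)" by (simp add: trace_norm_def)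
  then show ?thesis using mtrace_conj[OF assms diagm_carrier] by (simp add: mtrace_diagm)
qed

lemma trace_norm_conj:
  assumes "unitary n W" "hermitian n A"
  shows "trace_norm (W * A * adj W) = trace_norm A"
proof -
  obtain U d where U: "unitary n U" and A: "A = U * diagm n (\<lambda>i. complex_of_real (d i)) * adj U"
    using spectral_theorem[OF assms(2)] by metis
  show ?thesis unfolding A conj_conj[OF diagm_carrier unitaryD(1)[OF U] unitaryD(1)[OF assms(1)]]
    using trace_norm_spectral[OF U] trace_norm_spectral[OF unitary_mult[OF assms(1) U]] by metis
qed

text \<open>The assumptions say \<open>-P \<le> A \<le> P\<close>; tested on the eigenvectors of
  \<open>A\<close> they bound each absolute eigenvalue by a diagonal entry of \<open>P\<close> in
  that basis, and these entries sum to the trace. A single explicit \<open>P\<close> can handle a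
  whole average of tensor products.\<close>

lemma trace_norm_le:
  assumes "hermitian n A" "P \<in> carrier_mat n n"
    and "pos {..<n} (\<lambda>i j. P $$ (i,j) + A $$ (i,j))" "pos {..<n} (\<lambda>i j. P $$ (i,j) + - (A $$ (i,j)))"
  shows "trace_norm A \<le> Re (mtrace P)"
proof -
  obtain U d where U: "unitary n U" and A: "A = U * diagm n (\<lambda>i. complex_of_real (d i)) * adj U"
    using spectral_theorem[OF assms(1)] by metis
  note Uc = unitaryD(1)[OF U]
  have Ac: "A \<in> carrier_mat n n" using assms(1) by (simp add: hermitian_def)
  have quad: "(\<Sum>i<n. \<Sum>j<n. cnj (U $$ (i,l)) * X $$ (i,j) * U $$ (j,l)) = (adj U * X * U) $$ (l,l)"
    if "X \<in> carrier_mat n n" "l < n" for X l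
    unfolding mult_mult_index[OF adj_carrier[OF Uc] that(1) Uc that(2) that(2)]
    using Uc that by (subst sum.swap) simp
  have dA: "adj U * A * U = diagm n (\<lambda>i. complex_of_real (d i))"
    unfolding A by (rule unitary_cancel(2)[OF U diagm_carrier])
  have "\<bar>d l\<bar> \<le> Re ((adj U * P * U) $$ (l,l))" if l: "l < n" for l
  proof -
    have "0 \<le> (adj U * P * U) $$ (l,l) + (adj U * A * U) $$ (l,l)"
      using assms(3)[unfolded pos_def, rule_format, of "\<lambda>i. U $$ (i,l)"]
      unfolding quad[OF assms(2) l, symmetric] quad[OF Ac l, symmetric]
      by (simp add: algebra_simps sum.distrib)
    moreover have "0 \<le> (adj U * P * U) $$ (l,l) - (adj U * A * U) $$ (l,l)"
      using assms(4)[unfolded pos_def, rule_format, of "\<lambda>i. U $$ (i,l)"]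
      unfolding quad[OF assms(2) l, symmetric] quad[OF Ac l, symmetric]
      by (simp add: algebra_simps sum.distrib sum_subtractf)
    ultimately show ?thesis unfolding dA using l by (auto simp: less_eq_complex_def)
  qed
  then have "(\<Sum>l<n. \<bar>d l\<bar>) \<le> (\<Sum>l<n. Re ((adj U * P * U) $$ (l,l)))"
    by (intro sum_mono) auto
  also have "\<dots> = Re (mtrace (adj U * P * adj (adj U)))"
    using Uc by (simp add: mtrace_def)
  also have "\<dots> = Re (mtrace P)"
    using mtrace_conj[OF unitary_adj[OF U] assms(2)] by simp
  finally show ?thesis unfolding A trace_norm_spectral[OF U] .
qed

section \<open>Spectral projectors, time evolution and tensor products\<close>

lemma diagm_mult_left_index:
  assumes "A \<in> carrier_mat n m" "i < n" "j < m"
  shows "(diagm n f * A) $$ (i,j) = f i * A $$ (i,j)"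
proof -
  have "(diagm n f * A) $$ (i,j) = (\<Sum>l<n. if l = i then f i * A $$ (i,j) else 0)"
    unfolding mult_index[OF diagm_carrier assms] by (intro sum.cong) (use assms in auto)
  then show ?thesis using assms by simp
qed

lemma diagm_mult_right_index:
  assumes "A \<in> carrier_mat m n" "i < m" "j < n"
  shows "(A * diagm n f) $$ (i,j) = A $$ (i,j) * f j"
proof -
  have "(A * diagm n f) $$ (i,j) = (\<Sum>l<n. if l = j then A $$ (i,j) * f j else 0)"
    unfolding mult_index[OF assms(1) diagm_carrier assms(2,3)] by (intro sum.cong) (use assms in auto)
  then show ?thesis using assms by simp
qed

text \<open>In the coordinates \<open>adj U *\<^sub>v v\<close> the equation decouples. With
  \<open>z = 1\<close> and 0/1 entries it describes the fixed vectors of a projector, in general the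
  eigenvectors of a Hamiltonian; comparing the two identifies the spectral projectors.\<close>

lemma diagm_conj_eigen:
  assumes U: "unitary n U" and v: "v \<in> carrier_vec n"
  shows "(U * diagm n f * adj U) *\<^sub>v v = z \<cdot>\<^sub>v v \<longleftrightarrow> (\<forall>i<n. (f i - z) * (adj U *\<^sub>v v) $ i = 0)"
proof -
  note Uc = unitaryD(1)[OF U]
  define w where "w = adj U *\<^sub>v v"
  have w: "w \<in> carrier_vec n" unfolding w_def by (rule mult_mat_vec_carrier[OF adj_carrier[OF Uc] v])
  have Uw: "U *\<^sub>v w = v"
    unfolding w_def assoc_mult_mat_vec[OF Uc adj_carrier[OF Uc] v, symmetric] unitaryD(3)[OF U]
    using v by simp
  have inj: "x = y" if "U *\<^sub>v x = U *\<^sub>v y" "x \<in> carrier_vec n" "y \<in> carrier_vec n" for x y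
  proof -
    have "adj U *\<^sub>v (U *\<^sub>v x) = adj U *\<^sub>v (U *\<^sub>v y)" using that(1) by simp
    then show ?thesis
      unfolding assoc_mult_mat_vec[OF adj_carrier[OF Uc] Uc that(2), symmetric]
        assoc_mult_mat_vec[OF adj_carrier[OF Uc] Uc that(3), symmetric] unitaryD(2)[OF U]
      using that(2,3) by simp
  qed
  have dw: "diagm n f *\<^sub>v w = vec n (\<lambda>i. f i * w $ i)"
  proof (rule eq_vecI)
    fix i assume "i < dim_vec (vec n (\<lambda>i. f i * w $ i))"
    then have i: "i < n" by simp
    have "(diagm n f *\<^sub>v w) $ i = (\<Sum>l<n. diagm n f $$ (i,l) * w $ l)"
      using i w by (simp add: scalar_prod_def lessThan_atLeast0)
    also have "\<dots> = (\<Sum>l<n. if l = i then f i * w $ i else 0)"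
      by (intro sum.cong) (use i in auto)
    finally show "(diagm n f *\<^sub>v w) $ i = vec n (\<lambda>i. f i * w $ i) $ i" using i by simp
  qed simp
  have "(U * diagm n f * adj U) *\<^sub>v v = U *\<^sub>v (diagm n f *\<^sub>v w)"
    unfolding assoc_mult_mat_vec[OF mult_carrier_mat[OF Uc diagm_carrier] adj_carrier[OF Uc] v]
      w_def[symmetric] by (rule assoc_mult_mat_vec[OF Uc diagm_carrier w])
  moreover have "z \<cdot>\<^sub>v v = U *\<^sub>v (z \<cdot>\<^sub>v w)"
    using mult_mat_vec[OF Uc w, of z] Uw by simp
  ultimately have "(U * diagm n f * adj U) *\<^sub>v v = z \<cdot>\<^sub>v v \<longleftrightarrow> diagm n f *\<^sub>v w = z \<cdot>\<^sub>v w"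
    using inj[of "diagm n f *\<^sub>v w" "z \<cdot>\<^sub>v w"] w by (auto simp: dw)
  also have "\<dots> \<longleftrightarrow> (\<forall>i<n. (f i - z) * w $ i = 0)"
    unfolding dw using w by (auto simp: vec_eq_iff algebra_simps)
  finally show ?thesis unfolding w_def .
qed

text \<open>Resolves the definite description. For uniqueness, two orthogonal projections with the
  same fixed vectors absorb each other, and taking adjoints turns mutual absorption into
  equality.\<close>

lemma spec_proj_eq:
  assumes U: "unitary n U" and H: "H = U * diagm n (\<lambda>i. complex_of_real (d i)) * adj U"
  shows "spec_proj n H E = U * diagm n (\<lambda>i. if d i = E then 1 else 0) * adj U" (is "_ = ?P")
  unfolding spec_proj_def
proof (rule the_equality)
  note Uc = unitaryD(1)[OF U]
  have Pc: "?P \<in> carrier_mat n n" using Uc by auto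
  have PP: "?P * ?P = ?P"
    unfolding conj_mult_conj[OF U diagm_carrier diagm_carrier] diagm_mult
    by (rule arg_cong[where f="\<lambda>f. U * diagm n f * adj U"]) auto
  have aP: "adj ?P = ?P"
    unfolding adj_conj_diagm[OF Uc] by (rule arg_cong[where f="\<lambda>f. U * diagm n f * adj U"]) auto
  have fixed: "?P *\<^sub>v v = v \<longleftrightarrow> H *\<^sub>v v = complex_of_real E \<cdot>\<^sub>v v" if v: "v \<in> carrier_vec n" for v
  proof -
    have "?P *\<^sub>v v = v \<longleftrightarrow> ?P *\<^sub>v v = 1 \<cdot>\<^sub>v v" by simp
    then show ?thesis
      unfolding H diagm_conj_eigen[OF U v] by auto
  qed
  show "?P \<in> carrier_mat n n \<and> ?P * ?P = ?P \<and> adj ?P = ?P \<and>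
      (\<forall>v\<in>carrier_vec n. ?P *\<^sub>v v = v \<longleftrightarrow> H *\<^sub>v v = complex_of_real E \<cdot>\<^sub>v v)"
    using Pc PP aP fixed by blast
  fix P assume asm: "P \<in> carrier_mat n n \<and> P * P = P \<and> adj P = P \<and>
      (\<forall>v\<in>carrier_vec n. P *\<^sub>v v = v \<longleftrightarrow> H *\<^sub>v v = complex_of_real E \<cdot>\<^sub>v v)"
  \<comment> \<open>Columns of an idempotent \<open>R\<close> are fixed by \<open>R\<close>; a
    matrix \<open>Q\<close> that fixes every vector fixed by \<open>R\<close> therefore leaves
    \<open>R\<close> unchanged.\<close>
  have absorb: "Q * R = R" if "Q \<in> carrier_mat n n" "R \<in> carrier_mat n n" "R * R = R"
    "\<And>v. v \<in> carrier_vec n \<Longrightarrow> R *\<^sub>v v = v \<Longrightarrow> Q *\<^sub>v v = v" for Q R :: "complex mat"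
  proof (rule mat_col_eqI)
    fix j assume "j < dim_col R"
    then have j: "j < n" using that by simp
    have "R *\<^sub>v col R j = col R j" using col_mult2[OF that(2,2) j] that(3) by simp
    then have "Q *\<^sub>v col R j = col R j" using that(2,4) by auto
    then show "col (Q * R) j = col R j" using col_mult2[OF that(1,2) j] by simp
  qed (use that in auto)
  have "P * ?P = ?P" by (rule absorb) (use asm Pc PP fixed in blast)+
  moreover have "?P * P = P" by (rule absorb) (use asm Pc fixed in blast)+
  moreover have "adj (?P * P) = adj P * adj ?P" by (rule adj_mult[OF Pc]) (use asm in blast)
  ultimately show "P = ?P" using asm aP by metis
qed

text \<open>In the eigenbasis the spectral projectors are 0/1 diagonal matrices, so the sandwich
  keeps exactly the entries in rows of energy \<open>E\<close> and columns of energy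
  \<open>F\<close>. Values that are not eigenvalues give the zero projector, and degenerate levels
  need no separate treatment.\<close>

lemma modes_eq:
  assumes U: "unitary n U" and H: "H = U * diagm n (\<lambda>i. complex_of_real (d i)) * adj U"
    and \<sigma>: "\<sigma> \<in> carrier_mat n n"
  shows "modes n H \<sigma> = {d i - d j | i j. i < n \<and> j < n \<and> (adj U * \<sigma> * U) $$ (i,j) \<noteq> 0}"
proof -
  note Uc = unitaryD(1)[OF U]
  define S where "S = adj U * \<sigma> * U"
  have S: "S \<in> carrier_mat n n" using Uc \<sigma> by (auto simp: S_def)
  have \<sigma>S: "\<sigma> = U * S * adj U" unfolding S_def using unitary_cancel(1)[OF U \<sigma>] by simp
  define I where "I E = diagm n (\<lambda>i. if d i = E then 1 else 0)" for E
  have Ic: "I E \<in> carrier_mat n n" for E by (simp add: I_def)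
  have iff: "spec_proj n H E * \<sigma> * spec_proj n H F \<noteq> 0\<^sub>m n n \<longleftrightarrow>
    (\<exists>i j. i < n \<and> j < n \<and> d i = E \<and> d j = F \<and> S $$ (i,j) \<noteq> 0)" for E F
  proof -
    let ?X = "I E * S * I F"
    have Xc: "?X \<in> carrier_mat n n" using S Ic by (metis mult_carrier_mat)
    have "spec_proj n H E * \<sigma> * spec_proj n H F = U * ?X * adj U"
      unfolding spec_proj_eq[OF U H] \<sigma>S I_def[symmetric] conj_mult_conj[OF U Ic S] 
        conj_mult_conj[OF U mult_carrier_mat[OF Ic S] Ic] ..
    moreover have "U * ?X * adj U = 0\<^sub>m n n \<longleftrightarrow> ?X = 0\<^sub>m n n"
    proof
      assume "U * ?X * adj U = 0\<^sub>m n n"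
      then have "?X = adj U * 0\<^sub>m n n * U" using unitary_cancel(2)[OF U Xc] by simp
      then show "?X = 0\<^sub>m n n" using Uc by (simp add: left_mult_zero_mat[of U n n])
    qed (use Uc in auto)
    moreover have entry: "?X $$ (i,j) = (if d i = E \<and> d j = F then S $$ (i,j) else 0)" if "i < n" "j < n" for i j
      unfolding I_def diagm_mult_right_index[OF mult_carrier_mat[OF diagm_carrier S] that]
        diagm_mult_left_index[OF S that] by simp
    have "?X = 0\<^sub>m n n \<longleftrightarrow> (\<forall>i<n. \<forall>j<n. ?X $$ (i,j) = 0)"
      using Xc by (auto simp del: index_mult_mat intro!: eq_matI)
    ultimately show ?thesis using entry by (auto simp del: index_mult_mat)
  qed
  show ?thesis unfolding modes_def iff S_def[symmetric] by blast
qed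

text \<open>Powers of \<open>H\<close> act on the eigenvalues, so each entry of the series is a
  finite combination of scalar exponential series, matching the entrywise form of
  \<open>mexp\<close>.\<close>

lemma evol_eq:
  assumes U: "unitary n U" and H: "H = U * diagm n (\<lambda>i. complex_of_real (d i)) * adj U"
  shows "evol n H t = U * diagm n (\<lambda>i. exp (- \<i> * t * d i)) * adj U"
proof -
  note Uc = unitaryD(1)[OF U]
  define z where "z = - \<i> * complex_of_real t"
  have zH: "z \<cdot>\<^sub>m H = U * diagm n (\<lambda>i. z * d i) * adj U"
    using Uc unfolding H by (intro eq_matI) (auto simp: diagm_conj_index[OF Uc Uc] sum_distrib_left mult_ac
        simp del: index_mult_mat(1))
  have pow: "(z \<cdot>\<^sub>m H) ^\<^sub>m k = U * diagm n (\<lambda>i. (z * d i) ^ k) * adj U" for k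
  proof (induction k)
    case 0
    have "diagm n (\<lambda>i. 1) = 1\<^sub>m n" by (rule eq_matI) auto
    then show ?case using Uc unitaryD(3)[OF U] by (simp add: zH)
  next
    case (Suc k)
    have "(z \<cdot>\<^sub>m H) ^\<^sub>m Suc k = (z \<cdot>\<^sub>m H) ^\<^sub>m k * (z \<cdot>\<^sub>m H)" by simp
    also have "\<dots> = U * diagm n (\<lambda>i. (z * d i) ^ k * (z * d i)) * adj U"
      unfolding Suc.IH unfolding zH conj_mult_conj[OF U diagm_carrier diagm_carrier] diagm_mult ..
    finally show ?case by (simp add: mult.commute)
  qed
  show ?thesis
  proof (rule eq_matI)
    fix i j assume "i < dim_row (U * diagm n (\<lambda>i. exp (- \<i> * t * d i)) * adj U)"
      "j < dim_col (U * diagm n (\<lambda>i. exp (- \<i> * t * d i)) * adj U)"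
    then have i: "i < n" and j: "j < n" using Uc by auto
    have "(\<lambda>k. (z * d l) ^ k /\<^sub>R fact k) sums exp (z * d l)" for l
      by (rule exp_converges)
    then have "(\<lambda>k. \<Sum>l<n. U $$ (i,l) * ((z * d l) ^ k /\<^sub>R fact k) * cnj (U $$ (j,l)))
        sums (\<Sum>l<n. U $$ (i,l) * exp (z * d l) * cnj (U $$ (j,l)))"
      by (intro sums_sum sums_mult sums_mult2)
    moreover have "((z \<cdot>\<^sub>m H) ^\<^sub>m k) $$ (i,j) / of_nat (fact k)
        = (\<Sum>l<n. U $$ (i,l) * ((z * d l) ^ k /\<^sub>R fact k) * cnj (U $$ (j,l)))" for k
      unfolding pow diagm_conj_index[OF Uc Uc i j] sum_divide_distrib
      by (simp add: scaleR_conv_of_real field_simps)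
    ultimately have "(\<Sum>k. ((z \<cdot>\<^sub>m H) ^\<^sub>m k) $$ (i,j) / of_nat (fact k))
        = (\<Sum>l<n. U $$ (i,l) * exp (z * d l) * cnj (U $$ (j,l)))"
      by (simp add: sums_iff)
    then show "evol n H t $$ (i,j) = (U * diagm n (\<lambda>i. exp (- \<i> * t * d i)) * adj U) $$ (i,j)"
      unfolding diagm_conj_index[OF Uc Uc i j] using i j by (simp add: evol_def mexp_def z_def)
  qed (use Uc in \<open>auto simp: evol_def mexp_def\<close>)
qed

lemma evol_carrier [simp]: "evol n H t \<in> carrier_mat n n"
  by (simp add: evol_def mexp_def)

lemma evol_diagm:
  "evol n (diagm n (\<lambda>i. complex_of_real (d i))) t = diagm n (\<lambda>i. exp (- \<i> * t * d i))"
  using evol_eq[OF unitary_one, of "diagm n (\<lambda>i. complex_of_real (d i))" n d t] by simp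

lemma evol_conj:
  assumes "hermitian n H" "unitary n W"
  shows "evol n (W * H * adj W) t = W * evol n H t * adj W"
proof -
  obtain U d where U: "unitary n U" and H: "H = U * diagm n (\<lambda>i. complex_of_real (d i)) * adj U"
    using spectral_theorem[OF assms(1)] by metis
  have "W * H * adj W = (W * U) * diagm n (\<lambda>i. complex_of_real (d i)) * adj (W * U)"
    unfolding H by (rule conj_conj[OF diagm_carrier unitaryD(1)[OF U] unitaryD(1)[OF assms(2)]])
  from evol_eq[OF unitary_mult[OF assms(2) U] this] evol_eq[OF U H]
    conj_conj[OF diagm_carrier unitaryD(1)[OF U] unitaryD(1)[OF assms(2)]]
  show ?thesis by simp
qed

section \<open>Tensor products and sum Hamiltonians\<close>

lemma index_less: "i < d \<Longrightarrow> a < m \<Longrightarrow> i * m + a < d * (m::nat)"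
proof -
  assume "i < d" "a < m"
  then have "i * m + a < Suc i * m" by simp
  also have "\<dots> \<le> d * m" using \<open>i < d\<close> by (intro mult_right_mono) auto
  finally show "i * m + a < d * m" .
qed

lemma bij_betw_div_mod: "bij_betw (\<lambda>r. (r div m, r mod m)) {..<d * m} ({..<d} \<times> {..<m::nat})"
proof (rule bij_betwI[where g="\<lambda>(i,a). i * m + a"])
  show "(\<lambda>r. (r div m, r mod m)) \<in> {..<d * m} \<rightarrow> {..<d} \<times> {..<m}"
    by (auto simp: less_mult_imp_div_less intro!: mod_less_divisor)
      (metis gr_zeroI mult_0_right not_less_zero)
  show "(\<lambda>(i,a). i * m + a) \<in> {..<d} \<times> {..<m} \<rightarrow> {..<d * m}"
    by (auto intro: index_less)
qed auto

lemma sum_div_mod: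
  "(\<Sum>r<d * m. F (r div m) (r mod m)) = (\<Sum>i<d. \<Sum>a<(m::nat). F i a)"
  using sum.reindex_bij_betw[OF bij_betw_div_mod, of "\<lambda>p. F (fst p) (snd p)" m d]
  by (simp add: sum.cartesian_product')

lemma kron_carrier: "A \<in> carrier_mat a b \<Longrightarrow> B \<in> carrier_mat c d \<Longrightarrow> kron A B \<in> carrier_mat (a * c) (b * d)"
  by (auto simp: kron_def)

lemma kron_index:
  assumes "A \<in> carrier_mat a b" "B \<in> carrier_mat c d" "r < a * c" "s < b * d"
  shows "kron A B $$ (r,s) = A $$ (r div c, s div d) * B $$ (r mod c, s mod d)"
  using assms by (simp add: kron_def)

lemma div_mod_less: "r < a * c \<Longrightarrow> r div c < a \<and> r mod c < (c::nat)"
  using bij_betw_div_mod[of c a] by (auto dest!: bij_betw_apply)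

lemma kron_mult:
  assumes "A \<in> carrier_mat n n" "B \<in> carrier_mat m m" "C \<in> carrier_mat n n" "D \<in> carrier_mat m m"
  shows "kron A B * kron C D = kron (A * C) (B * D)"
proof (rule eq_matI)
  fix r s assume "r < dim_row (kron (A * C) (B * D))" "s < dim_col (kron (A * C) (B * D))"
  then have r: "r < n * m" and s: "s < n * m" using assms by (auto simp: kron_def)
  note r' = div_mod_less[OF r] and s' = div_mod_less[OF s]
  have "(kron A B * kron C D) $$ (r,s) = (\<Sum>l<n*m. kron A B $$ (r,l) * kron C D $$ (l,s))"
    by (rule mult_index[OF kron_carrier[OF assms(1,2)] kron_carrier[OF assms(3,4)] r s])
  also have "\<dots> = (\<Sum>l<n*m. (A $$ (r div m, l div m) * B $$ (r mod m, l mod m)) *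
    (C $$ (l div m, s div m) * D $$ (l mod m, s mod m)))"
    by (intro sum.cong) (use r s assms in \<open>auto simp: kron_index\<close>)
  also have "\<dots> = (\<Sum>i<n. \<Sum>a<m. (A $$ (r div m, i) * B $$ (r mod m, a)) *
    (C $$ (i, s div m) * D $$ (a, s mod m)))"
    by (rule sum_div_mod)
  also have "\<dots> = (\<Sum>i<n. A $$ (r div m, i) * C $$ (i, s div m)) * (\<Sum>a<m. B $$ (r mod m, a) * D $$ (a, s mod m))"
    by (simp add: sum_product mult_ac)
  also have "\<dots> = (A * C) $$ (r div m, s div m) * (B * D) $$ (r mod m, s mod m)"
    by (simp only: mult_index[OF assms(1,3) conjunct1[OF r'] conjunct1[OF s']]
        mult_index[OF assms(2,4) conjunct2[OF r'] conjunct2[OF s']])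
  also have "\<dots> = kron (A * C) (B * D) $$ (r,s)"
    using kron_index[OF mult_carrier_mat[OF assms(1,3)] mult_carrier_mat[OF assms(2,4)] r s] by simp
  finally show "(kron A B * kron C D) $$ (r,s) = kron (A * C) (B * D) $$ (r,s)" .
qed (use assms in \<open>auto simp: kron_def\<close>)

lemma adj_kron:
  assumes "A \<in> carrier_mat n n" "B \<in> carrier_mat m m"
  shows "adj (kron A B) = kron (adj A) (adj B)"
proof (rule eq_matI)
  fix r s assume "r < dim_row (kron (adj A) (adj B))" "s < dim_col (kron (adj A) (adj B))"
  then have r: "r < n * m" and s: "s < n * m" using assms by (auto simp: kron_def)
  show "adj (kron A B) $$ (r,s) = kron (adj A) (adj B) $$ (r,s)"
    using kron_carrier[OF assms] r s div_mod_less[OF r] div_mod_less[OF s] assms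
    by (simp add: kron_index[OF assms s r] kron_index[OF adj_carrier[OF assms(1)] adj_carrier[OF assms(2)] r s])
qed (use assms in \<open>auto simp: kron_def\<close>)

lemma kron_one: "kron (1\<^sub>m n) (1\<^sub>m m) = 1\<^sub>m (n * m)"
proof (rule eq_matI)
  fix i j assume "i < dim_row (1\<^sub>m (n * m))" "j < dim_col (1\<^sub>m (n * m))"
  then have "i < n * m" "j < n * m" by auto
  moreover have "i = j \<longleftrightarrow> i div m = j div m \<and> i mod m = j mod m" by (metis div_mult_mod_eq)
  ultimately show "kron (1\<^sub>m n) (1\<^sub>m m) $$ (i,j) = 1\<^sub>m (n * m) $$ (i,j)"
    using div_mod_less[of i n m] div_mod_less[of j n m] by (auto simp: kron_def)
qed (auto simp: kron_def)

lemma kron_unitary: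
  assumes "unitary n U"
  shows "unitary (n * m) (kron U (1\<^sub>m m))"
proof -
  note Uc = unitaryD(1)[OF assms]
  show ?thesis
    unfolding unitary_def adj_kron[OF Uc one_carrier_mat] adj_one
      kron_mult[OF adj_carrier[OF Uc] one_carrier_mat Uc one_carrier_mat] unitaryD(2)[OF assms]
    using kron_carrier[OF Uc one_carrier_mat] by (simp add: kron_one)
qed

lemma kron_one_conj:
  assumes "U \<in> carrier_mat n n" "A \<in> carrier_mat n n" "B \<in> carrier_mat m m"
  shows "kron U (1\<^sub>m m) * kron A B * adj (kron U (1\<^sub>m m)) = kron (U * A * adj U) B"
  unfolding adj_kron[OF assms(1) one_carrier_mat] adj_one kron_mult[OF assms(1) one_carrier_mat assms(2,3)]
    kron_mult[OF mult_carrier_mat[OF assms(1,2)] mult_carrier_mat[OF one_carrier_mat assms(3)]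
      adj_carrier[OF assms(1)] one_carrier_mat]
  using assms(3) by simp

lemma psd_kron:
  assumes "psd n A" "psd m B"
  shows "psd (n * m) (kron A B)"
proof -
  have A: "A \<in> carrier_mat n n" "pos {..<n} (\<lambda>i j. A $$ (i,j))" and B: "B \<in> carrier_mat m m"
    using assms by (auto simp: psd_iff_pos)
  obtain g where g: "\<And>i j. i < m \<Longrightarrow> j < m \<Longrightarrow> B $$ (i,j) = (\<Sum>a<m. g i a * cnj (g j a))"
    using psd_gram[OF assms(2)] by metis
  have "pos ({..<n} \<times> {..<m}) (\<lambda>p q. A $$ (fst p, fst q) * B $$ (snd p, snd q))"
    by (rule pos_tensor_gram[OF A(2), where L="\<lambda>i j. B $$ (i,j)" and I="{..<m}" and g=g]) (use g in auto)
  from pos_reindex[OF bij_betw_div_mod this]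
  have "pos {..<n * m} (\<lambda>r s. kron A B $$ (r,s))"
    by (subst pos_cong) (auto simp: kron_index[OF A(1) B])
  then show ?thesis using kron_carrier[OF A(1) B] by (simp add: psd_iff_pos)
qed

lemma hermitian_kron: "hermitian n A \<Longrightarrow> hermitian m B \<Longrightarrow> hermitian (n * m) (kron A B)"
  unfolding hermitian_def using adj_kron[of A n B m] kron_carrier[of A n n B m m] by auto

lemma hermitian_add: "hermitian n A \<Longrightarrow> hermitian n B \<Longrightarrow> hermitian n (A + B)"
  unfolding hermitian_def
proof (intro conjI)
  assume "A \<in> carrier_mat n n \<and> adj A = A" "B \<in> carrier_mat n n \<and> adj B = B"
  then have A: "A \<in> carrier_mat n n" "adj A = A" and B: "B \<in> carrier_mat n n" "adj B = B" by auto
  show "A + B \<in> carrier_mat n n" using A B by simp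
  have "adj (A + B) = adj A + adj B" using A(1) B(1) by (intro eq_matI) auto
  then show "adj (A + B) = A + B" using A B by simp
qed

lemma hermitian_one: "hermitian n (1\<^sub>m n)"
  by (simp add: hermitian_def)

lemma hermitian_minus: "hermitian n A \<Longrightarrow> hermitian n B \<Longrightarrow> hermitian n (A - B)"
  unfolding hermitian_def
proof (intro conjI)
  assume "A \<in> carrier_mat n n \<and> adj A = A" "B \<in> carrier_mat n n \<and> adj B = B"
  then have A: "A \<in> carrier_mat n n" "adj A = A" and B: "B \<in> carrier_mat n n" "adj B = B" by auto
  show "A - B \<in> carrier_mat n n" using A B by (simp add: minus_carrier_mat)
  have "adj (A - B) = adj A - adj B" using A(1) B(1) by (intro eq_matI) auto
  then show "adj (A - B) = A - B" using A B by simp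
qed

lemma hermitian_ham_sum: "hermitian n H \<Longrightarrow> hermitian m K \<Longrightarrow> hermitian (n * m) (ham_sum n H m K)"
  unfolding ham_sum_def by (intro hermitian_add hermitian_kron hermitian_one)

text \<open>The basis change touches the first factor only, because the Hamiltonian of the catalyst
  can be chosen diagonal from the start.\<close>

lemma ham_sum_conj:
  assumes U: "unitary n U" and "H \<in> carrier_mat n n" "K \<in> carrier_mat m m"
  shows "ham_sum n (U * H * adj U) m K = kron U (1\<^sub>m m) * ham_sum n H m K * adj (kron U (1\<^sub>m m))"
proof -
  note Uc = unitaryD(1)[OF U]
  let ?W = "kron U (1\<^sub>m m)"
  have W: "?W \<in> carrier_mat (n*m) (n*m)" using kron_carrier[OF Uc one_carrier_mat] .
  have k: "kron H (1\<^sub>m m) \<in> carrier_mat (n*m) (n*m)" "kron (1\<^sub>m n) K \<in> carrier_mat (n*m) (n*m)"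
    using kron_carrier[of H n n "1\<^sub>m m" m m] kron_carrier[of "1\<^sub>m n" n n K m m] assms by auto
  have "?W * ham_sum n H m K * adj ?W = ?W * kron H (1\<^sub>m m) * adj ?W + ?W * kron (1\<^sub>m n) K * adj ?W"
    unfolding ham_sum_def mult_add_distrib_mat[OF W k]
    by (rule add_mult_distrib_mat[OF _ _ adj_carrier[OF W]]) (use W k in auto)
  also have "\<dots> = ham_sum n (U * H * adj U) m K"
    unfolding ham_sum_def kron_one_conj[OF Uc assms(2) one_carrier_mat] kron_one_conj[OF Uc one_carrier_mat assms(3)]
    using unitaryD(3)[OF U] Uc by simp
  finally show ?thesis by simp
qed

section \<open>Channels in Kraus form\<close>

lemma sum_swap3:
  "(\<Sum>a\<in>A. \<Sum>b\<in>B. \<Sum>c\<in>C. F a b c) = (\<Sum>b\<in>B. \<Sum>c\<in>C. \<Sum>a\<in>A. F a b c)"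
  by (rule trans[OF sum.swap sum.cong[OF refl sum.swap]])

lemma channel_cong:
  assumes "channel dX dY \<Lambda>" "\<And>A. A \<in> carrier_mat dX dX \<Longrightarrow> \<Lambda>' A = \<Lambda> A"
  shows "channel dX dY \<Lambda>'"
proof -
  have "ext_id dX dY k \<Lambda>' M = ext_id dX dY k \<Lambda> M" for k M
    by (simp add: ext_id_def assms(2))
  then show ?thesis using assms unfolding channel_def by (auto simp: smult_carrier_mat)
qed

lemma channel_comp:
  assumes "channel dX dY \<Lambda>" "channel dY dZ \<Gamma>"
  shows "channel dX dZ (\<lambda>A. \<Gamma> (\<Lambda> A))"
proof -
  have carrier: "\<Lambda> A \<in> carrier_mat dY dY" if "A \<in> carrier_mat dX dX" for A
    using assms(1) that by (simp add: channel_def)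
  have "ext_id dX dZ k (\<lambda>A. \<Gamma> (\<Lambda> A)) M = ext_id dY dZ k \<Gamma> (ext_id dX dY k \<Lambda> M)" for k M
  \<comment> \<open>For \<open>k = 0\<close> the index arithmetic with \<open>div\<close> and
    \<open>mod\<close> says nothing, but then both matrices have size 0.\<close>
  proof (cases "k = 0")
    case False
    have "mat dY dY (\<lambda>(i,j). ext_id dX dY k \<Lambda> M $$ (i*k + r mod k, j*k + s mod k))
      = \<Lambda> (mat dX dX (\<lambda>(i,j). M $$ (i*k + r mod k, j*k + s mod k)))" for r s
    proof (rule eq_matI)
      let ?L = "\<Lambda> (mat dX dX (\<lambda>(i,j). M $$ (i*k + r mod k, j*k + s mod k)))"
      have L: "?L \<in> carrier_mat dY dY" by (rule carrier) simp
      then show "dim_row (mat dY dY (\<lambda>(i,j). ext_id dX dY k \<Lambda> M $$ (i*k + r mod k, j*k + s mod k))) = dim_row ?L"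
        "dim_col (mat dY dY (\<lambda>(i,j). ext_id dX dY k \<Lambda> M $$ (i*k + r mod k, j*k + s mod k))) = dim_col ?L"
        by auto
      fix i j assume "i < dim_row ?L" "j < dim_col ?L"
      then have i: "i < dY" and j: "j < dY" using L by auto
      have *: "i * k + r mod k < dY * k" "j * k + s mod k < dY * k"
        using False i j by (auto intro!: index_less)
      show "mat dY dY (\<lambda>(i,j). ext_id dX dY k \<Lambda> M $$ (i*k + r mod k, j*k + s mod k)) $$ (i,j) = ?L $$ (i,j)"
        using i j False * by (simp add: ext_id_def)
    qed
    then show ?thesis by (auto simp: ext_id_def)
  qed (auto intro!: eq_matI simp: ext_id_def)
  then show ?thesis using assms unfolding channel_def by simp
qed

text \<open>Coefficient functions over an arbitrary index set, so that measurement outcomes and Gram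
  labels can index the operators directly.\<close>

definition kraus :: "nat \<Rightarrow> nat \<Rightarrow> 'a set \<Rightarrow> ('a \<Rightarrow> nat \<Rightarrow> nat \<Rightarrow> complex) \<Rightarrow> complex mat \<Rightarrow> complex mat" where
  "kraus dX dY I K M = mat dY dY (\<lambda>(r,s). \<Sum>a\<in>I. \<Sum>x<dX. \<Sum>y<dX. K a r x * M $$ (x,y) * cnj (K a s y))"

lemma kraus_carrier [simp]: "kraus dX dY I K M \<in> carrier_mat dY dY"
  by (simp add: kraus_def)

lemma kraus_channel:
  assumes TP: "\<And>x y. x < dX \<Longrightarrow> y < dX \<Longrightarrow> (\<Sum>a\<in>I. \<Sum>r<dY. cnj (K a r y) * K a r x) = (if x = y then 1 else 0)"
  shows "channel dX dY (kraus dX dY I K)"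
  unfolding channel_def
proof (intro conjI ballI allI impI)
  fix A B :: "complex mat" and z
  assume A: "A \<in> carrier_mat dX dX"
  show "kraus dX dY I K A \<in> carrier_mat dY dY" by simp
  show "kraus dX dY I K (z \<cdot>\<^sub>m A) = z \<cdot>\<^sub>m kraus dX dY I K A"
    by (rule eq_matI) (use A in \<open>auto simp: kraus_def sum_distrib_left mult_ac\<close>)
  have "mtrace (kraus dX dY I K A) = (\<Sum>r<dY. \<Sum>a\<in>I. \<Sum>x<dX. \<Sum>y<dX. K a r x * A $$ (x,y) * cnj (K a r y))"
    by (simp add: mtrace_def kraus_def)
  also have "\<dots> = (\<Sum>x<dX. \<Sum>y<dX. \<Sum>a\<in>I. \<Sum>r<dY. K a r x * A $$ (x,y) * cnj (K a r y))"
    by (subst sum.swap) (subst sum_swap4, rule trans[OF sum.swap], simp add: sum.swap[of _ I "{..<dY}"])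
  also have "\<dots> = (\<Sum>x<dX. \<Sum>y<dX. A $$ (x,y) * (\<Sum>a\<in>I. \<Sum>r<dY. cnj (K a r y) * K a r x))"
    by (simp add: sum_distrib_left mult_ac)
  also have "\<dots> = (\<Sum>x<dX. \<Sum>y<dX. if y = x then A $$ (x,x) else 0)"
    by (intro sum.cong refl) (auto simp: TP)
  also have "\<dots> = mtrace A" using A by (simp add: mtrace_def)
  finally show "mtrace (kraus dX dY I K A) = mtrace A" .
next
  fix A B :: "complex mat"
  assume A: "A \<in> carrier_mat dX dX" and B: "B \<in> carrier_mat dX dX"
  show "kraus dX dY I K (A + B) = kraus dX dY I K A + kraus dX dY I K B"
    by (rule eq_matI) (use A B in \<open>auto simp: kraus_def algebra_simps sum.distrib\<close>)
next
  fix k and M :: "complex mat"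
  assume M: "psd (dX * k) M"
  then have pM: "pos {..<dX * k} (\<lambda>i j. M $$ (i,j))" by (simp add: psd_iff_pos)
  have "pos {..<dY * k} (\<lambda>r s. ext_id dX dY k (kraus dX dY I K) M $$ (r,s))"
  proof (cases "k = 0")
    case True
    then show ?thesis by (simp add: pos_def)
  next
    case False
    show ?thesis
      unfolding pos_def
    proof
      fix f :: "nat \<Rightarrow> complex"
      \<comment> \<open>\<open>h a\<close> is the adjoint of Kraus operator \<open>a\<close>,
        extended trivially to the ancilla, applied to \<open>f\<close>. Everything that follows
        rearranges the form of the output at \<open>f\<close> into the sum over \<open>a\<close> of
        the forms of \<open>M\<close> at \<open>h a\<close>.\<close>
      define h where "h a l = (\<Sum>i<dY. cnj (K a i (l div k)) * f (i * k + l mod k))" for a l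
      have ext: "ext_id dX dY k (kraus dX dY I K) M $$ (r,s) = (\<Sum>a\<in>I. \<Sum>x<dX. \<Sum>y<dX.
          K a (r div k) x * M $$ (x * k + r mod k, y * k + s mod k) * cnj (K a (s div k) y))"
        if "r < dY * k" "s < dY * k" for r s
        using that div_mod_less[OF that(1)] div_mod_less[OF that(2)] by (simp add: ext_id_def kraus_def)
      define G where "G a i m j p x y = (cnj (f (i * k + m)) * K a i x) * M $$ (x * k + m, y * k + p) *
        (cnj (K a j y) * f (j * k + p))" for a i m j p x y
      have "(\<Sum>r<dY*k. \<Sum>s<dY*k. cnj (f r) * ext_id dX dY k (kraus dX dY I K) M $$ (r,s) * f s)
        = (\<Sum>r<dY*k. \<Sum>s<dY*k. \<Sum>a\<in>I. \<Sum>x<dX. \<Sum>y<dX. G a (r div k) (r mod k) (s div k) (s mod k) x y)"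
        by (intro sum.cong refl) (simp add: ext G_def sum_distrib_left sum_distrib_right mult_ac)
      also have "\<dots> = (\<Sum>i<dY. \<Sum>m<k. \<Sum>j<dY. \<Sum>p<k. \<Sum>a\<in>I. \<Sum>x<dX. \<Sum>y<dX. G a i m j p x y)"
        unfolding sum_div_mod[where F="\<lambda>i m. \<Sum>s<dY*k. \<Sum>a\<in>I. \<Sum>x<dX. \<Sum>y<dX. G a i m (s div k) (s mod k) x y"]
        by (intro sum.cong refl sum_div_mod)
      also have "\<dots> = (\<Sum>q\<in>{..<dY}\<times>{..<k}\<times>{..<dY}\<times>{..<k}. \<Sum>v\<in>I\<times>{..<dX}\<times>{..<dX}. 
          (case (q,v) of ((i,m,j,p),(a,x,y)) \<Rightarrow> G a i m j p x y))"
        by (simp add: sum.cartesian_product')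
      also have "\<dots> = (\<Sum>v\<in>{..<dY}\<times>{..<dY}. \<Sum>q\<in>I\<times>{..<dX}\<times>{..<k}\<times>{..<dX}\<times>{..<k}.
          (case (v,q) of ((i,j),(a,x,m,y,p)) \<Rightarrow> G a i m j p x y))"
        unfolding sum.cartesian_product
        by (rule sum.reindex_bij_witness[where
            i="\<lambda>((i,j),(a,x,m,y,p)). ((i,m,j,p),(a,x,y))" and j="\<lambda>((i,m,j,p),(a,x,y)). ((i,j),(a,x,m,y,p))"]) auto
      also have "\<dots> = (\<Sum>q\<in>I\<times>{..<dX}\<times>{..<k}\<times>{..<dX}\<times>{..<k}. \<Sum>v\<in>{..<dY}\<times>{..<dY}.
          (case (v,q) of ((i,j),(a,x,m,y,p)) \<Rightarrow> G a i m j p x y))"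
        by (rule sum.swap)
      also have "\<dots> = (\<Sum>a\<in>I. \<Sum>x<dX. \<Sum>m<k. \<Sum>y<dX. \<Sum>p<k. \<Sum>i<dY. \<Sum>j<dY. G a i m j p x y)"
        by (simp add: sum.cartesian_product')
      also have "\<dots> = (\<Sum>a\<in>I. \<Sum>x<dX. \<Sum>m<k. \<Sum>y<dX. \<Sum>p<k. 
          cnj (h a (x * k + m)) * M $$ (x * k + m, y * k + p) * h a (y * k + p))"
        by (intro sum.cong refl) (simp add: G_def h_def sum_distrib_left sum_distrib_right mult_ac)
      also have "\<dots> = (\<Sum>a\<in>I. \<Sum>r<dX*k. \<Sum>s<dX*k. cnj (h a r) * M $$ (r,s) * h a s)"
      proof (rule sum.cong[OF refl])
        fix a
        have "(\<Sum>r<dX*k. \<Sum>s<dX*k. cnj (h a r) * M $$ (r,s) * h a s) = 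
          (\<Sum>r<dX*k. \<Sum>s<dX*k. (\<lambda>x m y p. cnj (h a (x * k + m)) * M $$ (x * k + m, y * k + p) * h a (y * k + p))
             (r div k) (r mod k) (s div k) (s mod k))"
          by simp
        also have "\<dots> = (\<Sum>r<dX*k. \<Sum>y<dX. \<Sum>p<k. 
            (\<lambda>x m. cnj (h a (x * k + m)) * M $$ (x * k + m, y * k + p) * h a (y * k + p)) (r div k) (r mod k))"
          by (intro sum.cong refl sum_div_mod)
        also have "\<dots> = (\<Sum>x<dX. \<Sum>m<k. \<Sum>y<dX. \<Sum>p<k.
            cnj (h a (x * k + m)) * M $$ (x * k + m, y * k + p) * h a (y * k + p))"
          by (rule sum_div_mod[where F="\<lambda>x m. \<Sum>y<dX. \<Sum>p<k. 
            cnj (h a (x * k + m)) * M $$ (x * k + m, y * k + p) * h a (y * k + p)"])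
        finally show "(\<Sum>x<dX. \<Sum>m<k. \<Sum>y<dX. \<Sum>p<k.
            cnj (h a (x * k + m)) * M $$ (x * k + m, y * k + p) * h a (y * k + p))
          = (\<Sum>r<dX*k. \<Sum>s<dX*k. cnj (h a r) * M $$ (r,s) * h a s)" by (rule sym)
      qed
      finally show "0 \<le> (\<Sum>r<dY*k. \<Sum>s<dY*k. cnj (f r) * ext_id dX dY k (kraus dX dY I K) M $$ (r,s) * f s)"
        using pM by (simp add: pos_def sum_nonneg)
    qed
  qed
  then show "psd (dY * k) (ext_id dX dY k (kraus dX dY I K) M)"
    by (simp add: psd_iff_pos ext_id_def)
qed

lemma unitary_channel:
  assumes "unitary n W"
  shows "channel n n (\<lambda>M. W * M * adj W)"
proof (rule channel_cong)
  note Wc = unitaryD(1)[OF assms]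
  show "channel n n (kraus n n {()} (\<lambda>_ r x. W $$ (r,x)))"
    by (rule kraus_channel) (use unitary_orthonormal_cols[OF assms] in auto)
  fix A :: "complex mat" assume A: "A \<in> carrier_mat n n"
  show "W * A * adj W = kraus n n {()} (\<lambda>_ r x. W $$ (r,x)) A"
  proof (rule eq_matI)
    fix i j assume "i < dim_row (kraus n n {()} (\<lambda>_ r x. W $$ (r,x)) A)"
      "j < dim_col (kraus n n {()} (\<lambda>_ r x. W $$ (r,x)) A)"
    then have i: "i < n" and j: "j < n" by (auto simp: kraus_def)
    show "(W * A * adj W) $$ (i,j) = kraus n n {()} (\<lambda>_ r x. W $$ (r,x)) A $$ (i,j)"
      unfolding mult_mult_index[OF Wc A adj_carrier[OF Wc] i j]
      by (subst sum.swap) (use Wc i j in \<open>simp add: kraus_def\<close>)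
  qed (use Wc in \<open>auto simp: kraus_def\<close>)
qed

lemma channel_psd:
  assumes "channel dX dY \<Lambda>" "psd dX A"
  shows "psd dY (\<Lambda> A)"
proof -
  have A: "A \<in> carrier_mat dX dX" using assms(2) by (simp add: psd_iff_pos)
  then have L: "\<Lambda> A \<in> carrier_mat dY dY" using assms(1) by (simp add: channel_def)
  have "mat dX dX (\<lambda>(i,j). A $$ (i,j)) = A" using A by (intro eq_matI) auto
  then have "ext_id dX dY 1 \<Lambda> A = \<Lambda> A" using L by (intro eq_matI) (auto simp: ext_id_def)
  then show ?thesis using assms unfolding channel_def by (metis mult.right_neutral)
qed

text \<open>The energy condition is put on the coefficients summed over \<open>a\<close>, the matrix
  elements of the map itself. Single Kraus operators of a measurement in a superposed basis do not
  conserve energy; only their sum over the outcomes does.\<close>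

lemma kraus_covariant:
  assumes cov: "\<And>r s x y. r < dY \<Longrightarrow> s < dY \<Longrightarrow> x < dX \<Longrightarrow> y < dX \<Longrightarrow>
      (\<Sum>a\<in>I. K a r x * cnj (K a s y)) \<noteq> 0 \<Longrightarrow> e x - e y = e' r - e' s"
  shows "covariant dX (diagm dX (\<lambda>x. complex_of_real (e x))) dY (diagm dY (\<lambda>x. complex_of_real (e' x))) (kraus dX dY I K)"
  unfolding covariant_def
proof (intro allI impI)
  fix \<sigma> t assume "state dX \<sigma>"
  then have \<sigma>: "\<sigma> \<in> carrier_mat dX dX" by (simp add: state_def psd_iff_pos)
  define p where "p r = cis (- (t * r))" for r
  have pe: "exp (- \<i> * complex_of_real t * complex_of_real r) = p r" for r
    by (simp add: p_def cis_conv_exp mult.assoc)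
  have p_diff: "p a * cnj (p b) = p (a - b)" for a b
    by (simp add: p_def cis_cnj cis_mult algebra_simps)
  have cj: "(diagm n (\<lambda>i. p (d i)) * A * adj (diagm n (\<lambda>i. p (d i)))) $$ (i,j) = p (d i) * A $$ (i,j) * cnj (p (d j))"
    if "A \<in> carrier_mat n n" "i < n" "j < n" for A n i j d
    unfolding adj_diagm diagm_mult_right_index[OF mult_carrier_mat[OF diagm_carrier that(1)] that(2,3)]
      diagm_mult_left_index[OF that] ..
  let ?Vx = "diagm dX (\<lambda>i. p (e i))" and ?Vy = "diagm dY (\<lambda>i. p (e' i))"
  show "kraus dX dY I K (evol dX (diagm dX (\<lambda>x. complex_of_real (e x))) t * \<sigma> * adj (evol dX (diagm dX (\<lambda>x. complex_of_real (e x))) t)) =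
           evol dY (diagm dY (\<lambda>x. complex_of_real (e' x))) t * kraus dX dY I K \<sigma> * adj (evol dY (diagm dY (\<lambda>x. complex_of_real (e' x))) t)"
    unfolding evol_diagm pe
  proof (rule eq_matI)
    fix r s assume "r < dim_row (?Vy * kraus dX dY I K \<sigma> * adj ?Vy)" "s < dim_col (?Vy * kraus dX dY I K \<sigma> * adj ?Vy)"
    then have r: "r < dY" and s: "s < dY" by auto
    have coeff: "(\<Sum>a\<in>I. K a r x * (p (e x) * z * cnj (p (e y))) * cnj (K a s y)) =
      p (e' r) * (\<Sum>a\<in>I. K a r x * z * cnj (K a s y)) * cnj (p (e' s))" if "x < dX" "y < dX" for x y z
    proof -
      have "(\<Sum>a\<in>I. K a r x * (p (e x) * z * cnj (p (e y))) * cnj (K a s y)) = 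
        p (e x - e y) * z * (\<Sum>a\<in>I. K a r x * cnj (K a s y))"
        by (simp add: sum_distrib_left p_diff[symmetric] mult_ac)
      also have "\<dots> = p (e' r - e' s) * z * (\<Sum>a\<in>I. K a r x * cnj (K a s y))"
        using cov[OF r s that] by (cases "(\<Sum>a\<in>I. K a r x * cnj (K a s y)) = 0") auto
      also have "\<dots> = p (e' r) * (\<Sum>a\<in>I. K a r x * z * cnj (K a s y)) * cnj (p (e' s))"
        by (simp add: sum_distrib_left p_diff[symmetric] mult_ac)
      finally show ?thesis .
    qed
    have pull: "(\<Sum>a\<in>I. \<Sum>x<dX. \<Sum>y<dX. F a x y) = (\<Sum>x<dX. \<Sum>y<dX. \<Sum>a\<in>I. F a x y)"
      for F :: "'a \<Rightarrow> nat \<Rightarrow> nat \<Rightarrow> complex"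
      by (rule sum_swap3)
    have "kraus dX dY I K (?Vx * \<sigma> * adj ?Vx) $$ (r,s) = 
      (\<Sum>x<dX. \<Sum>y<dX. \<Sum>a\<in>I. K a r x * (p (e x) * \<sigma> $$ (x,y) * cnj (p (e y))) * cnj (K a s y))"
      unfolding pull[symmetric] using r s by (simp add: kraus_def cj[OF \<sigma>] del: index_mult_mat)
    also have "\<dots> = (\<Sum>x<dX. \<Sum>y<dX. p (e' r) * (\<Sum>a\<in>I. K a r x * \<sigma> $$ (x,y) * cnj (K a s y)) * cnj (p (e' s)))"
      by (intro sum.cong refl coeff) auto
    also have "\<dots> = p (e' r) * (\<Sum>x<dX. \<Sum>y<dX. \<Sum>a\<in>I. K a r x * \<sigma> $$ (x,y) * cnj (K a s y)) * cnj (p (e' s))"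
      by (simp add: sum_distrib_left sum_distrib_right)
    also have "\<dots> = (?Vy * kraus dX dY I K \<sigma> * adj ?Vy) $$ (r,s)"
      unfolding pull[symmetric] cj[OF kraus_carrier r s] using r s by (simp add: kraus_def)
    finally show "kraus dX dY I K (?Vx * \<sigma> * adj ?Vx) $$ (r,s) = (?Vy * kraus dX dY I K \<sigma> * adj ?Vy) $$ (r,s)" .
  qed (auto simp: kraus_def)
qed

text \<open>The marginal \<open>\<sigma>\<close> is kept apart from the \<open>\<rho>'\<close> in
  the correlation bound: the approximate claim takes \<open>\<sigma>\<close> near
  \<open>\<rho>'\<close>, the exact claim takes them equal.\<close>

definition correlated_catalysis ::
  "nat \<Rightarrow> complex mat \<Rightarrow> complex mat \<Rightarrow> nat \<Rightarrow> complex mat \<Rightarrow> complex mat \<Rightarrow> complex mat \<Rightarrow> real \<Rightarrow> bool" where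
  "correlated_catalysis dS HS \<rho> dS' HS' \<rho>' \<sigma> \<epsilon> \<longleftrightarrow> (\<exists>dC HC c \<Lambda>. hermitian dC HC \<and> state dC c \<and>
            channel (dS*dC) (dS'*dC) \<Lambda> \<and>
            covariant (dS*dC) (ham_sum dS HS dC HC) (dS'*dC) (ham_sum dS' HS' dC HC) \<Lambda> \<and>
            (let \<tau> = \<Lambda> (kron \<rho> c) in
               ptrace_B dS' dC \<tau> = \<sigma> \<and>
               ptrace_A dS' dC \<tau> = c \<and>
               trace_norm (\<tau> - kron \<rho>' c) < \<epsilon>))"

lemma kron_one_conj_index:
  assumes U: "U \<in> carrier_mat n n" and T: "T \<in> carrier_mat (n * m) (n * m)"
    and ia: "i < n" "j < n" "a < m" "b < m"
  shows "(kron U (1\<^sub>m m) * T * adj (kron U (1\<^sub>m m))) $$ (i * m + a, j * m + b)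
    = (\<Sum>l<n. \<Sum>k<n. U $$ (i,k) * T $$ (k * m + a, l * m + b) * cnj (U $$ (j,l)))"
proof -
  let ?W = "kron U (1\<^sub>m m)"
  have W: "?W \<in> carrier_mat (n * m) (n * m)" using kron_carrier[OF U one_carrier_mat] .
  have r: "i * m + a < n * m" and s: "j * m + b < n * m" using ia by (auto intro: index_less)
  have Wi: "?W $$ (i * m + a, q) = U $$ (i, q div m) * (if q mod m = a then 1 else 0)" if "q < n * m" "i < n" "a < m" for i a q
    using kron_index[OF U one_carrier_mat index_less[OF that(2,3)] that(1)] that div_mod_less[OF that(1)]
    by (auto simp: index_less)
  have "(?W * T * adj ?W) $$ (i * m + a, j * m + b) = 
    (\<Sum>q<n*m. \<Sum>p<n*m. ?W $$ (i * m + a, p) * T $$ (p,q) * adj ?W $$ (q, j * m + b))"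
    by (rule mult_mult_index[OF W T adj_carrier[OF W] r s])
  also have "\<dots> = (\<Sum>q<n*m. \<Sum>p<n*m. (\<lambda>k a' l b'. U $$ (i,k) * (if a' = a then 1 else 0) * T $$ (k * m + a', l * m + b') *
      (cnj (U $$ (j,l)) * (if b' = b then 1 else 0))) (p div m) (p mod m) (q div m) (q mod m))"
  proof (intro sum.cong refl)
    fix q p assume "q \<in> {..<n*m}" "p \<in> {..<n*m}"
    then have q: "q < n * m" and p: "p < n * m" by auto
    have "adj ?W $$ (q, j * m + b) = cnj (?W $$ (j * m + b, q))"
      using W q s by simp
    then show "?W $$ (i * m + a, p) * T $$ (p,q) * adj ?W $$ (q, j * m + b) =
      (\<lambda>k a' l b'. U $$ (i,k) * (if a' = a then 1 else 0) * T $$ (k * m + a', l * m + b') *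
      (cnj (U $$ (j,l)) * (if b' = b then 1 else 0))) (p div m) (p mod m) (q div m) (q mod m)"
      using Wi[OF p ia(1,3)] Wi[OF q ia(2,4)] by simp
  qed
  also have "\<dots> = (\<Sum>q<n*m. \<Sum>k<n. \<Sum>a'<m. (\<lambda>l b'. U $$ (i,k) * (if a' = a then 1 else 0) * T $$ (k * m + a', l * m + b') *
      (cnj (U $$ (j,l)) * (if b' = b then 1 else 0))) (q div m) (q mod m))"
    by (intro sum.cong refl sum_div_mod)
  also have "\<dots> = (\<Sum>l<n. \<Sum>b'<m. \<Sum>k<n. \<Sum>a'<m. U $$ (i,k) * (if a' = a then 1 else 0) * T $$ (k * m + a', l * m + b') *
      (cnj (U $$ (j,l)) * (if b' = b then 1 else 0)))"
    by (rule sum_div_mod[where F="\<lambda>l b'. \<Sum>k<n. \<Sum>a'<m. U $$ (i,k) * (if a' = a then 1 else 0) * T $$ (k * m + a', l * m + b') *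
      (cnj (U $$ (j,l)) * (if b' = b then 1 else 0))"])
  also have "\<dots> = (\<Sum>l<n. \<Sum>b'<m. if b' = b then (\<Sum>k<n. U $$ (i,k) * T $$ (k * m + a, l * m + b) * cnj (U $$ (j,l))) else 0)"
  proof (intro sum.cong refl)
    fix l b'
    have "(\<Sum>a'<m. U $$ (i,k) * (if a' = a then 1 else 0) * T $$ (k * m + a', l * m + b') *
      (cnj (U $$ (j,l)) * (if b' = b then 1 else 0))) = 
      (\<Sum>a'<m. if a' = a then (if b' = b then U $$ (i,k) * T $$ (k * m + a, l * m + b) * cnj (U $$ (j,l)) else 0) else 0)" for k
      by (intro sum.cong refl) auto
    then show "(\<Sum>k<n. \<Sum>a'<m. U $$ (i,k) * (if a' = a then 1 else 0) * T $$ (k * m + a', l * m + b') *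
      (cnj (U $$ (j,l)) * (if b' = b then 1 else 0)))
      = (if b' = b then (\<Sum>k<n. U $$ (i,k) * T $$ (k * m + a, l * m + b) * cnj (U $$ (j,l))) else 0)"
      using ia by simp
  qed
  also have "\<dots> = (\<Sum>l<n. \<Sum>k<n. U $$ (i,k) * T $$ (k * m + a, l * m + b) * cnj (U $$ (j,l)))"
    using ia by simp
  finally show ?thesis .
qed

lemma ptrace_B_conj:
  assumes U: "U \<in> carrier_mat n n" and T: "T \<in> carrier_mat (n * m) (n * m)"
  shows "ptrace_B n m (kron U (1\<^sub>m m) * T * adj (kron U (1\<^sub>m m))) = U * ptrace_B n m T * adj U"
proof (rule eq_matI)
  have P: "ptrace_B n m T \<in> carrier_mat n n" by (simp add: ptrace_B_def)
  fix i j assume "i < dim_row (U * ptrace_B n m T * adj U)" "j < dim_col (U * ptrace_B n m T * adj U)"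
  then have i: "i < n" and j: "j < n" using U by auto
  have "ptrace_B n m (kron U (1\<^sub>m m) * T * adj (kron U (1\<^sub>m m))) $$ (i,j) =
    (\<Sum>a<m. \<Sum>l<n. \<Sum>k<n. U $$ (i,k) * T $$ (k * m + a, l * m + a) * cnj (U $$ (j,l)))"
    using i j by (simp add: ptrace_B_def kron_one_conj_index[OF U T] del: index_mult_mat)
  also have "\<dots> = (\<Sum>l<n. \<Sum>k<n. \<Sum>a<m. U $$ (i,k) * T $$ (k * m + a, l * m + a) * cnj (U $$ (j,l)))"
    by (rule sum_swap3)
  also have "\<dots> = (U * ptrace_B n m T * adj U) $$ (i,j)"
    unfolding mult_mult_index[OF U P adj_carrier[OF U] i j]
    using U i j by (simp add: ptrace_B_def sum_distrib_left sum_distrib_right)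
  finally show "ptrace_B n m (kron U (1\<^sub>m m) * T * adj (kron U (1\<^sub>m m))) $$ (i,j) = (U * ptrace_B n m T * adj U) $$ (i,j)" .
qed (use U in \<open>auto simp: ptrace_B_def\<close>)

lemma ptrace_A_conj:
  assumes U: "unitary n U" and T: "T \<in> carrier_mat (n * m) (n * m)"
  shows "ptrace_A n m (kron U (1\<^sub>m m) * T * adj (kron U (1\<^sub>m m))) = ptrace_A n m T"
proof (rule eq_matI)
  note Uc = unitaryD(1)[OF U]
  fix a b assume "a < dim_row (ptrace_A n m T)" "b < dim_col (ptrace_A n m T)"
  then have a: "a < m" and b: "b < m" by (auto simp: ptrace_A_def)
  have "ptrace_A n m (kron U (1\<^sub>m m) * T * adj (kron U (1\<^sub>m m))) $$ (a,b) =
    (\<Sum>i<n. \<Sum>l<n. \<Sum>k<n. U $$ (i,k) * T $$ (k * m + a, l * m + b) * cnj (U $$ (i,l)))"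
    using a b by (simp add: ptrace_A_def kron_one_conj_index[OF Uc T] del: index_mult_mat)
  also have "\<dots> = (\<Sum>l<n. \<Sum>k<n. \<Sum>i<n. U $$ (i,k) * T $$ (k * m + a, l * m + b) * cnj (U $$ (i,l)))"
    by (rule sum_swap3)
  also have "\<dots> = (\<Sum>l<n. \<Sum>k<n. T $$ (k * m + a, l * m + b) * (\<Sum>i<n. cnj (U $$ (i,l)) * U $$ (i,k)))"
    by (simp add: sum_distrib_left mult_ac)
  also have "\<dots> = (\<Sum>l<n. \<Sum>k<n. if k = l then T $$ (l * m + a, l * m + b) else 0)"
    by (intro sum.cong refl) (auto simp: unitary_orthonormal_cols[OF U])
  also have "\<dots> = ptrace_A n m T $$ (a,b)" using a b by (simp add: ptrace_A_def)
  finally show "ptrace_A n m (kron U (1\<^sub>m m) * T * adj (kron U (1\<^sub>m m))) $$ (a,b) = ptrace_A n m T $$ (a,b)" .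
qed (auto simp: ptrace_A_def)

lemma state_conj:
  assumes "state n \<sigma>" "unitary n U"
  shows "state n (adj U * \<sigma> * U)"
  using psd_conj[of n \<sigma> "adj U" n] mtrace_conj[OF unitary_adj[OF assms(2)], of \<sigma>] assms unitaryD(1)[OF assms(2)]
  unfolding state_def by (simp add: psd_iff_pos)

text \<open>Local basis changes before and after the channel carry it over to the rotated
  Hamiltonians, which reduces the problem to diagonal ones. The catalyst is not rotated, so its
  state and Hamiltonian stay as they are, and the trace norm is unitarily invariant.\<close>

theorem correlated_catalysis_conj:
  assumes U: "unitary dS U" and U': "unitary dS' U'"
    and herm: "hermitian dS H" "hermitian dS' H'"
    and \<rho>: "psd dS \<rho>" and \<rho>': "psd dS' \<rho>'" and \<sigma>: "\<sigma> \<in> carrier_mat dS' dS'"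
    and cat: "correlated_catalysis dS H (adj U * \<rho> * U) dS' H' (adj U' * \<rho>' * U') (adj U' * \<sigma> * U') \<epsilon>"
  shows "correlated_catalysis dS (U * H * adj U) \<rho> dS' (U' * H' * adj U') \<rho>' \<sigma> \<epsilon>"
proof -
  note Uc = unitaryD(1)[OF U] and Uc' = unitaryD(1)[OF U']
  have \<rho>c: "\<rho> \<in> carrier_mat dS dS" "\<rho>' \<in> carrier_mat dS' dS'" using \<rho> \<rho>' by (auto simp: psd_iff_pos)
  obtain dC HC c \<Lambda> where HC: "hermitian dC HC" and c: "state dC c"
    and ch: "channel (dS*dC) (dS'*dC) \<Lambda>"
    and cov: "covariant (dS*dC) (ham_sum dS H dC HC) (dS'*dC) (ham_sum dS' H' dC HC) \<Lambda>"
    and pB: "ptrace_B dS' dC (\<Lambda> (kron (adj U * \<rho> * U) c)) = adj U' * \<sigma> * U'"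
    and pA: "ptrace_A dS' dC (\<Lambda> (kron (adj U * \<rho> * U) c)) = c"
    and tn: "trace_norm (\<Lambda> (kron (adj U * \<rho> * U) c) - kron (adj U' * \<rho>' * U') c) < \<epsilon>"
    using cat unfolding correlated_catalysis_def Let_def by (elim exE conjE)
  have cc: "c \<in> carrier_mat dC dC" using c by (simp add: state_def psd_iff_pos)
  have Hc: "H \<in> carrier_mat dS dS" "H' \<in> carrier_mat dS' dS'" "HC \<in> carrier_mat dC dC"
    using herm HC by (auto simp: hermitian_def)
  define W where "W = kron U (1\<^sub>m dC)"
  define W' where "W' = kron U' (1\<^sub>m dC)"
  have W: "unitary (dS*dC) W" "unitary (dS'*dC) W'"
    unfolding W_def W'_def by (rule kron_unitary, fact)+
  note Wc = unitaryD(1)[OF W(1)] and Wc' = unitaryD(1)[OF W(2)]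
  define \<Gamma> where "\<Gamma> M = W' * \<Lambda> (adj W * M * W) * adj W'" for M
  have \<Lambda>c: "\<Lambda> M \<in> carrier_mat (dS'*dC) (dS'*dC)" if "M \<in> carrier_mat (dS*dC) (dS*dC)" for M
    using ch that by (simp add: channel_def)
  have "channel (dS*dC) (dS*dC) (\<lambda>M. adj W * M * W)"
    using unitary_channel[OF unitary_adj[OF W(1)]] by simp
  from channel_comp[OF channel_comp[OF this ch] unitary_channel[OF W(2)]]
  have \<Gamma>ch: "channel (dS*dC) (dS'*dC) \<Gamma>" unfolding \<Gamma>_def .
  have \<Gamma>cov: "covariant (dS*dC) (ham_sum dS (U * H * adj U) dC HC) (dS'*dC) (ham_sum dS' (U' * H' * adj U') dC HC) \<Gamma>"
    unfolding covariant_def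
  proof (intro allI impI)
    fix \<sigma> t assume \<sigma>: "state (dS*dC) \<sigma>"
    then have \<sigma>c: "\<sigma> \<in> carrier_mat (dS*dC) (dS*dC)" by (simp add: state_def psd_iff_pos)
    define V where "V = evol (dS*dC) (ham_sum dS H dC HC) t"
    define V' where "V' = evol (dS'*dC) (ham_sum dS' H' dC HC) t"
    have Vc: "V \<in> carrier_mat (dS*dC) (dS*dC)" "V' \<in> carrier_mat (dS'*dC) (dS'*dC)" by (auto simp: V_def V'_def)
    define \<sigma>0 where "\<sigma>0 = adj W * \<sigma> * W"
    have \<sigma>0: "state (dS*dC) \<sigma>0" unfolding \<sigma>0_def by (rule state_conj[OF \<sigma> W(1)])
    then have \<sigma>0c: "\<sigma>0 \<in> carrier_mat (dS*dC) (dS*dC)" by (simp add: state_def psd_iff_pos)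
    have \<sigma>W: "\<sigma> = W * \<sigma>0 * adj W" unfolding \<sigma>0_def by (rule unitary_cancel(1)[OF W(1) \<sigma>c, symmetric])
    have adjV: "adj (X * Y * adj X) = X * adj Y * adj X" if "X \<in> carrier_mat k k" "Y \<in> carrier_mat k k"
      for X Y :: "complex mat" and k
      using that adj_mult[of "X * Y" k k "adj X" k] adj_mult[of X k k Y k]
        assoc_mult_mat[of X k k "adj Y" k "adj X" k] by simp
    have e: "evol (dS*dC) (ham_sum dS (U * H * adj U) dC HC) t = W * V * adj W"
      unfolding V_def ham_sum_conj[OF U Hc(1,3)] W_def
      by (rule evol_conj[OF hermitian_ham_sum[OF herm(1) HC] W(1)[unfolded W_def]])
    have e': "evol (dS'*dC) (ham_sum dS' (U' * H' * adj U') dC HC) t = W' * V' * adj W'"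
      unfolding V'_def ham_sum_conj[OF U' Hc(2,3)] W'_def
      by (rule evol_conj[OF hermitian_ham_sum[OF herm(2) HC] W(2)[unfolded W'_def]])
    have inner: "(W * V * adj W) * \<sigma> * adj (W * V * adj W) = W * (V * \<sigma>0 * adj V) * adj W"
      unfolding adjV[OF Wc Vc(1)] \<sigma>W conj_mult_conj[OF W(1) Vc(1) \<sigma>0c]
        conj_mult_conj[OF W(1) mult_carrier_mat[OF Vc(1) \<sigma>0c] adj_carrier[OF Vc(1)]] ..
    have VsV: "V * \<sigma>0 * adj V \<in> carrier_mat (dS*dC) (dS*dC)" using Vc(1) \<sigma>0c by (metis mult_carrier_mat adj_carrier)
    have "\<Gamma> ((W * V * adj W) * \<sigma> * adj (W * V * adj W)) = W' * \<Lambda> (V * \<sigma>0 * adj V) * adj W'"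
      unfolding \<Gamma>_def inner unitary_cancel(2)[OF W(1) VsV] ..
    also have "\<Lambda> (V * \<sigma>0 * adj V) = V' * \<Lambda> \<sigma>0 * adj V'"
      using cov \<sigma>0 unfolding covariant_def V_def V'_def by blast
    also have "W' * (V' * \<Lambda> \<sigma>0 * adj V') * adj W' = (W' * V' * adj W') * \<Gamma> \<sigma> * adj (W' * V' * adj W')"
      unfolding adjV[OF Wc' Vc(2)] \<Gamma>_def \<sigma>0_def[symmetric] conj_mult_conj[OF W(2) Vc(2) \<Lambda>c[OF \<sigma>0c]]
        conj_mult_conj[OF W(2) mult_carrier_mat[OF Vc(2) \<Lambda>c[OF \<sigma>0c]] adj_carrier[OF Vc(2)]] ..
    finally show "\<Gamma> (evol (dS*dC) (ham_sum dS (U * H * adj U) dC HC) t * \<sigma> *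
          adj (evol (dS*dC) (ham_sum dS (U * H * adj U) dC HC) t)) =
       evol (dS'*dC) (ham_sum dS' (U' * H' * adj U') dC HC) t * \<Gamma> \<sigma> *
          adj (evol (dS'*dC) (ham_sum dS' (U' * H' * adj U') dC HC) t)"
      unfolding e e' .
  qed
  define \<tau> where "\<tau> = \<Lambda> (kron (adj U * \<rho> * U) c)"
  have rho0: "psd dS (adj U * \<rho> * U)" using psd_conj[OF \<rho> adj_carrier[OF Uc]] by simp
  have rho0': "psd dS' (adj U' * \<rho>' * U')" using psd_conj[OF \<rho>' adj_carrier[OF Uc']] by simp
  have pc: "psd dC c" using c by (simp add: state_def)
  have \<tau>psd: "psd (dS'*dC) \<tau>" unfolding \<tau>_def by (rule channel_psd[OF ch psd_kron[OF rho0 pc]])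
  then have \<tau>c: "\<tau> \<in> carrier_mat (dS'*dC) (dS'*dC)" by (simp add: psd_iff_pos)
  have "adj W * kron \<rho> c * W = kron (adj U * \<rho> * U) c"
    using kron_one_conj[OF adj_carrier[OF Uc] \<rho>c(1) cc] adj_kron[OF Uc one_carrier_mat, of dC]
      adj_kron[OF adj_carrier[OF Uc] one_carrier_mat, of dC] by (simp add: W_def)
  then have \<Gamma>\<tau>: "\<Gamma> (kron \<rho> c) = W' * \<tau> * adj W'" by (simp add: \<Gamma>_def \<tau>_def)
  have "ptrace_B dS' dC (\<Gamma> (kron \<rho> c)) = U' * (adj U' * \<sigma> * U') * adj U'"
    unfolding \<Gamma>\<tau> W'_def ptrace_B_conj[OF Uc' \<tau>c] unfolding \<tau>_def pB ..
  then have pB': "ptrace_B dS' dC (\<Gamma> (kron \<rho> c)) = \<sigma>" using unitary_cancel(1)[OF U' \<sigma>] by simp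
  have pA': "ptrace_A dS' dC (\<Gamma> (kron \<rho> c)) = c"
    unfolding \<Gamma>\<tau> W'_def ptrace_A_conj[OF U' \<tau>c] unfolding \<tau>_def pA ..
  let ?X = "kron (adj U' * \<rho>' * U') c"
  have X: "psd (dS'*dC) ?X" by (rule psd_kron[OF rho0' pc])
  then have Xc: "?X \<in> carrier_mat (dS'*dC) (dS'*dC)" by (simp add: psd_iff_pos)
  have "kron \<rho>' c = W' * ?X * adj W'"
    unfolding W'_def kron_one_conj[OF Uc' _ cc, of "adj U' * \<rho>' * U'", OF mult_carrier_mat[OF mult_carrier_mat[OF
      adj_carrier[OF Uc'] \<rho>c(2)] Uc']] unitary_cancel(1)[OF U' \<rho>c(2)] ..
  then have "\<Gamma> (kron \<rho> c) - kron \<rho>' c = W' * (\<tau> - ?X) * adj W'"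
    unfolding \<Gamma>\<tau> mult_minus_distrib_mat[OF Wc' \<tau>c Xc]
    by (simp add: minus_mult_distrib_mat[OF mult_carrier_mat[OF Wc' \<tau>c] mult_carrier_mat[OF Wc' Xc] adj_carrier[OF Wc']])
  then have "trace_norm (\<Gamma> (kron \<rho> c) - kron \<rho>' c) = trace_norm (\<tau> - ?X)"
    using trace_norm_conj[OF W(2) hermitian_minus[OF psd_hermitian[OF \<tau>psd] psd_hermitian[OF X]]] by simp
  then have "trace_norm (\<Gamma> (kron \<rho> c) - kron \<rho>' c) < \<epsilon>" using tn by (simp add: \<tau>_def)
  then show ?thesis unfolding correlated_catalysis_def Let_def
    using HC c \<Gamma>ch \<Gamma>cov pB' pA' by blast
qed

section \<open>The catalyst\<close>

text \<open>Basis labels of a \<open>k\<close>-fold tensor power. They are extensional functions so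
  that sums of products over positions factor by \<open>prod_sum_PiE\<close>.\<close>

definition words :: "nat \<Rightarrow> nat \<Rightarrow> (nat \<Rightarrow> nat) set" where
  "words k D = PiE {..<k} (\<lambda>_. {..<D})"

lemma finite_words [simp]: "finite (words k D)"
  by (simp add: words_def finite_PiE)

lemma words_less: "w \<in> words k D \<Longrightarrow> p < k \<Longrightarrow> w p < D"
  by (auto simp: words_def PiE_iff)

lemma sum_words_prod: "(\<Sum>w\<in>words k D. \<Prod>p<k. F p (w p)) = (\<Prod>p<k. \<Sum>i<D. (F p i :: 'a :: comm_semiring_1))"
  unfolding words_def by (rule prod_sum_PiE[symmetric]) auto

lemma bij_betw_words_Suc:
  "bij_betw (\<lambda>(i,w). w(k := i)) ({..<D} \<times> words k D) (words (Suc k) D)"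
  unfolding bij_betw_def words_def lessThan_Suc PiE_insert_eq
  using inj_combinator[of k "{..<k}" "\<lambda>_. {..<D}"] by auto

text \<open>Of the \<open>Suc m\<close> systems measured or prepared jointly, \<open>m\<close> sit
  in the catalyst and one is passing through. \<open>f u\<close> is the row vector of outcome
  \<open>u\<close>, so \<open>complete\<close> says that the rank-one effects sum to the identity.
  \<open>conserve\<close> is covariance of the whole measure-and-prepare map, hence the sum over
  \<open>u\<close>. The Gram factor \<open>g\<close> is a parameter because the Kraus operators are
  written with it.\<close>

locale measure_prepare =
  fixes d d' m :: nat and E E' :: "nat \<Rightarrow> real" and \<rho> vr :: "nat \<Rightarrow> nat \<Rightarrow> complex"
    and U :: "'u set" and f :: "'u \<Rightarrow> (nat \<Rightarrow> nat) \<Rightarrow> complex" and g :: "'u \<Rightarrow> nat \<Rightarrow> nat \<Rightarrow> complex"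
    and R :: "'u \<Rightarrow> nat \<Rightarrow> nat \<Rightarrow> complex"
  assumes U_fin: "finite U"
    and \<rho>_gram: "\<And>i j. i < d \<Longrightarrow> j < d \<Longrightarrow> \<rho> i j = (\<Sum>b<d. vr i b * cnj (vr j b))"
    and \<rho>_trace: "(\<Sum>i<d. \<rho> i i) = 1"
    and complete: "\<And>w w'. w \<in> words (Suc m) d \<Longrightarrow> w' \<in> words (Suc m) d \<Longrightarrow>
      (\<Sum>u\<in>U. cnj (f u w) * f u w') = (if w = w' then 1 else 0)"
    and R_gram: "\<And>u r s. u \<in> U \<Longrightarrow> r < d' \<Longrightarrow> s < d' \<Longrightarrow> R u r s = (\<Sum>b<d'. g u r b * cnj (g u s b))"
    and R_trace: "\<And>u. u \<in> U \<Longrightarrow> (\<Sum>r<d'. R u r r) = 1"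
    and conserve: "\<And>w w' v v'. w \<in> words (Suc m) d \<Longrightarrow> w' \<in> words (Suc m) d \<Longrightarrow>
      v \<in> words (Suc m) d' \<Longrightarrow> v' \<in> words (Suc m) d' \<Longrightarrow>
      (\<Sum>u\<in>U. f u w * cnj (f u w') * (\<Prod>p<Suc m. R u (v p) (v' p))) \<noteq> 0 \<Longrightarrow>
      (\<Sum>p<Suc m. E (w p)) - (\<Sum>p<Suc m. E (w' p)) = (\<Sum>p<Suc m. E' (v p)) - (\<Sum>p<Suc m. E' (v' p))"
begin

text \<open>A basis state (k, w) of the catalyst has k unused copies of the input in its first
  positions and output systems in the remaining ones.\<close>

definition B :: "(nat \<times> (nat \<Rightarrow> nat)) set" where
  "B = (SIGMA k:{..m}. PiE {..<m} (\<lambda>p. {..<if p < k then d else d'}))"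

text \<open>The probability of outcome \<open>u\<close> on \<open>Suc m\<close> copies of
  \<open>\<rho>\<close>, complex-valued to share a type with the kernels.\<close>

definition pr :: "'u \<Rightarrow> complex" where
  "pr u = (\<Sum>w\<in>words (Suc m) d. \<Sum>w'\<in>words (Suc m) d. f u w * (\<Prod>p<Suc m. \<rho> (w p) (w' p)) * cnj (f u w'))"

text \<open>The catalyst state given that the outputs in stock were prepared after outcome
  \<open>u\<close>. The counter is classical, hence the block structure in \<open>fst\<close>, and
  uniform over its \<open>Suc m\<close> values.\<close>

definition cU :: "'u \<Rightarrow> nat \<times> (nat \<Rightarrow> nat) \<Rightarrow> nat \<times> (nat \<Rightarrow> nat) \<Rightarrow> complex" where
  "cU u x y = (if fst x = fst y then (\<Prod>p<m. (if p < fst x then \<rho> else R u) (snd x p) (snd y p)) / of_nat (Suc m) else 0)"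

definition cat :: "nat \<times> (nat \<Rightarrow> nat) \<Rightarrow> nat \<times> (nat \<Rightarrow> nat) \<Rightarrow> complex" where
  "cat x y = (\<Sum>u\<in>U. pr u * cU u x y)"

text \<open>The counter carries no energy of its own; it only decides which energy list applies to a
  slot.\<close>

definition eC :: "nat \<times> (nat \<Rightarrow> nat) \<Rightarrow> real" where
  "eC x = (\<Sum>p<m. (if p < fst x then E else E') (snd x p))"

text \<open>The passing system takes position \<open>m\<close>, after the \<open>m\<close> stored
  ones, which completes the \<open>Suc m\<close> letters of a joint measurement or
  preparation.\<close>

definition word :: "nat \<times> nat \<times> (nat \<Rightarrow> nat) \<Rightarrow> nat \<Rightarrow> nat" where
  "word x = (snd (snd x))(m := fst x)"

text \<open>With \<open>k < m\<close> inputs collected, slot \<open>k\<close> is the first one still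
  holding an output: the incoming letter goes there and the output found there is released.
  \<open>unshift\<close> undoes this relabelling.\<close>

definition shift :: "nat \<times> nat \<times> (nat \<Rightarrow> nat) \<Rightarrow> nat \<times> nat \<times> (nat \<Rightarrow> nat)" where
  "shift x = (case x of (i, k, w) \<Rightarrow> (w k, Suc k, w(k := i)))"

definition unshift :: "nat \<times> nat \<times> (nat \<Rightarrow> nat) \<Rightarrow> nat \<times> nat \<times> (nat \<Rightarrow> nat)" where
  "unshift y = (case y of (j, k, w) \<Rightarrow> (w (k - 1), k - 1, w(k - 1 := j)))"

definition G :: "'u \<Rightarrow> (nat \<Rightarrow> nat) \<Rightarrow> (nat \<Rightarrow> nat) \<Rightarrow> complex" where
  "G u b v = (\<Prod>p<Suc m. g u (v p) (b p))"

text \<open>The single operator \<open>None\<close> performs the shift on all counters below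
  \<open>m\<close>. At counter \<open>m\<close>, \<open>Some (u,b)\<close> applies the measurement
  vector of \<open>u\<close>, prepares the \<open>b\<close>-th Gram vector of the product of
  \<open>R u\<close>, and resets the counter to 0.\<close>

definition Kr :: "('u \<times> (nat \<Rightarrow> nat)) option \<Rightarrow> nat \<times> nat \<times> (nat \<Rightarrow> nat) \<Rightarrow> nat \<times> nat \<times> (nat \<Rightarrow> nat) \<Rightarrow> complex" where
  "Kr a y x = (case a of None \<Rightarrow> (if fst (snd x) < m \<and> y = shift x then 1 else 0)
    | Some (u,b) \<Rightarrow> (if fst (snd x) = m \<and> fst (snd y) = 0 then f u (word x) * G u b (word y) else 0))"

definition I :: "('u \<times> (nat \<Rightarrow> nat)) option set" where
  "I = insert None (Some ` (U \<times> words (Suc m) d'))"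

abbreviation X where "X \<equiv> {..<d} \<times> B"
abbreviation Y where "Y \<equiv> {..<d'} \<times> B"

section \<open>The Kraus operators: trace preservation and covariance\<close>

lemma finite_B [simp]: "finite B"
  by (auto simp: B_def intro!: finite_PiE)

lemma sum_I: "(\<Sum>a\<in>I. F a) = F None + (\<Sum>u\<in>U. \<Sum>b\<in>words (Suc m) d'. F (Some (u,b)))"
proof -
  have "(\<Sum>a\<in>I. F a) = F None + (\<Sum>a\<in>Some ` (U \<times> words (Suc m) d'). F a)"
    unfolding I_def by (subst sum.insert) (auto simp: U_fin)
  also have "(\<Sum>a\<in>Some ` (U \<times> words (Suc m) d'). F a) = (\<Sum>a\<in>U \<times> words (Suc m) d'. F (Some a))"
    by (subst sum.reindex) auto
  finally show ?thesis by (simp add: sum.cartesian_product')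
qed

lemma mem_B_top: "(m,w) \<in> B \<longleftrightarrow> w \<in> words m d"
proof -
  have "PiE {..<m} (\<lambda>p. {..<if p < m then d else d'}) = words m d"
    unfolding words_def by (rule PiE_cong) auto
  then show ?thesis by (simp add: B_def)
qed

lemma mem_B_bot: "(0,w) \<in> B \<longleftrightarrow> w \<in> words m d'"
  by (simp add: B_def words_def)

lemma sum_top: "(\<Sum>x\<in>X. if fst (snd x) = m then F (word x) else 0) = (\<Sum>v\<in>words (Suc m) d. F v)"
proof -
  have "(\<Sum>x\<in>X. if fst (snd x) = m then F (word x) else 0) = (\<Sum>x\<in>{x\<in>X. fst (snd x) = m}. F (word x))"
    by (rule sum.inter_filter[symmetric]) auto
  also have "\<dots> = (\<Sum>q\<in>{..<d} \<times> words m d. F ((\<lambda>(i,w). w(m := i)) q))"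
    by (rule sum.reindex_bij_witness[where i="\<lambda>q. (fst q,(m,snd q))" and j="\<lambda>x. (fst x,snd (snd x))"])
      (auto simp: mem_B_top word_def)
  also have "\<dots> = (\<Sum>v\<in>words (Suc m) d. F v)"
    by (rule sum.reindex_bij_betw[OF bij_betw_words_Suc])
  finally show ?thesis .
qed

lemma sum_bot: "(\<Sum>y\<in>Y. if fst (snd y) = 0 then F (word y) else 0) = (\<Sum>v\<in>words (Suc m) d'. F v)"
proof -
  have "(\<Sum>y\<in>Y. if fst (snd y) = 0 then F (word y) else 0) = (\<Sum>x\<in>{x\<in>Y. fst (snd x) = 0}. F (word x))"
    by (rule sum.inter_filter[symmetric]) auto
  also have "\<dots> = (\<Sum>q\<in>{..<d'} \<times> words m d'. F ((\<lambda>(i,w). w(m := i)) q))"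
    by (rule sum.reindex_bij_witness[where i="\<lambda>q. (fst q,(0,snd q))" and j="\<lambda>x. (fst x,snd (snd x))"])
      (auto simp: mem_B_bot word_def)
  also have "\<dots> = (\<Sum>v\<in>words (Suc m) d'. F v)"
    by (rule sum.reindex_bij_betw[OF bij_betw_words_Suc])
  finally show ?thesis .
qed

lemma word_top: "x \<in> X \<Longrightarrow> fst (snd x) = m \<Longrightarrow> word x \<in> words (Suc m) d"
  using bij_betw_apply[OF bij_betw_words_Suc, of "(fst x, snd (snd x))" d m]
  by (auto simp: mem_B_top word_def)

lemma word_bot: "y \<in> Y \<Longrightarrow> fst (snd y) = 0 \<Longrightarrow> word y \<in> words (Suc m) d'"
  using bij_betw_apply[OF bij_betw_words_Suc, of "(fst y, snd (snd y))" d' m]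
  by (auto simp: mem_B_bot word_def)

lemma word_inj: "x \<in> {..<D} \<times> B \<Longrightarrow> y \<in> {..<D'} \<times> B \<Longrightarrow> fst (snd x) = fst (snd y) \<Longrightarrow> word x = word y \<Longrightarrow> x = y"
proof (cases x; cases y)
  fix i c j c'
  assume *: "x \<in> {..<D} \<times> B" "y \<in> {..<D'} \<times> B" "fst (snd x) = fst (snd y)" "word x = word y"
    and x: "x = (i,c)" "y = (j,c')"
  obtain k w w' where c: "c = (k,w)" "c' = (k,w')" using * x by (cases c; cases c') auto
  \<comment> \<open>Stored words are \<open>undefined\<close> at \<open>m\<close>, so writing the
    passing letter there overwrites no information.\<close>
  have ext: "w m = undefined" "w' m = undefined"
    using * by (auto simp: x c B_def PiE_iff extensional_def)
  have "w(m := i) = w'(m := j)" using * by (simp add: x c word_def)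
  then have "i = j" "w = w'" using ext by (metis fun_upd_same, metis fun_upd_triv fun_upd_upd)
  then show "x = y" by (simp add: x c)
qed

lemma unshift_shift: "unshift (shift x) = x"
  by (auto simp: shift_def unshift_def split: prod.splits)

lemma shift_unshift: "fst (snd y) \<noteq> 0 \<Longrightarrow> shift (unshift y) = y"
  by (auto simp: shift_def unshift_def split: prod.splits)

lemma mem_B_iff: "(k,w) \<in> B \<longleftrightarrow> k \<le> m \<and> (\<forall>p<m. w p < (if p < k then d else d')) \<and> (\<forall>p\<ge>m. w p = undefined)"
  by (simp add: B_def PiE_iff extensional_def not_less Ball_def)

text \<open>Raising the counter turns slot \<open>k\<close> from an output slot into an input slot,
  which fits the letter now stored there; the released letter comes from an output slot and so lies
  below \<open>d'\<close>.\<close>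

lemma shift_mem:
  assumes "x \<in> X" "fst (snd x) < m"
  shows "shift x \<in> Y"
proof -
  obtain i k w where x: "x = (i,k,w)" by (metis prod.exhaust)
  have i: "i < d" and k: "k < m" and w: "\<And>p. p < m \<Longrightarrow> w p < (if p < k then d else d')" "\<And>p. p \<ge> m \<Longrightarrow> w p = undefined"
    using assms by (auto simp only: x mem_B_iff mem_Times_iff fst_conv snd_conv lessThan_iff)
  have "(w(k := i)) p < (if p < Suc k then d else d')" if "p < m" for p
    using w(1)[OF that] i by (cases "p = k") (simp_all add: less_Suc_eq)
  moreover have "w k < d'" using w(1)[OF k] by simp
  ultimately show ?thesis using k w(2) by (simp add: x shift_def mem_B_iff del: fun_upd_apply) simp
qed

lemma unshift_mem:
  assumes "y \<in> Y" "fst (snd y) \<noteq> 0"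
  shows "unshift y \<in> X \<and> fst (snd (unshift y)) < m"
proof -
  obtain j k w where y: "y = (j,Suc k,w)" using assms(2) by (metis prod.exhaust fst_conv snd_conv not0_implies_Suc)
  have j: "j < d'" and k: "k < m" and w: "\<And>p. p < m \<Longrightarrow> w p < (if p < Suc k then d else d')" "\<And>p. p \<ge> m \<Longrightarrow> w p = undefined"
    using assms by (auto simp only: y mem_B_iff mem_Times_iff fst_conv snd_conv lessThan_iff Suc_le_eq)
  have "(w(k := j)) p < (if p < k then d else d')" if "p < m" for p
    using w(1)[OF that] j by (cases "p = k") (simp_all add: less_Suc_eq)
  moreover have "w k < d" using w(1)[OF k] by simp
  ultimately show ?thesis using k w(2) by (simp add: y unshift_def mem_B_iff del: fun_upd_apply) simp
qed

lemma sum_shift: "(\<Sum>x\<in>X. Kr None y x * F x) = (if fst (snd y) = 0 then 0 else F (unshift y))" if "y \<in> Y"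
proof (cases "fst (snd y) = 0")
  case True
  then have "Kr None y x = 0" for x by (auto simp: Kr_def shift_def split: prod.splits)
  then show ?thesis using True by simp
next
  case False
  have "(\<Sum>x\<in>X. Kr None y x * F x) = (\<Sum>x\<in>X. if x = unshift y then F (unshift y) else 0)"
    by (rule sum.cong) (use unshift_mem[OF that False] shift_unshift[OF False] unshift_shift in \<open>auto simp: Kr_def\<close>)
  also have "\<dots> = F (unshift y)" using unshift_mem[OF that False] by (subst sum.delta) auto
  finally show ?thesis using False by simp
qed

lemma cnj_Kr_None: "cnj (Kr None y x) = Kr None y x"
  by (simp add: Kr_def)

lemma sum_G: "(\<Sum>b\<in>words (Suc m) d'. G u b v * cnj (G u b v')) = (\<Prod>p<Suc m. R u (v p) (v' p))"
  if "u \<in> U" "v \<in> words (Suc m) d'" "v' \<in> words (Suc m) d'"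
proof -
  have "(\<Sum>b\<in>words (Suc m) d'. G u b v * cnj (G u b v')) =
    (\<Sum>b\<in>words (Suc m) d'. \<Prod>p<Suc m. g u (v p) (b p) * cnj (g u (v' p) (b p)))"
    by (simp only: G_def cnj_prod prod.distrib)
  also have "\<dots> = (\<Prod>p<Suc m. R u (v p) (v' p))"
    unfolding sum_words_prod[where F="\<lambda>p b. g u (v p) b * cnj (g u (v' p) b)"] by (intro prod.cong refl R_gram[symmetric]) (use that words_less in auto)
  finally show ?thesis .
qed

text \<open>The shift acts on counters below \<open>m\<close>, the measurement operators on counter
  \<open>m\<close>, and each contributes the identity on its own sector: the shift by injectivity,
  the measurement because the prepared product has trace 1 for every \<open>u\<close>, after which
  \<open>complete\<close> finishes.\<close>

lemma Kr_trace_preserving: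
  assumes "x \<in> X" "x' \<in> X"
  shows "(\<Sum>a\<in>I. \<Sum>y\<in>Y. cnj (Kr a y x') * Kr a y x) = (if x = x' then 1 else 0)"
proof -
  have none: "(\<Sum>y\<in>Y. cnj (Kr None y x') * Kr None y x) = (if fst (snd x) < m \<and> x = x' then 1 else 0)"
  proof (cases "fst (snd x) < m")
    case True
    have "(\<Sum>y\<in>Y. cnj (Kr None y x') * Kr None y x) = (\<Sum>y\<in>Y. if y = shift x then Kr None (shift x) x' else 0)"
      by (rule sum.cong) (use True in \<open>auto simp: Kr_def\<close>)
    also have "\<dots> = Kr None (shift x) x'" using shift_mem[OF assms(1) True] by (subst sum.delta) auto
    also have "\<dots> = (if x = x' then 1 else 0)"
    proof -
      have "shift x = shift x' \<longleftrightarrow> x = x'" by (metis unshift_shift)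
      then show ?thesis using True by (auto simp: Kr_def)
    qed
    finally show ?thesis using True by simp
  qed (simp add: Kr_def)
  have some: "(\<Sum>u\<in>U. \<Sum>b\<in>words (Suc m) d'. \<Sum>y\<in>Y. cnj (Kr (Some (u,b)) y x') * Kr (Some (u,b)) y x)
    = (if fst (snd x) = m \<and> x = x' then 1 else 0)"
  proof (cases "fst (snd x) = m \<and> fst (snd x') = m")
    case True
    have "(\<Sum>b\<in>words (Suc m) d'. \<Sum>y\<in>Y. cnj (Kr (Some (u,b)) y x') * Kr (Some (u,b)) y x)
      = cnj (f u (word x')) * f u (word x)" if u: "u \<in> U" for u
    proof -
      have "(\<Sum>b\<in>words (Suc m) d'. \<Sum>y\<in>Y. cnj (Kr (Some (u,b)) y x') * Kr (Some (u,b)) y x)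
        = (\<Sum>b\<in>words (Suc m) d'. \<Sum>y\<in>Y. if fst (snd y) = 0 then 
            cnj (f u (word x')) * f u (word x) * (G u b (word y) * cnj (G u b (word y))) else 0)"
      proof (intro sum.cong refl)
        fix b and y :: "nat \<times> nat \<times> (nat \<Rightarrow> nat)"
        show "cnj (Kr (Some (u,b)) y x') * Kr (Some (u,b)) y x = (if fst (snd y) = 0 then 
            cnj (f u (word x')) * f u (word x) * (G u b (word y) * cnj (G u b (word y))) else 0)"
          using True by (cases "fst (snd y) = 0") (simp_all add: Kr_def)
      qed
      also have "\<dots> = (\<Sum>b\<in>words (Suc m) d'. \<Sum>v\<in>words (Suc m) d'. 
            cnj (f u (word x')) * f u (word x) * (G u b v * cnj (G u b v)))"
      proof (rule sum.cong[OF refl])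
        fix b
        show "(\<Sum>y\<in>Y. if fst (snd y) = 0 then cnj (f u (word x')) * f u (word x) * (G u b (word y) * cnj (G u b (word y))) else 0)
          = (\<Sum>v\<in>words (Suc m) d'. cnj (f u (word x')) * f u (word x) * (G u b v * cnj (G u b v)))"
          by (rule sum_bot[where F="\<lambda>v. cnj (f u (word x')) * f u (word x) * (G u b v * cnj (G u b v))"])
      qed
      also have "\<dots> = cnj (f u (word x')) * f u (word x) * (\<Sum>v\<in>words (Suc m) d'. \<Sum>b\<in>words (Suc m) d'. G u b v * cnj (G u b v))"
        by (subst sum.swap) (simp add: sum_distrib_left)
      also have "(\<Sum>v\<in>words (Suc m) d'. \<Sum>b\<in>words (Suc m) d'. G u b v * cnj (G u b v))
        = (\<Sum>v\<in>words (Suc m) d'. \<Prod>p<Suc m. R u (v p) (v p))"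
      proof (rule sum.cong[OF refl])
        fix v assume v: "v \<in> words (Suc m) d'"
        show "(\<Sum>b\<in>words (Suc m) d'. G u b v * cnj (G u b v)) = (\<Prod>p<Suc m. R u (v p) (v p))"
          by (rule sum_G[OF u v v])
      qed
      also have "\<dots> = 1" unfolding sum_words_prod[where F="\<lambda>p i. R u i i"] R_trace[OF u] by simp
      finally show ?thesis by simp
    qed
    then have "(\<Sum>u\<in>U. \<Sum>b\<in>words (Suc m) d'. \<Sum>y\<in>Y. cnj (Kr (Some (u,b)) y x') * Kr (Some (u,b)) y x)
      = (\<Sum>u\<in>U. cnj (f u (word x')) * f u (word x))" by simp
    also have "\<dots> = (if word x' = word x then 1 else 0)"
      using complete[OF word_top[OF assms(2)] word_top[OF assms(1)]] True by simp
    also have "\<dots> = (if x = x' then 1 else 0)" using word_inj[OF assms] True by auto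
    finally show ?thesis using True by simp
  next
    case False
    then have "cnj (Kr (Some (u,b)) y x') * Kr (Some (u,b)) y x = 0" for u b y by (auto simp: Kr_def)
    then have "(\<Sum>u\<in>U. \<Sum>b\<in>words (Suc m) d'. \<Sum>y\<in>Y. cnj (Kr (Some (u,b)) y x') * Kr (Some (u,b)) y x) = 0"
      by simp
    then show ?thesis using False by auto
  qed
  have "fst (snd x) \<le> m" using assms(1) by (cases x) (simp add: mem_B_iff)
  then show ?thesis unfolding sum_I none some by (cases "fst (snd x) = m") simp_all
qed

lemma sum_Kr_some:
  assumes "y \<in> Y" "y' \<in> Y"
  shows "(\<Sum>u\<in>U. \<Sum>b\<in>words (Suc m) d'. Kr (Some (u,b)) y x * cnj (Kr (Some (u,b)) y' x')) =
    (if fst (snd x) = m \<and> fst (snd x') = m \<and> fst (snd y) = 0 \<and> fst (snd y') = 0 then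
      (\<Sum>u\<in>U. f u (word x) * cnj (f u (word x')) * (\<Prod>p<Suc m. R u (word y p) (word y' p))) else 0)"
proof (cases "fst (snd x) = m \<and> fst (snd x') = m \<and> fst (snd y) = 0 \<and> fst (snd y') = 0")
  case True
  have "(\<Sum>b\<in>words (Suc m) d'. Kr (Some (u,b)) y x * cnj (Kr (Some (u,b)) y' x')) =
    f u (word x) * cnj (f u (word x')) * (\<Prod>p<Suc m. R u (word y p) (word y' p))" if u: "u \<in> U" for u
  proof -
    have "(\<Sum>b\<in>words (Suc m) d'. Kr (Some (u,b)) y x * cnj (Kr (Some (u,b)) y' x')) =
      (\<Sum>b\<in>words (Suc m) d'. f u (word x) * cnj (f u (word x')) * (G u b (word y) * cnj (G u b (word y'))))"
      by (intro sum.cong refl) (use True in \<open>simp add: Kr_def\<close>)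
    then show ?thesis using sum_G[OF u word_bot[OF assms(1)] word_bot[OF assms(2)]] True
      by (simp add: sum_distrib_left[symmetric])
  qed
  then show ?thesis using True by simp
next
  case False
  then have "Kr (Some (u,b)) y x * cnj (Kr (Some (u,b)) y' x') = 0" for u b by (auto simp: Kr_def)
  then show ?thesis using False by auto
qed

lemma word_energy:
  "(\<Sum>p<Suc m. e (word (i,k,w) p)) = e i + (\<Sum>p<m. e (w p))"
  by (simp add: word_def add.commute)

text \<open>The shift exchanges two systems without changing either, and the two slot labellings
  differ at position \<open>k\<close> only.\<close>

lemma shift_energy:
  assumes "k < m"
  shows "E i + eC (k,w) = E' (w k) + eC (Suc k, w(k := i))"
proof -
  have k: "k \<in> {..<m}" using assms by simp
  have "eC (k,w) = E' (w k) + (\<Sum>p\<in>{..<m}-{k}. (if p < k then E else E') (w p))"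
    unfolding eC_def using sum.remove[OF finite_lessThan k, of "\<lambda>p. (if p < k then E else E') (w p)"] by simp
  moreover have "eC (Suc k, w(k := i)) = E i + (\<Sum>p\<in>{..<m}-{k}. (if p < Suc k then E else E') ((w(k := i)) p))"
    unfolding eC_def using sum.remove[OF finite_lessThan k, of "\<lambda>p. (if p < Suc k then E else E') ((w(k := i)) p)"] by simp
  moreover have "(\<Sum>p\<in>{..<m}-{k}. (if p < Suc k then E else E') ((w(k := i)) p)) = (\<Sum>p\<in>{..<m}-{k}. (if p < k then E else E') (w p))"
    by (rule sum.cong) auto
  ultimately show ?thesis by simp
qed

text \<open>At counter \<open>m\<close> all slots hold inputs and at counter 0 all hold outputs, so
  the energy of system plus catalyst is that of the full word and the locale assumption
  \<open>conserve\<close> applies.\<close>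

lemma Kr_covariant:
  assumes "x \<in> X" "x' \<in> X" "y \<in> Y" "y' \<in> Y"
    and "(\<Sum>a\<in>I. Kr a y x * cnj (Kr a y' x')) \<noteq> 0"
  shows "(E (fst x) + eC (snd x)) - (E (fst x') + eC (snd x')) = (E' (fst y) + eC (snd y)) - (E' (fst y') + eC (snd y'))"
proof -
  obtain i k w i' k' w' j l v j' l' v' where c: "x = (i,k,w)" "x' = (i',k',w')" "y = (j,l,v)" "y' = (j',l',v')"
    by (metis prod.exhaust)
  have cases: "Kr None y x * cnj (Kr None y' x') \<noteq> 0 \<or>
    (\<Sum>u\<in>U. \<Sum>b\<in>words (Suc m) d'. Kr (Some (u,b)) y x * cnj (Kr (Some (u,b)) y' x')) \<noteq> 0"
    using assms(5) unfolding sum_I by auto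
  then show ?thesis
  proof
    assume "Kr None y x * cnj (Kr None y' x') \<noteq> 0"
    then have "k < m" "y = shift x" "k' < m" "y' = shift x'" by (auto simp: Kr_def c split: if_splits)
    then show ?thesis using shift_energy[of k i w] shift_energy[of k' i' w'] by (simp add: c shift_def)
  next
    assume nz: "(\<Sum>u\<in>U. \<Sum>b\<in>words (Suc m) d'. Kr (Some (u,b)) y x * cnj (Kr (Some (u,b)) y' x')) \<noteq> 0"
    then have k: "k = m" "k' = m" "l = 0" "l' = 0"
      and "(\<Sum>u\<in>U. f u (word x) * cnj (f u (word x')) * (\<Prod>p<Suc m. R u (word y p) (word y' p))) \<noteq> 0"
      unfolding sum_Kr_some[OF assms(3,4)] by (auto simp: c split: if_splits)
    then have "(\<Sum>p<Suc m. E (word x p)) - (\<Sum>p<Suc m. E (word x' p)) = (\<Sum>p<Suc m. E' (word y p)) - (\<Sum>p<Suc m. E' (word y' p))"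
      using assms by (intro conserve word_top word_bot) (auto simp: c)
    then show ?thesis unfolding c word_energy k by (simp add: eC_def)
  qed
qed

section \<open>The catalyst state and the output of one round\<close>

lemma pr_nonneg: "0 \<le> pr u"
proof -
  have "pos (words (Suc m) d) (\<lambda>w w'. \<Prod>p<Suc m. \<rho> (w p) (w' p))"
  proof (rule pos_gram[where I="words (Suc m) d" and g="\<lambda>w b. \<Prod>p<Suc m. vr (w p) (b p)"])
    fix w w' assume w: "w \<in> words (Suc m) d" "w' \<in> words (Suc m) d"
    have "(\<Sum>b\<in>words (Suc m) d. (\<Prod>p<Suc m. vr (w p) (b p)) * cnj (\<Prod>p<Suc m. vr (w' p) (b p)))
      = (\<Sum>b\<in>words (Suc m) d. \<Prod>p<Suc m. vr (w p) (b p) * cnj (vr (w' p) (b p)))"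
      by (simp only: cnj_prod prod.distrib)
    also have "\<dots> = (\<Prod>p<Suc m. \<rho> (w p) (w' p))"
      unfolding sum_words_prod[where F="\<lambda>p b. vr (w p) b * cnj (vr (w' p) b)"]
      by (intro prod.cong refl \<rho>_gram[symmetric]) (use w words_less in auto)
    finally show "(\<Prod>p<Suc m. \<rho> (w p) (w' p)) = (\<Sum>b\<in>words (Suc m) d. (\<Prod>p<Suc m. vr (w p) (b p)) * cnj (\<Prod>p<Suc m. vr (w' p) (b p)))" by simp
  qed
  then show ?thesis unfolding pos_def pr_def by (elim allE[where x="\<lambda>w. cnj (f u w)"]) (simp del: prod.lessThan_Suc)
qed

lemma sum_pr: "(\<Sum>u\<in>U. pr u) = 1"
proof -
  have "(\<Sum>u\<in>U. pr u) = (\<Sum>w\<in>words (Suc m) d. \<Sum>w'\<in>words (Suc m) d. (\<Prod>p<Suc m. \<rho> (w p) (w' p)) * (\<Sum>u\<in>U. cnj (f u w') * f u w))"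
    unfolding pr_def by (subst sum_swap3) (simp add: sum_distrib_left mult_ac del: prod.lessThan_Suc)
  also have "\<dots> = (\<Sum>w\<in>words (Suc m) d. \<Sum>w'\<in>words (Suc m) d. if w' = w then (\<Prod>p<Suc m. \<rho> (w p) (w p)) else 0)"
    by (intro sum.cong refl) (auto simp: complete simp del: prod.lessThan_Suc)
  also have "\<dots> = (\<Sum>w\<in>words (Suc m) d. \<Prod>p<Suc m. \<rho> (w p) (w p))" by (simp del: prod.lessThan_Suc)
  also have "\<dots> = 1" unfolding sum_words_prod[where F="\<lambda>p i. \<rho> i i"] \<rho>_trace by simp
  finally show ?thesis .
qed

text \<open>The counter is part of the Gram index, which produces the blocks, and each slot adds the
  Gram index of its own state; the index set is therefore \<open>B\<close> again. The uniform weight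
  enters as a square root on each side.\<close>

lemma cU_gram:
  assumes u: "u \<in> U" and xy: "x \<in> B" "y \<in> B"
  defines "h \<equiv> \<lambda>(k,w) (l,b). if k = l then (\<Prod>p<m. if p < k then vr (w p) (b p) else g u (w p) (b p)) / complex_of_real (sqrt (Suc m)) else 0"
  shows "cU u x y = (\<Sum>a\<in>B. h x a * cnj (h y a))"
proof -
  obtain k w l v where c: "x = (k,w)" "y = (l,v)" by (metis prod.exhaust)
  have k: "k \<le> m" "l \<le> m" using xy by (auto simp: c B_def)
  have sq: "complex_of_real (sqrt (Suc m)) * complex_of_real (sqrt (Suc m)) = of_nat (Suc m)"
    unfolding of_real_mult[symmetric] by simp
  have "(\<Sum>a\<in>B. h x a * cnj (h y a)) = (\<Sum>l'\<le>m. \<Sum>b\<in>PiE {..<m} (\<lambda>p. {..<if p < l' then d else d'}). h x (l',b) * cnj (h y (l',b)))"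
    unfolding B_def by (subst sum.Sigma) (auto intro!: finite_PiE)
  also have "\<dots> = (\<Sum>l'\<le>m. if l' = k then (\<Sum>b\<in>PiE {..<m} (\<lambda>p. {..<if p < k then d else d'}). h x (k,b) * cnj (h y (k,b))) else 0)"
    by (intro sum.cong refl) (auto simp: h_def c)
  also have "\<dots> = (\<Sum>b\<in>PiE {..<m} (\<lambda>p. {..<if p < k then d else d'}). h x (k,b) * cnj (h y (k,b)))"
    using k by simp
  also have "\<dots> = cU u x y"
  proof (cases "k = l")
    case True
    have "(\<Sum>b\<in>PiE {..<m} (\<lambda>p. {..<if p < k then d else d'}). h x (k,b) * cnj (h y (k,b)))
      = (\<Sum>b\<in>PiE {..<m} (\<lambda>p. {..<if p < k then d else d'}). 
          \<Prod>p<m. (if p < k then vr (w p) (b p) * cnj (vr (v p) (b p)) else g u (w p) (b p) * cnj (g u (v p) (b p)))) / of_nat (Suc m)"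
      unfolding sum_divide_distrib
    proof (intro sum.cong refl)
      fix b
      have "h x (k,b) * cnj (h y (k,b)) = (\<Prod>p<m. if p < k then vr (w p) (b p) else g u (w p) (b p)) *
        (\<Prod>p<m. cnj (if p < k then vr (v p) (b p) else g u (v p) (b p))) / (complex_of_real (sqrt (Suc m)) * complex_of_real (sqrt (Suc m)))"
        using True by (simp add: h_def c del: of_nat_Suc)
      also have "\<dots> = (\<Prod>p<m. (if p < k then vr (w p) (b p) * cnj (vr (v p) (b p)) else g u (w p) (b p) * cnj (g u (v p) (b p)))) / of_nat (Suc m)"
        unfolding sq prod.distrib[symmetric] by (intro arg_cong2[where f="(/)"] prod.cong refl) auto
      finally show "h x (k,b) * cnj (h y (k,b)) = (\<Prod>p<m. (if p < k then vr (w p) (b p) * cnj (vr (v p) (b p)) else g u (w p) (b p) * cnj (g u (v p) (b p)))) / of_nat (Suc m)" .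
    qed
    also have "(\<Sum>b\<in>PiE {..<m} (\<lambda>p. {..<if p < k then d else d'}). 
          \<Prod>p<m. (if p < k then vr (w p) (b p) * cnj (vr (v p) (b p)) else g u (w p) (b p) * cnj (g u (v p) (b p))))
      = (\<Prod>p<m. \<Sum>b<(if p < k then d else d'). (if p < k then vr (w p) b * cnj (vr (v p) b) else g u (w p) b * cnj (g u (v p) b)))"
      by (rule prod_sum_PiE[symmetric]) auto
    also have "\<dots> = (\<Prod>p<m. (if p < k then \<rho> else R u) (w p) (v p))"
    proof (intro prod.cong refl)
      fix p assume "p \<in> {..<m}"
      then have "w p < (if p < k then d else d')" "v p < (if p < k then d else d')"
        using xy True by (auto simp: c B_def PiE_iff)
      then show "(\<Sum>b<(if p < k then d else d'). (if p < k then vr (w p) b * cnj (vr (v p) b) else g u (w p) b * cnj (g u (v p) b)))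
        = (if p < k then \<rho> else R u) (w p) (v p)"
        using \<rho>_gram[of "w p" "v p"] R_gram[OF u, of "w p" "v p"] by auto
    qed
    finally show ?thesis using True by (simp add: cU_def c)
  next
    case False
    then show ?thesis by (simp add: cU_def c h_def)
  qed
  finally show ?thesis by simp
qed

lemma cU_trace: "(\<Sum>x\<in>B. cU u x x) = 1" if u: "u \<in> U"
proof -
  have "(\<Sum>x\<in>B. cU u x x) = (\<Sum>k\<le>m. \<Sum>w\<in>PiE {..<m} (\<lambda>p. {..<if p < k then d else d'}). cU u (k,w) (k,w))"
    unfolding B_def by (subst sum.Sigma) (auto intro!: finite_PiE)
  also have "\<dots> = (\<Sum>k\<le>m. 1 / of_nat (Suc m))"
  proof (intro sum.cong refl)
    fix k
    have "(\<Sum>w\<in>PiE {..<m} (\<lambda>p. {..<if p < k then d else d'}). cU u (k,w) (k,w))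
      = (\<Sum>w\<in>PiE {..<m} (\<lambda>p. {..<if p < k then d else d'}). \<Prod>p<m. (if p < k then \<rho> else R u) (w p) (w p)) / of_nat (Suc m)"
      unfolding sum_divide_distrib by (simp add: cU_def)
    also have "(\<Sum>w\<in>PiE {..<m} (\<lambda>p. {..<if p < k then d else d'}). \<Prod>p<m. (if p < k then \<rho> else R u) (w p) (w p))
      = (\<Prod>p<m. \<Sum>i<(if p < k then d else d'). (if p < k then \<rho> else R u) i i)"
      by (rule prod_sum_PiE[symmetric]) auto
    also have "\<dots> = 1" by (intro prod.neutral ballI) (auto simp: \<rho>_trace R_trace[OF u])
    finally show "(\<Sum>w\<in>PiE {..<m} (\<lambda>p. {..<if p < k then d else d'}). cU u (k,w) (k,w)) = 1 / of_nat (Suc m)" .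
  qed
  also have "\<dots> = 1" by (simp del: of_nat_Suc)
  finally show ?thesis .
qed

text \<open>The core of the construction, checked counter by counter. Output counter
  \<open>Suc l\<close> arises from \<open>l\<close> by a shift: the incoming \<open>\<rho>\<close>
  fills slot \<open>l\<close> and one \<open>R u\<close> leaves, which turns \<open>cU u\<close> at
  \<open>l\<close> into \<open>cU u\<close> at \<open>Suc l\<close>. Output counter 0 arises from
  counter \<open>m\<close>, where the old estimate has left no trace and a fresh \<open>u\<close>
  appears with probability \<open>pr u\<close>. Equal weights of the counters make these pieces fit
  exactly.\<close>

lemma Kr_output:
  assumes "y \<in> Y" "y' \<in> Y"
  shows "(\<Sum>a\<in>I. \<Sum>x\<in>X. \<Sum>x'\<in>X. Kr a y x * (\<rho> (fst x) (fst x') * cat (snd x) (snd x')) * cnj (Kr a y' x'))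
    = (\<Sum>u\<in>U. pr u * (R u (fst y) (fst y') * cU u (snd y) (snd y')))"
proof -
  define Z where "Z x x' = \<rho> (fst x) (fst x') * cat (snd x) (snd x')" for x x' :: "nat \<times> nat \<times> (nat \<Rightarrow> nat)"
  have none: "(\<Sum>x\<in>X. \<Sum>x'\<in>X. Kr None y x * Z x x' * cnj (Kr None y' x'))
    = (if fst (snd y) = 0 \<or> fst (snd y') = 0 then 0 else Z (unshift y) (unshift y'))"
  proof -
    have "(\<Sum>x\<in>X. \<Sum>x'\<in>X. Kr None y x * Z x x' * cnj (Kr None y' x'))
      = (\<Sum>x\<in>X. Kr None y x * (\<Sum>x'\<in>X. Kr None y' x' * Z x x'))"
      unfolding cnj_Kr_None by (simp add: sum_distrib_left mult_ac)
    then show ?thesis unfolding sum_shift[OF assms(2)] sum_shift[OF assms(1)] by simp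
  qed
  have some: "(\<Sum>u\<in>U. \<Sum>b\<in>words (Suc m) d'. \<Sum>x\<in>X. \<Sum>x'\<in>X. Kr (Some (u,b)) y x * Z x x' * cnj (Kr (Some (u,b)) y' x'))
    = (if fst (snd y) = 0 \<and> fst (snd y') = 0 then 
       (\<Sum>u\<in>U. pr u * (\<Prod>p<Suc m. R u (word y p) (word y' p))) / of_nat (Suc m) else 0)"
  proof -
    \<comment> \<open>At counter \<open>m\<close> the catalyst holds no outputs, so
      \<open>cU u\<close> does not depend on \<open>u\<close> and the probabilities sum to 1: the
      measured systems are exactly \<open>Suc m\<close> independent copies of
      \<open>\<rho>\<close>.\<close>
    have Z_top: "Z x x' = (\<Prod>p<Suc m. \<rho> (word x p) (word x' p)) / of_nat (Suc m)"
      if "fst (snd x) = m" "fst (snd x') = m" for x x'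
    proof -
      have "cat (snd x) (snd x') = (\<Prod>p<m. \<rho> (snd (snd x) p) (snd (snd x') p)) / of_nat (Suc m) * (\<Sum>u\<in>U. pr u)"
        using that by (simp add: cat_def cU_def sum_distrib_right sum_distrib_left sum_divide_distrib mult.commute)
      then show ?thesis by (simp add: Z_def word_def sum_pr mult_ac)
    qed
    define H where "H w w' = (if fst (snd y) = 0 \<and> fst (snd y') = 0 then
        (\<Prod>p<Suc m. \<rho> (w p) (w' p)) / of_nat (Suc m) *
        (\<Sum>u\<in>U. f u w * cnj (f u w') * (\<Prod>p<Suc m. R u (word y p) (word y' p))) else 0)" for w w'
    have H: "Z x x' * (\<Sum>u\<in>U. \<Sum>b\<in>words (Suc m) d'. Kr (Some (u,b)) y x * cnj (Kr (Some (u,b)) y' x'))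
      = (if fst (snd x) = m then (if fst (snd x') = m then H (word x) (word x') else 0) else 0)" for x x'
    proof (cases "fst (snd x) = m \<and> fst (snd x') = m")
      case True
      then show ?thesis using Z_top[of x x'] unfolding sum_Kr_some[OF assms] H_def by simp
    next
      case False
      then show ?thesis unfolding sum_Kr_some[OF assms] by auto
    qed
    have "(\<Sum>u\<in>U. \<Sum>b\<in>words (Suc m) d'. \<Sum>x\<in>X. \<Sum>x'\<in>X. Kr (Some (u,b)) y x * Z x x' * cnj (Kr (Some (u,b)) y' x'))
      = (\<Sum>x'\<in>X. \<Sum>x\<in>X. \<Sum>u\<in>U. \<Sum>b\<in>words (Suc m) d'. Kr (Some (u,b)) y x * Z x x' * cnj (Kr (Some (u,b)) y' x'))"
      by (rule sum_swap4)
    also have "\<dots> = (\<Sum>x\<in>X. \<Sum>x'\<in>X. \<Sum>u\<in>U. \<Sum>b\<in>words (Suc m) d'. Kr (Some (u,b)) y x * Z x x' * cnj (Kr (Some (u,b)) y' x'))"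
      by (rule sum.swap)
    also have "\<dots> = (\<Sum>x\<in>X. \<Sum>x'\<in>X. Z x x' * (\<Sum>u\<in>U. \<Sum>b\<in>words (Suc m) d'. Kr (Some (u,b)) y x * cnj (Kr (Some (u,b)) y' x')))"
      by (simp only: sum_distrib_left mult_ac)
    also have "\<dots> = (\<Sum>x\<in>X. if fst (snd x) = m then (\<Sum>x'\<in>X. if fst (snd x') = m then H (word x) (word x') else 0) else 0)"
      unfolding H by (intro sum.cong refl) auto
    also have "\<dots> = (\<Sum>x\<in>X. if fst (snd x) = m then (\<Sum>w'\<in>words (Suc m) d. H (word x) w') else 0)"
    proof (rule sum.cong[OF refl])
      fix x
      show "(if fst (snd x) = m then (\<Sum>x'\<in>X. if fst (snd x') = m then H (word x) (word x') else 0) else 0)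
        = (if fst (snd x) = m then (\<Sum>w'\<in>words (Suc m) d. H (word x) w') else 0)"
        using sum_top[where F="H (word x)"] by simp
    qed
    also have "\<dots> = (\<Sum>w\<in>words (Suc m) d. \<Sum>w'\<in>words (Suc m) d. H w w')"
      by (rule sum_top[where F="\<lambda>w. \<Sum>w'\<in>words (Suc m) d. H w w'"])
    also have "\<dots> = (if fst (snd y) = 0 \<and> fst (snd y') = 0 then 
       (\<Sum>w\<in>words (Suc m) d. \<Sum>w'\<in>words (Suc m) d. \<Sum>u\<in>U. f u w * (\<Prod>p<Suc m. \<rho> (w p) (w' p)) * cnj (f u w') * 
         ((\<Prod>p<Suc m. R u (word y p) (word y' p)) / of_nat (Suc m))) else 0)"
      unfolding H_def
      by (simp add: sum_distrib_left mult_ac del: prod.lessThan_Suc of_nat_Suc)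
    also have "\<dots> = (if fst (snd y) = 0 \<and> fst (snd y') = 0 then 
       (\<Sum>u\<in>U. pr u * (\<Prod>p<Suc m. R u (word y p) (word y' p))) / of_nat (Suc m) else 0)"
      unfolding sum_swap3[symmetric, where A=U] pr_def sum_distrib_right sum_divide_distrib
      by (simp add: mult_ac del: prod.lessThan_Suc of_nat_Suc)
    finally show ?thesis .
  qed
  obtain j k w j' k' w' where c: "y = (j,k,w)" "y' = (j',k',w')" by (metis prod.exhaust)
  have k: "k \<le> m" using assms(1) by (auto simp: c B_def)
  have "(\<Sum>a\<in>I. \<Sum>x\<in>X. \<Sum>x'\<in>X. Kr a y x * Z x x' * cnj (Kr a y' x'))
    = (\<Sum>u\<in>U. pr u * (R u (fst y) (fst y') * cU u (snd y) (snd y')))"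
  proof (cases "k = k'")
    case False
    then show ?thesis unfolding sum_I none some
      by (cases "k = 0"; cases "k' = 0") (auto simp: c Z_def unshift_def cat_def cU_def)
  next
    case True
    show ?thesis
    proof (cases k)
      case 0
      then show ?thesis using True unfolding sum_I none some
        by (simp add: c cU_def word_def sum_divide_distrib mult_ac del: of_nat_Suc)
    next
      case (Suc l)
      then have l: "l \<in> {..<m}" using k by simp
      \<comment> \<open>The products agree in all factors except at slot \<open>l\<close>, where the
        \<open>\<rho>\<close> of the input trades places with the \<open>R u\<close> of the released
        output.\<close>
      have "\<rho> (w l) (w' l) * cU u (l, w(l := j)) (l, w'(l := j')) = R u j j' * cU u (Suc l, w) (Suc l, w')" for u
      proof -
        have "(\<Prod>p<m. (if p < l then \<rho> else R u) ((w(l := j)) p) ((w'(l := j')) p)) =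
          R u j j' * (\<Prod>p\<in>{..<m}-{l}. (if p < l then \<rho> else R u) ((w(l := j)) p) ((w'(l := j')) p))"
          by (subst prod.remove[OF finite_lessThan l]) simp
        moreover have "(\<Prod>p<m. (if p < Suc l then \<rho> else R u) (w p) (w' p)) =
          \<rho> (w l) (w' l) * (\<Prod>p\<in>{..<m}-{l}. (if p < Suc l then \<rho> else R u) (w p) (w' p))"
          by (subst prod.remove[OF finite_lessThan l]) simp
        moreover have "(\<Prod>p\<in>{..<m}-{l}. (if p < l then \<rho> else R u) ((w(l := j)) p) ((w'(l := j')) p))
          = (\<Prod>p\<in>{..<m}-{l}. (if p < Suc l then \<rho> else R u) (w p) (w' p))"
          by (rule prod.cong) auto
        ultimately show ?thesis by (simp add: cU_def del: of_nat_Suc)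
      qed
      then have key: "\<rho> (w l) (w' l) * (pr u * cU u (l, w(l := j)) (l, w'(l := j'))) = pr u * (R u j j' * cU u (Suc l, w) (Suc l, w'))" for u
        by (metis mult.left_commute)
      have k': "k' = Suc l" using True Suc by simp
      show ?thesis unfolding sum_I none some unfolding c \<open>k = Suc l\<close> k'
        by (simp add: Z_def unshift_def cat_def sum_distrib_left, intro sum.cong refl key)
    qed
  qed
  then show ?thesis by (simp add: Z_def)
qed

end

section \<open>From configurations to matrices\<close>

lemma ham_sum_diagm:
  "ham_sum d (diagm d (\<lambda>i. complex_of_real (E i))) n (diagm n (\<lambda>a. complex_of_real (F a)))
    = diagm (d * n) (\<lambda>r. complex_of_real (E (r div n) + F (r mod n)))"
proof (rule eq_matI)
  fix r s assume "r < dim_row (diagm (d * n) (\<lambda>r. complex_of_real (E (r div n) + F (r mod n))))"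
    "s < dim_col (diagm (d * n) (\<lambda>r. complex_of_real (E (r div n) + F (r mod n))))"
  then have r: "r < d * n" and s: "s < d * n" by auto
  have "r = s \<longleftrightarrow> r div n = s div n \<and> r mod n = s mod n" by (metis div_mult_mod_eq)
  then show "ham_sum d (diagm d (\<lambda>i. complex_of_real (E i))) n (diagm n (\<lambda>a. complex_of_real (F a))) $$ (r,s)
    = diagm (d * n) (\<lambda>r. complex_of_real (E (r div n) + F (r mod n))) $$ (r,s)"
    using r s div_mod_less[OF r] div_mod_less[OF s]
      kron_carrier[OF one_carrier_mat diagm_carrier, of d n "\<lambda>a. complex_of_real (F a)"]
    by (simp add: ham_sum_def kron_index[OF diagm_carrier one_carrier_mat r s] kron_index[OF one_carrier_mat diagm_carrier r s])
qed (auto simp: ham_sum_def kron_def)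

lemma hermitian_diagm: "hermitian n (diagm n (\<lambda>i. complex_of_real (d i)))"
  by (simp add: hermitian_def adj_diagm)

context measure_prepare
begin

lemma pos_tensor_cU:
  assumes "u \<in> U" "pos {..<d'} K"
  shows "pos Y (\<lambda>y y'. K (fst y) (fst y') * cU u (snd y) (snd y'))"
  by (rule pos_tensor_gram[OF assms(2) cU_gram[OF assms(1)]])

lemma pos_cat: "pos B cat"
  unfolding cat_def
  by (intro pos_sum pos_scale pr_nonneg pos_gram[OF cU_gram])

text \<open>The error \<open>\<tau> - kron \<sigma> c\<close> is the average over \<open>u\<close>
  of \<open>R u - \<sigma>\<close> tensored with \<open>cU u\<close>. Each term is dominated by a
  multiple of the identity tensored with the same positive \<open>cU u\<close> of trace 1, so the
  bound involves \<open>d'\<close> but not the dimension of the catalyst.\<close>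

theorem correlated_catalysis_diagm:
  assumes herm: "hermitian d' \<sigma>"
    and bound: "real d' * (\<Sum>u\<in>U. Re (pr u) * (\<Sum>r<d'. \<Sum>s<d'. cmod (R u r s - \<sigma> $$ (r,s)))) < \<epsilon>"
  shows "correlated_catalysis d (diagm d (\<lambda>i. complex_of_real (E i))) (mat d d (\<lambda>(i,j). \<rho> i j))
    d' (diagm d' (\<lambda>i. complex_of_real (E' i))) \<sigma> (mat d' d' (\<lambda>(r,s). \<Sum>u\<in>U. pr u * R u r s)) \<epsilon>"
proof -
  define n where "n = card B"
  obtain en where en: "bij_betw en {..<n} B"
    using ex_bij_betw_nat_finite[OF finite_B] unfolding n_def atLeast0LessThan by blast
  \<comment> \<open>Decodes a matrix index into a system letter and an element of \<open>B\<close>;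
    all kernel facts are transported through it.\<close>
  define h where "h r = (r div n, en (r mod n))" for r
  have bij_h: "bij_betw h {..<D * n} ({..<D} \<times> B)" for D
  proof -
    have "bij_betw (map_prod id en) ({..<D} \<times> {..<n}) ({..<D} \<times> B)"
      using en unfolding bij_betw_def by (auto simp: map_prod_inj_on map_prod_surj_on)
    from bij_betw_trans[OF bij_betw_div_mod this] show ?thesis
      by (simp add: comp_def h_def[abs_def])
  qed
  have h_mem: "h r \<in> {..<D} \<times> B" if "r < D * n" for r D
    using bij_betw_apply[OF bij_h, of r D] that by simp
  have h_inj: "h r = h s \<longleftrightarrow> r = s" if "r < D * n" "s < D * n" for r s D
    using bij_betw_imp_inj_on[OF bij_h[of D]] that by (auto simp: inj_on_def)
  have sum_h: "(\<Sum>r<D * n. F (h r)) = (\<Sum>x\<in>{..<D} \<times> B. F x)" for F :: "_ \<Rightarrow> complex" and D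
    by (rule sum.reindex_bij_betw[OF bij_h])
  have h_pair: "h (i * n + a) = (i, en a)" if "a < n" for i a
    using that by (simp add: h_def)
  define eD where "eD a = eC (en a)" for a
  define HC where "HC = diagm n (\<lambda>a. complex_of_real (eD a))"
  define c where "c = mat n n (\<lambda>(a,b). cat (en a) (en b))"
  define K where "K a r s = Kr a (h r) (h s)" for a r s
  define \<Lambda> where "\<Lambda> = kraus (d*n) (d'*n) I K"
  define \<rho>m where "\<rho>m = mat d d (\<lambda>(i,j). \<rho> i j)"
  have ch: "channel (d*n) (d'*n) \<Lambda>"
    unfolding \<Lambda>_def
  proof (rule kraus_channel)
    fix x y assume x: "x < d*n" and y: "y < d*n"
    have "(\<Sum>a\<in>I. \<Sum>r<d'*n. cnj (K a r y) * K a r x) = (\<Sum>a\<in>I. \<Sum>z\<in>Y. cnj (Kr a z (h y)) * Kr a z (h x))"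
      unfolding K_def by (intro sum.cong[OF refl] sum_h[where F="\<lambda>z. cnj (Kr _ z (h y)) * Kr _ z (h x)"])
    also have "\<dots> = (if x = y then 1 else 0)"
      unfolding Kr_trace_preserving[OF h_mem[OF x] h_mem[OF y]] h_inj[OF x y] ..
    finally show "(\<Sum>a\<in>I. \<Sum>r<d'*n. cnj (K a r y) * K a r x) = (if x = y then 1 else 0)" .
  qed
  have cov: "covariant (d*n) (ham_sum d (diagm d (\<lambda>i. complex_of_real (E i))) n HC)
      (d'*n) (ham_sum d' (diagm d' (\<lambda>i. complex_of_real (E' i))) n HC) \<Lambda>"
    unfolding HC_def ham_sum_diagm \<Lambda>_def
  proof (rule kraus_covariant)
    fix r s x y assume *: "r < d'*n" "s < d'*n" "x < d*n" "y < d*n" "(\<Sum>a\<in>I. K a r x * cnj (K a s y)) \<noteq> 0"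
    show "(E (x div n) + eD (x mod n)) - (E (y div n) + eD (y mod n)) =
      (E' (r div n) + eD (r mod n)) - (E' (s div n) + eD (s mod n))"
      using Kr_covariant[OF h_mem[OF *(3)] h_mem[OF *(4)] h_mem[OF *(1)] h_mem[OF *(2)] *(5)[unfolded K_def]]
      by (simp add: h_def eD_def)
  qed
  have cc: "c \<in> carrier_mat n n" by (simp add: c_def)
  have en_mem: "a < n \<Longrightarrow> en a \<in> B" for a using bij_betw_apply[OF en] by simp
  have "pos {..<n} (\<lambda>a b. c $$ (a,b))"
    using pos_reindex[OF en pos_cat] by (subst pos_cong[where L="\<lambda>a b. cat (en a) (en b)"]) (auto simp: c_def)
  then have psd_c: "psd n c" using cc by (simp add: psd_iff_pos)
  have trace_cU: "(\<Sum>a<n. cU u (en a) (en a)) = 1" if "u \<in> U" for u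
    using sum.reindex_bij_betw[OF en, of "\<lambda>x. cU u x x"] cU_trace[OF that] by simp
  have "mtrace c = (\<Sum>a<n. \<Sum>u\<in>U. pr u * cU u (en a) (en a))"
    by (simp add: mtrace_def c_def cat_def)
  also have "\<dots> = (\<Sum>u\<in>U. pr u * (\<Sum>a<n. cU u (en a) (en a)))"
    unfolding sum_distrib_left by (rule sum.swap)
  also have "\<dots> = 1" using trace_cU sum_pr by simp
  finally have st_c: "state n c" using psd_c by (simp add: state_def)
  have \<rho>mc: "\<rho>m \<in> carrier_mat d d" by (simp add: \<rho>m_def)
  have "pos {..<d} (\<lambda>i j. \<rho>m $$ (i,j))"
    by (rule pos_gram[where I="{..<d}" and g=vr]) (simp add: \<rho>m_def \<rho>_gram)
  then have psd_\<rho>m: "psd d \<rho>m" using \<rho>mc by (simp add: psd_iff_pos)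
  define \<tau> where "\<tau> = \<Lambda> (kron \<rho>m c)"
  have \<tau>_psd: "psd (d'*n) \<tau>" unfolding \<tau>_def by (rule channel_psd[OF ch psd_kron[OF psd_\<rho>m psd_c]])
  then have \<tau>c: "\<tau> \<in> carrier_mat (d'*n) (d'*n)" by (simp add: psd_iff_pos)
  have \<tau>_index: "\<tau> $$ (r,s) = (\<Sum>u\<in>U. pr u * (R u (fst (h r)) (fst (h s)) * cU u (snd (h r)) (snd (h s))))"
    if r: "r < d'*n" and s: "s < d'*n" for r s
  proof -
    define T where "T a x y = Kr a (h r) x * (\<rho> (fst x) (fst y) * cat (snd x) (snd y)) * cnj (Kr a (h s) y)" for a x y
    have "\<tau> $$ (r,s) = (\<Sum>a\<in>I. \<Sum>x<d*n. \<Sum>y<d*n. K a r x * kron \<rho>m c $$ (x,y) * cnj (K a s y))"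
      using r s by (simp add: \<tau>_def \<Lambda>_def kraus_def)
    also have "\<dots> = (\<Sum>a\<in>I. \<Sum>x<d*n. \<Sum>y<d*n. T a (h x) (h y))"
    proof (intro sum.cong refl)
      fix a x y assume "x \<in> {..<d*n}" "y \<in> {..<d*n}"
      then have x: "x < d*n" and y: "y < d*n" by auto
      show "K a r x * kron \<rho>m c $$ (x,y) * cnj (K a s y) = T a (h x) (h y)"
        unfolding kron_index[OF \<rho>mc cc x y] T_def K_def
        using div_mod_less[OF x] div_mod_less[OF y] by (simp add: h_def \<rho>m_def c_def)
    qed
    also have "\<dots> = (\<Sum>a\<in>I. \<Sum>x<d*n. \<Sum>y\<in>X. T a (h x) y)"
      by (simp only: sum_h)
    also have "\<dots> = (\<Sum>a\<in>I. \<Sum>x\<in>X. \<Sum>y\<in>X. T a x y)"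
      by (rule sum.cong[OF refl sum_h[where F="\<lambda>x. \<Sum>y\<in>X. T _ x y"]])
    also have "\<dots> = (\<Sum>u\<in>U. pr u * (R u (fst (h r)) (fst (h s)) * cU u (snd (h r)) (snd (h s))))"
      unfolding T_def by (rule Kr_output[OF h_mem[OF r] h_mem[OF s]])
    finally show ?thesis .
  qed
  have \<tau>_index': "\<tau> $$ (i * n + a, j * n + b) = (\<Sum>u\<in>U. pr u * (R u i j * cU u (en a) (en b)))"
    if "i < d'" "j < d'" "a < n" "b < n" for i j a b
    using \<tau>_index[OF index_less[OF that(1,3)] index_less[OF that(2,4)]] that by (simp add: h_pair)
  have pB: "ptrace_B d' n \<tau> = mat d' d' (\<lambda>(r,s). \<Sum>u\<in>U. pr u * R u r s)"
  proof (rule eq_matI)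
    fix i j assume "i < dim_row (mat d' d' (\<lambda>(r,s). \<Sum>u\<in>U. pr u * R u r s))"
      "j < dim_col (mat d' d' (\<lambda>(r,s). \<Sum>u\<in>U. pr u * R u r s))"
    then have i: "i < d'" and j: "j < d'" by auto
    have "ptrace_B d' n \<tau> $$ (i,j) = (\<Sum>a<n. \<Sum>u\<in>U. pr u * (R u i j * cU u (en a) (en a)))"
      using i j by (simp add: ptrace_B_def \<tau>_index')
    also have "\<dots> = (\<Sum>u\<in>U. pr u * R u i j * (\<Sum>a<n. cU u (en a) (en a)))"
      by (subst sum.swap) (simp add: sum_distrib_left mult.assoc)
    finally show "ptrace_B d' n \<tau> $$ (i,j) = mat d' d' (\<lambda>(r,s). \<Sum>u\<in>U. pr u * R u r s) $$ (i,j)"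
      using i j by (simp add: trace_cU)
  qed (auto simp: ptrace_B_def)
  have pA: "ptrace_A d' n \<tau> = c"
  proof (rule eq_matI)
    fix a b assume "a < dim_row c" "b < dim_col c"
    then have a: "a < n" and b: "b < n" using cc by auto
    have "ptrace_A d' n \<tau> $$ (a,b) = (\<Sum>i<d'. \<Sum>u\<in>U. pr u * (R u i i * cU u (en a) (en b)))"
      using a b by (simp add: ptrace_A_def \<tau>_index')
    also have "\<dots> = (\<Sum>u\<in>U. pr u * cU u (en a) (en b) * (\<Sum>i<d'. R u i i))"
      by (subst sum.swap) (simp add: sum_distrib_left sum_distrib_right mult_ac)
    finally show "ptrace_A d' n \<tau> $$ (a,b) = c $$ (a,b)"
      using a b by (simp add: R_trace c_def cat_def)
  qed (use cc in \<open>auto simp: ptrace_A_def\<close>)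
  have \<sigma>c: "\<sigma> \<in> carrier_mat d' d'" using herm by (simp add: hermitian_def)
  define \<eta> where "\<eta> u = (\<Sum>r<d'. \<Sum>s<d'. cmod (R u r s - \<sigma> $$ (r,s)))" for u
  define D where "D u r s = R u r s - \<sigma> $$ (r,s)" for u r s
  \<comment> \<open>The dominating operator: the average of \<open>\<eta> u\<close> times the
    identity tensored with \<open>cU u\<close>. Its trace is \<open>d'\<close> times the averaged
    entrywise error, the left side of \<open>bound\<close>.\<close>
  define P where "P = mat (d'*n) (d'*n) (\<lambda>(r,s). \<Sum>u\<in>U. pr u *
    ((if fst (h r) = fst (h s) then complex_of_real (\<eta> u) else 0) * cU u (snd (h r)) (snd (h s))))"
  have P_index: "P $$ (r,s) = (\<Sum>u\<in>U. pr u *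
    ((if fst (h r) = fst (h s) then complex_of_real (\<eta> u) else 0) * cU u (snd (h r)) (snd (h s))))"
    if "r < d'*n" "s < d'*n" for r s using that by (simp add: P_def)
  let ?A = "\<tau> - kron \<sigma> c"
  have A_index: "?A $$ (r,s) = (\<Sum>u\<in>U. pr u * (D u (fst (h r)) (fst (h s)) * cU u (snd (h r)) (snd (h s))))"
    if r: "r < d'*n" and s: "s < d'*n" for r s
  proof -
    have "kron \<sigma> c $$ (r,s) = (\<Sum>u\<in>U. pr u * (\<sigma> $$ (fst (h r), fst (h s)) * cU u (snd (h r)) (snd (h s))))"
      unfolding kron_index[OF \<sigma>c cc r s] using div_mod_less[OF r] div_mod_less[OF s]
      by (simp add: c_def cat_def h_def sum_distrib_left mult_ac)
    then show ?thesis using \<tau>_index[OF r s] r s kron_carrier[OF \<sigma>c cc]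
      by (simp add: D_def sum_subtractf[symmetric] algebra_simps)
  qed
  have D_herm: "D u r s = cnj (D u s r)" if "u \<in> U" "r < d'" "s < d'" for u r s
    using hermitianD[OF herm that(2,3)] R_gram[OF that] R_gram[OF that(1,3,2)] by (simp add: D_def mult.commute)
  have pos_pm: "pos {..<d'*n} (\<lambda>r s. P $$ (r,s) + z * ?A $$ (r,s))" if z: "z = 1 \<or> z = -1" for z
  proof -
    have "pos {..<d'} (\<lambda>r s. (if r = s then complex_of_real (\<eta> u) else 0) + z * D u r s)" if u: "u \<in> U" for u
    proof (rule pos_diag_dominant)
      show "z * D u r s = cnj (z * D u s r)" if "r \<in> {..<d'}" "s \<in> {..<d'}" for r s
        using D_herm[OF u, of r s] that z by auto
      show "(\<Sum>r<d'. \<Sum>s<d'. cmod (z * D u r s)) \<le> \<eta> u"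
        using z by (auto simp: \<eta>_def D_def norm_mult)
    qed simp
    then have "pos Y (\<lambda>y y'. \<Sum>u\<in>U. pr u * (((if fst y = fst y' then complex_of_real (\<eta> u) else 0) + z * D u (fst y) (fst y'))
        * cU u (snd y) (snd y')))"
      by (intro pos_sum pos_scale pr_nonneg pos_tensor_cU)
    from pos_reindex[OF bij_h this] show ?thesis
    proof (rule pos_cong[THEN iffD1, rotated])
      fix r s assume "r \<in> {..<d'*n}" "s \<in> {..<d'*n}"
      then have r: "r < d'*n" and s: "s < d'*n" by auto
      show "(\<Sum>u\<in>U. pr u * (((if fst (h r) = fst (h s) then complex_of_real (\<eta> u) else 0) + z * D u (fst (h r)) (fst (h s)))
        * cU u (snd (h r)) (snd (h s)))) = P $$ (r,s) + z * ?A $$ (r,s)"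
        unfolding A_index[OF r s] P_index[OF r s] sum_distrib_left sum.distrib[symmetric]
        by (intro sum.cong refl) (simp add: algebra_simps)
    qed
  qed
  have "trace_norm ?A \<le> Re (mtrace P)"
  proof (rule trace_norm_le)
    show "hermitian (d'*n) ?A"
      by (rule hermitian_minus[OF psd_hermitian[OF \<tau>_psd] hermitian_kron[OF herm psd_hermitian[OF psd_c]]])
    show "P \<in> carrier_mat (d'*n) (d'*n)" by (simp add: P_def)
    show "pos {..<d'*n} (\<lambda>i j. P $$ (i,j) + ?A $$ (i,j))" using pos_pm[of 1] by simp
    show "pos {..<d'*n} (\<lambda>i j. P $$ (i,j) + - (?A $$ (i,j)))" using pos_pm[of "-1"] by simp
  qed
  also have "mtrace P = (\<Sum>r<d'*n. (\<lambda>i a. \<Sum>u\<in>U. pr u * (complex_of_real (\<eta> u) * cU u (en a) (en a))) (r div n) (r mod n))"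
    by (simp add: mtrace_def P_def h_def)
  also have "\<dots> = (\<Sum>i<d'. \<Sum>a<n. \<Sum>u\<in>U. pr u * (complex_of_real (\<eta> u) * cU u (en a) (en a)))"
    by (rule sum_div_mod)
  also have "\<dots> = of_nat d' * (\<Sum>u\<in>U. pr u * complex_of_real (\<eta> u) * (\<Sum>a<n. cU u (en a) (en a)))"
    by (subst sum.swap) (simp add: sum_distrib_left mult_ac)
  also have "\<dots> = of_nat d' * (\<Sum>u\<in>U. pr u * complex_of_real (\<eta> u))" by (simp add: trace_cU)
  also have "Re \<dots> = real d' * (\<Sum>u\<in>U. Re (pr u) * \<eta> u)" by simp
  finally have "trace_norm ?A < \<epsilon>" using bound unfolding \<eta>_def by linarith
  then show ?thesis unfolding correlated_catalysis_def Let_def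
    using ch cov st_c pB pA hermitian_diagm[of n eD] unfolding \<tau>_def \<rho>m_def[symmetric] HC_def by blast
qed

end

section \<open>Phase estimation\<close>

lemma sum_words2_prod:
  "(\<Sum>w\<in>words k D. \<Sum>w'\<in>words k D'. \<Prod>p<k. F p (w p) (w' p)) = (\<Prod>p<k. \<Sum>i<D. \<Sum>j<D'. (F p i j :: 'a :: comm_semiring_1))"
proof -
  have "(\<Sum>w'\<in>words k D'. \<Prod>p<k. F p (w p) (w' p)) = (\<Prod>p<k. \<Sum>j<D'. F p (w p) j)" for w
    by (rule sum_words_prod[where F="\<lambda>p. F p (w p)"])
  then show ?thesis by (simp only: sum_words_prod[where F="\<lambda>p i. \<Sum>j<D'. F p i j"])
qed

text \<open>Orthogonality of characters in the form used below: every selection rule comes from a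
  relabelling of the outcomes that multiplies the summand by a root of unity.\<close>

lemma sum_eq_0_by_shift:
  fixes F :: "'b \<Rightarrow> complex"
  assumes "bij_betw \<phi> S S" "\<And>u. u \<in> S \<Longrightarrow> F (\<phi> u) = c * F u" "c \<noteq> 1"
  shows "(\<Sum>u\<in>S. F u) = 0"
proof -
  have "(\<Sum>u\<in>S. F u) = (\<Sum>u\<in>S. F (\<phi> u))" by (rule sum.reindex_bij_betw[OF assms(1), symmetric])
  also have "\<dots> = c * (\<Sum>u\<in>S. F u)" by (simp add: assms(2) sum_distrib_left)
  finally show ?thesis using assms(3) by (metis mult_cancel_right1 mult.commute)
qed

lemma norm_1_cnj: "cmod z = 1 \<Longrightarrow> z * cnj z = 1"
  using complex_norm_square[of z] by simp

lemma norm_power_int_diff_1: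
  assumes "cmod z = 1"
  shows "cmod (z powi k - 1) \<le> real_of_int \<bar>k\<bar> * cmod (z - 1)"
proof -
  have nat: "cmod (z ^ n - 1) \<le> real n * cmod (z - 1)" for n
    using norm_power_diff[of z 1 n] assms by simp
  show ?thesis
  proof (cases "k \<ge> 0")
    case True
    then show ?thesis using nat[of "nat k"] by (simp add: power_int_def)
  next
    case False
    define y where "y = z ^ nat (- k)"
    have y: "cmod y = 1" "y \<noteq> 0" using assms by (auto simp: y_def norm_power)
    have "cmod (z powi k - 1) = cmod (inverse y - 1)"
      using False by (simp add: power_int_def y_def power_inverse)
    also have "inverse y - 1 = - (inverse y * (y - 1))" using y by (simp add: algebra_simps)
    also have "cmod (- (inverse y * (y - 1))) = cmod (y - 1)" using y by (simp add: norm_mult norm_inverse)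
    finally show ?thesis using nat[of "nat (- k)"] False by (simp add: y_def)
  qed
qed

text \<open>The difference of the directions, scaled by \<open>cmod a\<close>, splits into a radial
  part and \<open>z - a\<close>; each is at most \<open>cmod (z - a)\<close>, whence the factor
  2.\<close>

lemma sgn_diff_le:
  assumes "a \<noteq> (0::complex)" "z \<noteq> 0"
  shows "cmod (sgn z * cnj (sgn a) - 1) \<le> 2 * cmod (z - a) / cmod a"
proof -
  have a: "cmod (sgn a) = 1" using assms by (simp add: norm_sgn)
  have "cmod (sgn z * cnj (sgn a) - 1) = cmod ((sgn z - sgn a) * cnj (sgn a))"
    using norm_1_cnj[OF a] by (simp add: left_diff_distrib)
  also have "\<dots> = cmod (sgn z - sgn a)" using a by (simp add: norm_mult)
  finally have eq: "cmod (sgn z * cnj (sgn a) - 1) = cmod (sgn z - sgn a)" .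
  have sz: "z = complex_of_real (cmod z) * sgn z" and sa: "a = complex_of_real (cmod a) * sgn a"
    using assms by (simp_all add: sgn_div_norm scaleR_conv_of_real)
  have "complex_of_real (cmod a) * (sgn z - sgn a) = complex_of_real (cmod a - cmod z) * sgn z + (z - a)"
    using sz sa by (metis (no_types, opaque_lifting) add_diff_eq diff_add_cancel left_diff_distrib of_real_diff right_diff_distrib)
  then have "cmod a * cmod (sgn z - sgn a) \<le> \<bar>cmod a - cmod z\<bar> * cmod (sgn z) + cmod (z - a)"
    using norm_triangle_ineq[of "complex_of_real (cmod a - cmod z) * sgn z" "z - a"]
    by (metis norm_mult norm_of_real abs_norm_cancel)
  also have "\<dots> \<le> 2 * cmod (z - a)"
    using norm_triangle_ineq3[of a z] assms(2) by (simp add: norm_sgn norm_minus_commute)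
  finally show ?thesis unfolding eq using assms(1) by (simp add: field_simps)
qed

lemma cis_root_powi_eq_1:
  assumes "cis (2 * pi / real q) powi n = 1" "\<bar>n\<bar> < int q"
  shows "n = 0"
proof (rule ccontr)
  assume n: "n \<noteq> 0"
  have q: "0 < q" using assms(2) by linarith
  define j where "j = nat \<bar>n\<bar>"
  have j: "0 < j" "j < q" using n assms(2) by (auto simp: j_def)
  have "cis (2 * pi / real q) ^ j = 1"
  proof (cases "n \<ge> 0")
    case True
    then show ?thesis using assms(1) by (simp add: power_int_def j_def)
  next
    case False
    then have "inverse (cis (2 * pi / real q)) ^ j = 1" using assms(1) by (simp add: power_int_def j_def)
    then show ?thesis by (metis inverse_1 inverse_inverse_eq power_inverse)
  qed
  then have eq: "cis (2 * pi * real j / real q) = cis (2 * pi * real 0 / real q)"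
    by (simp add: DeMoivre mult_ac)
  have inj: "inj_on (\<lambda>j. cis (2 * pi * real j / real q)) {..<q}"
    using bij_betw_roots_unity[OF q] by (simp add: bij_betw_def)
  show False using inj_onD[OF inj eq] j q by simp
qed

text \<open>\<open>L\<close> lists the coherences of \<open>\<rho>\<close> whose phases are
  estimated, so they are off-diagonal and nonzero; \<open>k r\<close> gives the integer powers of
  these phases applied to output level \<open>r\<close>. The bound \<open>3 \<le> q\<close> comes
  from the fourth moments.\<close>

locale phase_estimation =
  fixes d d' :: nat and E E' :: "nat \<Rightarrow> real" and \<rho> vr :: "nat \<Rightarrow> nat \<Rightarrow> complex"
    and L :: "(nat \<times> nat) set" and k :: "nat \<Rightarrow> nat \<times> nat \<Rightarrow> int" and m q :: nat
  assumes \<rho>_gram: "\<And>i j. i < d \<Longrightarrow> j < d \<Longrightarrow> \<rho> i j = (\<Sum>b<d. vr i b * cnj (vr j b))"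
    and \<rho>_trace: "(\<Sum>i<d. \<rho> i i) = 1"
    and L_fin: "finite L"
    and L: "\<And>i j. (i,j) \<in> L \<Longrightarrow> i < d \<and> j < d \<and> i \<noteq> j \<and> \<rho> i j \<noteq> 0"
    and q3: "3 \<le> q"
begin

text \<open>The weight of output level \<open>r\<close> under rephasing of input level
  \<open>i\<close>: multiplying every \<open>u p i\<close> by \<open>\<zeta>\<close> multiplies
  \<open>V u r\<close> by \<open>\<zeta> powi \<kappa> r i\<close>.\<close>

definition \<kappa> :: "nat \<Rightarrow> nat \<Rightarrow> int" where
  "\<kappa> r i = (\<Sum>l\<in>L. k r l * (of_bool (i = fst l) - of_bool (i = snd l)))"

definition Q :: "complex set" where "Q = {z. z ^ q = 1}"

definition \<zeta> :: complex where "\<zeta> = cis (2 * pi / real q)"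

definition V1 :: "(nat \<Rightarrow> complex) set" where "V1 = PiE {..<d} (\<lambda>_. Q)"

definition U :: "(nat \<Rightarrow> nat \<Rightarrow> complex) set" where "U = PiE {..<Suc m} (\<lambda>_. V1)"

text \<open>The product over the copies of normalised measurement vectors, conjugated because it
  acts on the input as a bra.\<close>

definition f :: "(nat \<Rightarrow> nat \<Rightarrow> complex) \<Rightarrow> (nat \<Rightarrow> nat) \<Rightarrow> complex" where
  "f u w = (\<Prod>p<Suc m. cnj (u p (w p)) / complex_of_real (sqrt (real (q ^ d))))"

text \<open>The probability of the single-copy outcome \<open>v\<close>: the expectation of
  \<open>\<rho>\<close> in the vector with entries \<open>v a\<close>, divided by the number of
  outcomes.\<close>

definition g :: "(nat \<Rightarrow> complex) \<Rightarrow> complex" where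
  "g v = (\<Sum>a<d. \<Sum>b<d. cnj (v a) * \<rho> a b * v b) / of_nat (q ^ d)"

definition mn :: "(nat \<Rightarrow> nat \<Rightarrow> complex) \<Rightarrow> nat \<times> nat \<Rightarrow> complex" where
  "mn u l = (\<Sum>p<Suc m. u p (fst l) * cnj (u p (snd l))) / of_nat (Suc m)"

text \<open>The fallback value in the degenerate case is only there to keep the estimator equivariant
  and of modulus one.\<close>

definition \<theta> :: "(nat \<Rightarrow> nat \<Rightarrow> complex) \<Rightarrow> nat \<times> nat \<Rightarrow> complex" where
  "\<theta> u l = (if mn u l = 0 then u 0 (fst l) * cnj (u 0 (snd l)) else sgn (mn u l)) * cnj (sgn (\<rho> (fst l) (snd l)))"

text \<open>The diagonal unitary to be applied to the prepared state. The true phase of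
  \<open>\<rho>\<close> is divided out in \<open>\<theta>\<close>, so \<open>V u r\<close> is near 1
  when the estimate is good and follows any rotation of the reference.\<close>

definition V :: "(nat \<Rightarrow> nat \<Rightarrow> complex) \<Rightarrow> nat \<Rightarrow> complex" where
  "V u r = (\<Prod>l\<in>L. \<theta> u l powi k r l)"

lemma q_pos: "0 < q" using q3 by simp

lemma Q_norm: "z \<in> Q \<Longrightarrow> cmod z = 1"
proof -
  assume "z \<in> Q"
  then have "cmod z ^ q = 1 ^ q" by (simp add: Q_def flip: norm_power)
  then show "cmod z = 1" by (rule power_eq_imp_eq_base) (use q_pos in auto)
qed

lemma \<zeta>_Q: "\<zeta> \<in> Q"
  using q_pos by (simp add: Q_def \<zeta>_def DeMoivre)

lemma \<zeta>_norm: "cmod \<zeta> = 1" by (simp add: \<zeta>_def)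

lemma \<zeta>_powi: "\<zeta> powi n = 1 \<Longrightarrow> \<bar>n\<bar> < int q \<Longrightarrow> n = 0"
  unfolding \<zeta>_def by (rule cis_root_powi_eq_1)

lemma Q_mult: "z \<in> Q \<Longrightarrow> y \<in> Q \<Longrightarrow> z * y \<in> Q"
  by (simp add: Q_def power_mult_distrib)

lemma Q_cnj: "z \<in> Q \<Longrightarrow> cnj z \<in> Q"
  by (simp add: Q_def flip: complex_cnj_power)

lemma Q_fin: "finite Q" "card Q = q"
  using card_roots_unity_eq[OF q_pos] q_pos unfolding Q_def by (auto intro: card_ge_0_finite)

lemma V1_fin: "finite V1" "card V1 = q ^ d"
  unfolding V1_def by (auto simp: Q_fin card_PiE intro!: finite_PiE)

lemma U_fin: "finite U"
  unfolding U_def by (auto simp: V1_fin intro!: finite_PiE)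

lemma V1_norm: "v \<in> V1 \<Longrightarrow> i < d \<Longrightarrow> cmod (v i) = 1"
  by (intro Q_norm) (auto simp: V1_def)

lemma U_V1: "u \<in> U \<Longrightarrow> p < Suc m \<Longrightarrow> u p \<in> V1"
  using PiE_mem[of u "{..<Suc m}" "\<lambda>_. V1" p] by (simp add: U_def)

lemma \<zeta>_cancel: "cnj \<zeta> * (\<zeta> * y) = y" "\<zeta> * (cnj \<zeta> * y) = y"
  using norm_1_cnj[OF \<zeta>_norm] by (simp_all add: mult.assoc[symmetric] mult.commute[of "cnj \<zeta>" \<zeta>])

lemma V1_upd: "v(i := z * v i) \<in> V1" if "v \<in> V1" "z \<in> Q" "i < d"
proof -
  have v: "v \<in> PiE {..<d} (\<lambda>_. Q)" using that(1) unfolding V1_def .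
  have "v i \<in> Q" using PiE_mem[OF v, of i] that(3) by simp
  then have "z * v i \<in> Q" by (rule Q_mult[OF that(2)])
  then have "v(i := z * v i) \<in> PiE (insert i {..<d}) (\<lambda>_. Q)" by (rule PiE_fun_upd[OF _ v])
  moreover have "insert i {..<d} = {..<d}" using that(3) by auto
  ultimately show ?thesis by (simp only: V1_def)
qed

lemma bij_shift1: 
  assumes "i < d"
  shows "bij_betw (\<lambda>v. v(i := \<zeta> * v i)) V1 V1"
proof (rule bij_betw_byWitness[where f'="\<lambda>v. v(i := cnj \<zeta> * v i)"])
  note z = \<zeta>_cancel
  show "\<forall>v\<in>V1. (v(i := \<zeta> * v i))(i := cnj \<zeta> * (v(i := \<zeta> * v i)) i) = v"
    "\<forall>v\<in>V1. (v(i := cnj \<zeta> * v i))(i := \<zeta> * (v(i := cnj \<zeta> * v i)) i) = v"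
    by (simp_all add: z)
  show "(\<lambda>v. v(i := \<zeta> * v i)) ` V1 \<subseteq> V1" "(\<lambda>v. v(i := cnj \<zeta> * v i)) ` V1 \<subseteq> V1"
    using V1_upd[OF _ \<zeta>_Q assms] V1_upd[OF _ Q_cnj[OF \<zeta>_Q] assms] by blast+
qed

text \<open>Rephasing of level \<open>i\<close> in all copies at once, the symmetry under which the
  estimator is equivariant; \<open>restrict\<close> keeps the result in \<open>U\<close>.\<close>

definition sh :: "nat \<Rightarrow> (nat \<Rightarrow> nat \<Rightarrow> complex) \<Rightarrow> nat \<Rightarrow> nat \<Rightarrow> complex" where
  "sh i u = restrict (\<lambda>p. (u p)(i := \<zeta> * u p i)) {..<Suc m}"

lemma bij_sh:
  assumes "i < d"
  shows "bij_betw (sh i) U U"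
proof (rule bij_betw_byWitness[where f'="\<lambda>u. restrict (\<lambda>p. (u p)(i := cnj \<zeta> * u p i)) {..<Suc m}"])
  note z = \<zeta>_cancel
  have mem: "restrict (\<lambda>p. (u p)(i := y * u p i)) {..<Suc m} \<in> U" if "u \<in> U" "y \<in> Q" for u y
    unfolding U_def restrict_PiE_iff using V1_upd[OF U_V1[OF that(1)] that(2) assms] by simp
  show "\<forall>u\<in>U. restrict (\<lambda>p. (sh i u p)(i := cnj \<zeta> * sh i u p i)) {..<Suc m} = u"
    "\<forall>u\<in>U. sh i (restrict (\<lambda>p. (u p)(i := cnj \<zeta> * u p i)) {..<Suc m}) = u"
    by (auto simp: sh_def z U_def PiE_iff extensional_def fun_eq_iff restrict_def)
  show "sh i ` U \<subseteq> U" "(\<lambda>u. restrict (\<lambda>p. (u p)(i := cnj \<zeta> * u p i)) {..<Suc m}) ` U \<subseteq> U"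
    unfolding sh_def by (rule image_subsetI, erule mem, rule \<zeta>_Q Q_cnj[OF \<zeta>_Q])+
qed

lemma sh_apply: "p < Suc m \<Longrightarrow> sh i u p j = \<zeta> powi (of_bool (i = j)) * u p j"
  by (simp add: sh_def)

section \<open>Moments of the outcome distribution\<close>

lemma moment_2:
  assumes "a < d" "b < d"
  shows "(\<Sum>v\<in>V1. v a * cnj (v b)) = (if a = b then of_nat (q ^ d) else 0)"
proof (cases "a = b")
  case True
  have "(\<Sum>v\<in>V1. v a * cnj (v b)) = (\<Sum>v\<in>V1. 1)"
    by (rule sum.cong) (simp_all add: True norm_1_cnj V1_norm assms(2))
  then show ?thesis using True by (simp add: V1_fin)
next
  case False
  have "\<zeta> \<noteq> 1" using \<zeta>_powi[of 1] q3 by auto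
  have "(\<Sum>v\<in>V1. v a * cnj (v b)) = 0"
    by (rule sum_eq_0_by_shift[OF bij_shift1[OF assms(1)] _ \<open>\<zeta> \<noteq> 1\<close>]) (use False in simp)
  then show ?thesis using False by simp
qed

text \<open>Unless the entries match, some level has a nonzero total exponent of absolute value at
  most 2, and rephasing that level kills the sum. With \<open>q = 2\<close> the term
  \<open>a = j\<close>, \<open>b = i\<close> would survive as a product of squares, hence
  \<open>3 \<le> q\<close>.\<close>

lemma moment_4:
  assumes "i < d" "j < d" "i \<noteq> j" "a < d" "b < d"
  shows "(\<Sum>v\<in>V1. (cnj (v a) * v b) * (v i * cnj (v j))) = (if a = i \<and> b = j then of_nat (q ^ d) else 0)"
proof (cases "a = i \<and> b = j")
  case True
  have "(\<Sum>v\<in>V1. (cnj (v a) * v b) * (v i * cnj (v j))) = (\<Sum>v\<in>V1. 1)"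
  proof (rule sum.cong)
    fix v assume v: "v \<in> V1"
    have "(cnj (v a) * v b) * (v i * cnj (v j)) = (v i * cnj (v i)) * (v j * cnj (v j))"
      using True by (simp add: mult_ac)
    then show "(cnj (v a) * v b) * (v i * cnj (v j)) = 1"
      using norm_1_cnj[OF V1_norm[OF v assms(1)]] norm_1_cnj[OF V1_norm[OF v assms(2)]] by simp
  qed simp
  then show ?thesis using True by (simp add: V1_fin)
next
  case False
  have pw: "\<zeta> powi n \<noteq> 1" if "n \<noteq> 0" "\<bar>n\<bar> \<le> 2" for n using \<zeta>_powi[of n] q3 that by auto
  have cz: "cnj \<zeta> = \<zeta> powi (-1)" 
    using inverse_unique[OF norm_1_cnj[OF \<zeta>_norm]] by (simp add: power_int_minus)
  define N where "N c = of_bool (b = c) - of_bool (a = c) + (of_bool (i = c) - of_bool (j = c) :: int)" for c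
  have z0: "\<zeta> \<noteq> 0" using \<zeta>_norm by auto
  have step: "(cnj ((v(c := \<zeta> * v c)) a) * (v(c := \<zeta> * v c)) b) * ((v(c := \<zeta> * v c)) i * cnj ((v(c := \<zeta> * v c)) j)) =
    \<zeta> powi (N c) * ((cnj (v a) * v b) * (v i * cnj (v j)))" for v c
  proof -
    have s1: "(v(c := \<zeta> * v c)) x = \<zeta> powi (of_bool (x = c)) * v x" for x by simp
    have s2: "cnj ((v(c := \<zeta> * v c)) x) = \<zeta> powi (- of_bool (x = c)) * cnj (v x)" for x
      using cz by (cases "x = c") simp_all
    have "\<zeta> powi (N c) = \<zeta> powi (- of_bool (a = c)) * \<zeta> powi (of_bool (b = c)) * (\<zeta> powi (of_bool (i = c)) * \<zeta> powi (- of_bool (j = c)))"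
      using z0 by (simp add: N_def power_int_add[symmetric] add.commute)
    then show ?thesis unfolding s2 unfolding s1 by (simp only: mult_ac)
  qed
  \<comment> \<open>When \<open>a = i\<close> but \<open>b\<close> differs from \<open>j\<close>,
    level \<open>j\<close> has exponent -1; when \<open>a\<close> differs from \<open>i\<close>,
    level \<open>i\<close> has exponent 1 or 2.\<close>
  have "\<exists>c. c < d \<and> N c \<noteq> 0 \<and> \<bar>N c\<bar> \<le> 2"
  proof (cases "a = i")
    case True
    then have "b \<noteq> j" using False by simp
    then have "N j \<noteq> 0 \<and> \<bar>N j\<bar> \<le> 2" using assms(3) True by (auto simp: N_def)
    then show ?thesis using assms by blast
  next
    case ai: False
    then have "N i \<noteq> 0 \<and> \<bar>N i\<bar> \<le> 2" using assms(3) by (auto simp: N_def)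
    then show ?thesis using assms by blast
  qed
  then obtain c where c: "c < d" "N c \<noteq> 0" "\<bar>N c\<bar> \<le> 2" by blast
  have "(\<Sum>v\<in>V1. (cnj (v a) * v b) * (v i * cnj (v j))) = 0"
    by (rule sum_eq_0_by_shift[where F="\<lambda>v. (cnj (v a) * v b) * (v i * cnj (v j))",
          OF bij_shift1[OF c(1)] _ pw[OF c(2,3)]]) (rule step)
  then show ?thesis using False by auto
qed

lemma sqrt_sq: "complex_of_real (sqrt (real (q ^ d))) * complex_of_real (sqrt (real (q ^ d))) = of_nat (q ^ d)"
proof -
  have "sqrt (real (q ^ d)) * sqrt (real (q ^ d)) = real (q ^ d)"
    by (rule real_sqrt_mult_self[THEN trans]) simp
  then show ?thesis by (simp only: of_real_mult[symmetric] of_real_of_nat_eq)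
qed

lemma f_cnj_f: "f u w * cnj (f u w') = (\<Prod>p<Suc m. cnj (u p (w p)) * u p (w' p) / of_nat (q ^ d))"
proof -
  have "f u w * cnj (f u w') = (\<Prod>p<Suc m. cnj (u p (w p)) / complex_of_real (sqrt (real (q ^ d))) * 
      (u p (w' p) / complex_of_real (sqrt (real (q ^ d)))))"
    unfolding f_def cnj_prod prod.distrib[symmetric] by simp
  also have "\<dots> = (\<Prod>p<Suc m. cnj (u p (w p)) * u p (w' p) / of_nat (q ^ d))"
    by (intro prod.cong refl) (simp only: times_divide_times_eq sqrt_sq)
  finally show ?thesis .
qed

lemma complete:
  assumes "w \<in> words (Suc m) d" "w' \<in> words (Suc m) d"
  shows "(\<Sum>u\<in>U. cnj (f u w) * f u w') = (if w = w' then 1 else 0)"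
proof -
  have "(\<Sum>u\<in>U. cnj (f u w) * f u w') = (\<Sum>u\<in>U. \<Prod>p<Suc m. u p (w p) * cnj (u p (w' p)) / of_nat (q ^ d))"
    by (simp only: mult.commute[of "cnj (f _ w)"] f_cnj_f mult.commute[of "cnj (_ (w' _))"])
  also have "\<dots> = (\<Prod>p<Suc m. \<Sum>v\<in>V1. v (w p) * cnj (v (w' p)) / of_nat (q ^ d))"
    unfolding U_def by (rule prod_sum_PiE[symmetric]) (auto simp: V1_fin)
  also have "\<dots> = (\<Prod>p<Suc m. if w p = w' p then 1 else 0)"
  proof (intro prod.cong refl)
    fix p assume "p \<in> {..<Suc m}"
    then have "w p < d" "w' p < d" using assms words_less by auto
    then show "(\<Sum>v\<in>V1. v (w p) * cnj (v (w' p)) / of_nat (q ^ d)) = (if w p = w' p then 1 else 0)"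
      using moment_2 q_pos by (simp add: sum_divide_distrib[symmetric])
  qed
  also have "\<dots> = (if w = w' then 1 else 0)"
  proof (cases "w = w'")
    case False
    then obtain p where p: "p < Suc m" "w p \<noteq> w' p"
      using assms PiE_ext[of w "{..<Suc m}" "\<lambda>_. {..<d}" w'] unfolding words_def by auto
    have "(\<Prod>p<Suc m. if w p = w' p then 1 else 0 :: complex) = 0"
      by (rule prod_zero) (use p in auto)
    then show ?thesis using False by simp
  qed simp
  finally show ?thesis .
qed

text \<open>The outcome law factorises: the single-copy outcomes are independent with common law
  \<open>g\<close>.\<close>

lemma pr_eq:
  "(\<Sum>w\<in>words (Suc m) d. \<Sum>w'\<in>words (Suc m) d. f u w * (\<Prod>p<Suc m. \<rho> (w p) (w' p)) * cnj (f u w'))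
    = (\<Prod>p<Suc m. g (u p))"
proof -
  have "f u w * (\<Prod>p<Suc m. \<rho> (w p) (w' p)) * cnj (f u w') = 
     (\<Prod>p<Suc m. cnj (u p (w p)) * \<rho> (w p) (w' p) * u p (w' p) / of_nat (q ^ d))" for w w'
  proof -
    have "f u w * (\<Prod>p<Suc m. \<rho> (w p) (w' p)) * cnj (f u w') = f u w * cnj (f u w') * (\<Prod>p<Suc m. \<rho> (w p) (w' p))"
      by (simp only: mult_ac)
    also have "\<dots> = (\<Prod>p<Suc m. cnj (u p (w p)) * \<rho> (w p) (w' p) * u p (w' p) / of_nat (q ^ d))"
      unfolding f_cnj_f prod.distrib[symmetric] by (rule prod.cong) simp_all
    finally show ?thesis .
  qed
  then have "(\<Sum>w\<in>words (Suc m) d. \<Sum>w'\<in>words (Suc m) d. f u w * (\<Prod>p<Suc m. \<rho> (w p) (w' p)) * cnj (f u w'))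
    = (\<Sum>w\<in>words (Suc m) d. \<Sum>w'\<in>words (Suc m) d. (\<Prod>p<Suc m. cnj (u p (w p)) * \<rho> (w p) (w' p) * u p (w' p) / of_nat (q ^ d)))"
    by simp
  also have "\<dots> = (\<Prod>p<Suc m. g (u p))"
    unfolding sum_words2_prod[where F="\<lambda>p a b. cnj (u p a) * \<rho> a b * u p b / of_nat (q ^ d)"]
    by (simp only: g_def sum_divide_distrib)
  finally show ?thesis .
qed

lemma g_nonneg: "0 \<le> g v"
proof -
  have "pos {..<d} \<rho>" by (rule pos_gram[where I="{..<d}" and g=vr]) (simp add: \<rho>_gram)
  then have X: "0 \<le> (\<Sum>a<d. \<Sum>b<d. cnj (v a) * \<rho> a b * v b)" (is "0 \<le> ?X") by (simp add: pos_def)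
  have "0 \<le> complex_of_real (1 / real (q ^ d)) * ?X"
    by (rule mult_nonneg_nonneg[OF complex_of_real_nonneg X]) simp
  then show ?thesis by (simp add: g_def)
qed

lemma g_real: "g v = complex_of_real (Re (g v))" "0 \<le> Re (g v)"
  using g_nonneg[of v] by (auto simp: less_eq_complex_def complex_eq_iff)

lemma sum_g: "(\<Sum>v\<in>V1. g v) = 1"
proof -
  have "(\<Sum>v\<in>V1. g v) = (\<Sum>a<d. \<Sum>b<d. \<rho> a b * (\<Sum>v\<in>V1. v b * cnj (v a))) / of_nat (q ^ d)"
    unfolding g_def sum_divide_distrib[symmetric] by (subst sum_swap3) (simp only: sum_distrib_left mult_ac)
  also have "(\<Sum>a<d. \<Sum>b<d. \<rho> a b * (\<Sum>v\<in>V1. v b * cnj (v a))) = (\<Sum>a<d. \<Sum>b<d. if b = a then \<rho> a a * of_nat (q ^ d) else 0)"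
    by (intro sum.cong refl) (auto simp: moment_2)
  also have "\<dots> = of_nat (q ^ d)" using \<rho>_trace by (simp add: sum_distrib_right[symmetric])
  finally show ?thesis using q_pos by simp
qed

text \<open>The empirical mean is exactly unbiased off the diagonal: of all terms of
  \<open>g\<close> only the one with \<open>a = i\<close> and \<open>b = j\<close> survives
  \<open>moment_4\<close>.\<close>

lemma mean_g:
  assumes "i < d" "j < d" "i \<noteq> j"
  shows "(\<Sum>v\<in>V1. g v * (v i * cnj (v j))) = \<rho> i j"
proof -
  have "(\<Sum>v\<in>V1. g v * (v i * cnj (v j))) = (\<Sum>v\<in>V1. \<Sum>a<d. \<Sum>b<d. \<rho> a b * ((cnj (v a) * v b) * (v i * cnj (v j)))) / of_nat (q ^ d)"
    unfolding sum_divide_distrib[where A=V1]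
    by (intro sum.cong refl) (simp add: g_def sum_distrib_left sum_distrib_right mult_ac)
  also have "\<dots> = (\<Sum>a<d. \<Sum>b<d. \<rho> a b * (\<Sum>v\<in>V1. (cnj (v a) * v b) * (v i * cnj (v j)))) / of_nat (q ^ d)"
    by (subst sum_swap3) (simp only: sum_distrib_left)
  also have "(\<Sum>a<d. \<Sum>b<d. \<rho> a b * (\<Sum>v\<in>V1. (cnj (v a) * v b) * (v i * cnj (v j))))
    = (\<Sum>a<d. \<Sum>b<d. if b = j then (if a = i then \<rho> i j * of_nat (q ^ d) else 0) else 0)"
    by (intro sum.cong refl) (use moment_4[OF assms] in auto)
  also have "\<dots> = \<rho> i j * of_nat (q ^ d)" using assms by simp
  finally show ?thesis using q_pos by simp
qed

lemma expectation_prod: "(\<Sum>u\<in>U. (\<Prod>p<Suc m. g (u p)) * (\<Prod>p<Suc m. h p (u p))) = (\<Prod>p<Suc m. \<Sum>v\<in>V1. g v * h p v)"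
  unfolding U_def prod.distrib[symmetric] by (rule prod_sum_PiE[symmetric]) (auto simp: V1_fin)

definition pR :: "(nat \<Rightarrow> nat \<Rightarrow> complex) \<Rightarrow> real" where
  "pR u = (\<Prod>p<Suc m. Re (g (u p)))"

lemma pR: "complex_of_real (pR u) = (\<Prod>p<Suc m. g (u p))" "0 \<le> pR u"
  unfolding pR_def by (simp only: of_real_prod g_real(1)[symmetric]) (intro prod_nonneg g_real(2) ballI)

lemma sum_pR: "(\<Sum>u\<in>U. pR u) = 1"
proof -
  have "complex_of_real (\<Sum>u\<in>U. pR u) = (\<Sum>u\<in>U. (\<Prod>p<Suc m. g (u p)) * (\<Prod>p<Suc m. 1))"
    by (simp only: of_real_sum pR prod.neutral_const mult_1_right)
  also have "\<dots> = 1" unfolding expectation_prod[where h="\<lambda>p v. 1"] by (simp add: sum_g)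
  finally show ?thesis by (simp only: of_real_eq_1_iff)
qed

text \<open>Independence and centring (\<open>EX\<close>) kill the cross terms, so the second moment
  of the mean is that of one copy divided by \<open>Suc m\<close>; the single-copy value is bounded
  because outcome entries have modulus 1.\<close>

lemma variance:
  assumes l: "(i,j) \<in> L"
  shows "(\<Sum>u\<in>U. pR u * (cmod (mn u (i,j) - \<rho> i j))\<^sup>2) \<le> (1 + cmod (\<rho> i j))\<^sup>2 / real (Suc m)"
proof -
  note ij = L[OF l]
  define X where "X v = v i * cnj (v j) - \<rho> i j" for v :: "nat \<Rightarrow> complex"
  define S where "S = (\<Sum>v\<in>V1. Re (g v) * (cmod (X v))\<^sup>2)"
  have EX: "(\<Sum>v\<in>V1. g v * X v) = 0"
  proof -
    have "(\<Sum>v\<in>V1. g v * X v) = (\<Sum>v\<in>V1. g v * (v i * cnj (v j))) - (\<Sum>v\<in>V1. g v) * \<rho> i j"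
      unfolding X_def sum_distrib_right sum_subtractf[symmetric] right_diff_distrib ..
    then show ?thesis using mean_g[of i j] ij sum_g by simp
  qed
  have pair: "(\<Sum>u\<in>U. (\<Prod>p<Suc m. g (u p)) * (X (u a) * cnj (X (u b)))) = (if b = a then complex_of_real S else 0)"
    if a: "a < Suc m" and b: "b < Suc m" for a b
  proof -
    \<comment> \<open>Spreads the two factors over all copies, with 1 elsewhere, so that
      \<open>expectation_prod\<close> applies.\<close>
    define h where "h p v = (if p = a then X v else 1) * (if p = b then cnj (X v) else 1)" for p v
    have "(\<Prod>p<Suc m. h p (u p)) = X (u a) * cnj (X (u b))" for u
      unfolding h_def prod.distrib using a b by (simp only: prod.delta finite_lessThan lessThan_iff if_True)
    then have "(\<Sum>u\<in>U. (\<Prod>p<Suc m. g (u p)) * (X (u a) * cnj (X (u b)))) = (\<Prod>p<Suc m. \<Sum>v\<in>V1. g v * h p v)"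
      using expectation_prod[of h] by (simp only:)
    also have "\<dots> = (if b = a then complex_of_real S else 0)"
    proof (cases "b = a")
      case True
      have SS: "(\<Sum>v\<in>V1. g v * (X v * cnj (X v))) = complex_of_real S"
        unfolding S_def of_real_sum of_real_mult g_real(1)[symmetric] complex_norm_square ..
      have hh: "h p v = (if p = a then X v * cnj (X v) else 1)" for p v using True by (simp add: h_def)
      have "(\<Prod>p<Suc m. \<Sum>v\<in>V1. g v * h p v) = (\<Prod>p<Suc m. if p = a then complex_of_real S else 1)"
      proof (rule prod.cong[OF refl])
        fix p
        show "(\<Sum>v\<in>V1. g v * h p v) = (if p = a then complex_of_real S else 1)"
          unfolding hh using SS sum_g by (cases "p = a") simp_all
      qed
      also have "\<dots> = complex_of_real S"
        using a by (simp only: prod.delta finite_lessThan lessThan_iff if_True)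
      finally show ?thesis using True by (simp del: prod.lessThan_Suc)
    next
      case False
      have "(\<Prod>p<Suc m. \<Sum>v\<in>V1. g v * h p v) = 0"
      proof (rule prod_zero)
        have "h a v = X v" for v using False by (simp add: h_def)
        then show "\<exists>p\<in>{..<Suc m}. (\<Sum>v\<in>V1. g v * h p v) = 0"
          using a EX by (intro bexI[where x=a]) simp_all
      qed simp
      then show ?thesis using False by (simp only: if_False)
    qed
    finally show ?thesis .
  qed
  have mnX: "mn u (i,j) - \<rho> i j = (\<Sum>p<Suc m. X (u p)) / of_nat (Suc m)" for u
  proof -
    have "(\<Sum>p<Suc m. X (u p)) = (\<Sum>p<Suc m. u p i * cnj (u p j)) - of_nat (Suc m) * \<rho> i j"
      unfolding X_def sum_subtractf by (simp del: sum.lessThan_Suc of_nat_Suc)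
    then show ?thesis by (simp add: mn_def diff_divide_distrib del: sum.lessThan_Suc of_nat_Suc)
  qed
  have sq: "complex_of_real ((cmod (mn u (i,j) - \<rho> i j))\<^sup>2) = (\<Sum>a<Suc m. \<Sum>b<Suc m. X (u a) * cnj (X (u b))) / (of_nat (Suc m) * of_nat (Suc m))" for u
    unfolding complex_norm_square mnX 
    by (simp add: sum_product del: sum.lessThan_Suc of_nat_Suc)
  have "complex_of_real (\<Sum>u\<in>U. pR u * (cmod (mn u (i,j) - \<rho> i j))\<^sup>2)
    = (\<Sum>u\<in>U. \<Sum>a<Suc m. \<Sum>b<Suc m. (\<Prod>p<Suc m. g (u p)) * (X (u a) * cnj (X (u b)))) / (of_nat (Suc m) * of_nat (Suc m))"
    unfolding of_real_sum of_real_mult pR sq sum_divide_distrib[where A=U]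
    by (intro sum.cong refl) (simp only: sum_distrib_left times_divide_eq_right)
  also have "\<dots> = (\<Sum>a<Suc m. \<Sum>b<Suc m. \<Sum>u\<in>U. (\<Prod>p<Suc m. g (u p)) * (X (u a) * cnj (X (u b)))) / (of_nat (Suc m) * of_nat (Suc m))"
    by (simp only: sum_swap3[where A=U])
  also have "(\<Sum>a<Suc m. \<Sum>b<Suc m. \<Sum>u\<in>U. (\<Prod>p<Suc m. g (u p)) * (X (u a) * cnj (X (u b))))
    = (\<Sum>a<Suc m. \<Sum>b<Suc m. if b = a then complex_of_real S else 0)"
    by (intro sum.cong refl pair) auto
  also have "\<dots> = (\<Sum>a<Suc m. complex_of_real S)"
    by (intro sum.cong refl) (simp del: sum.lessThan_Suc)
  also have "\<dots> = of_nat (Suc m) * complex_of_real S"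
    by (simp del: sum.lessThan_Suc of_nat_Suc)
  also have "\<dots> / (of_nat (Suc m) * of_nat (Suc m)) = complex_of_real (S / real (Suc m))"
    by (simp del: of_nat_Suc)
  finally have eq: "(\<Sum>u\<in>U. pR u * (cmod (mn u (i,j) - \<rho> i j))\<^sup>2) = S / real (Suc m)"
    by (simp only: of_real_eq_iff)
  have "S \<le> (\<Sum>v\<in>V1. Re (g v) * (1 + cmod (\<rho> i j))\<^sup>2)"
    unfolding S_def
  proof (intro sum_mono mult_left_mono power_mono g_real(2))
    fix v assume v: "v \<in> V1"
    show "cmod (X v) \<le> 1 + cmod (\<rho> i j)"
      unfolding X_def using norm_triangle_ineq4[of "v i * cnj (v j)" "\<rho> i j"] V1_norm[OF v] ij
      by (simp add: norm_mult)
  qed simp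
  also have "\<dots> = (1 + cmod (\<rho> i j))\<^sup>2"
    using arg_cong[OF sum_g, of Re] by (simp add: sum_distrib_right[symmetric])
  finally show ?thesis unfolding eq by (intro divide_right_mono) auto
qed

end

section \<open>Accuracy and equivariance of the estimated phases\<close>

lemma powi_sum: "z \<noteq> 0 \<Longrightarrow> (\<Prod>x\<in>A. (z :: complex) powi e x) = z powi (\<Sum>x\<in>A. e x)"
  by (induction A rule: infinite_finite_induct) (simp_all add: power_int_add)

lemma cnj_powi:
  assumes "cmod z = 1"
  shows "cnj (z powi e) = z powi (- e)"
proof -
  have "cnj z = inverse z" using inverse_unique[OF norm_1_cnj[OF assms]] by simp
  then show ?thesis by (simp add: power_int_minus power_int_inverse)
qed

text \<open>Collects the factors of the error estimate: the size of \<open>k r l\<close> from taking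
  powers, 2 over the modulus of the coherence from passing to directions, and half of the numerator
  from the first moment. It depends on neither \<open>m\<close> nor \<open>q\<close>, and the sum
  over \<open>r\<close> gives one constant for all levels.\<close>

definition est_const :: "nat \<Rightarrow> (nat \<Rightarrow> nat \<Rightarrow> complex) \<Rightarrow> (nat \<times> nat) set \<Rightarrow> (nat \<Rightarrow> nat \<times> nat \<Rightarrow> int) \<Rightarrow> real" where
  "est_const d' \<rho> L k = (\<Sum>r<d'. \<Sum>l\<in>L. \<bar>real_of_int (k r l)\<bar> * 
     (((1 + cmod (\<rho> (fst l) (snd l)))\<^sup>2 + 1) / cmod (\<rho> (fst l) (snd l))))"

context phase_estimation
begin

lemma first_moment:
  assumes l: "(i,j) \<in> L"
  shows "(\<Sum>u\<in>U. pR u * cmod (mn u (i,j) - \<rho> i j)) \<le> ((1 + cmod (\<rho> i j))\<^sup>2 + 1) / (2 * sqrt (real (Suc m)))"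
proof -
  define s where "s = sqrt (real (Suc m))"
  have s: "0 < s" "s * s = real (Suc m)" by (simp_all add: s_def)
  \<comment> \<open>Replaces the modulus by its square so that the variance suffices; with
    \<open>s\<close> the root of the number of copies both terms are of the same order after
    averaging.\<close>
  have amgm: "t \<le> (s * t\<^sup>2 + 1 / s) / 2" for t
  proof -
    have "(s * t\<^sup>2 + 1 / s) / 2 - t = (s * t - 1)\<^sup>2 / (2 * s)"
      using s(1) by (simp add: field_simps power2_eq_square)
    moreover have "0 \<le> (s * t - 1)\<^sup>2 / (2 * s)" using s(1) by simp
    ultimately show ?thesis by linarith
  qed
  have "(\<Sum>u\<in>U. pR u * cmod (mn u (i,j) - \<rho> i j)) \<le>
    (\<Sum>u\<in>U. pR u * ((s * (cmod (mn u (i,j) - \<rho> i j))\<^sup>2 + 1 / s) / 2))"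
    by (intro sum_mono mult_left_mono amgm pR(2))
  also have "\<dots> = (\<Sum>u\<in>U. (s / 2) * (pR u * (cmod (mn u (i,j) - \<rho> i j))\<^sup>2) + (1 / (2 * s)) * pR u)"
    by (intro sum.cong refl) (simp add: field_simps)
  also have "\<dots> = (s / 2) * (\<Sum>u\<in>U. pR u * (cmod (mn u (i,j) - \<rho> i j))\<^sup>2) + (1 / (2 * s)) * (\<Sum>u\<in>U. pR u)"
    by (simp only: sum.distrib sum_distrib_left)
  also have "\<dots> \<le> (s / 2) * ((1 + cmod (\<rho> i j))\<^sup>2 / real (Suc m)) + (1 / (2 * s)) * 1"
    unfolding sum_pR using s by (intro add_right_mono mult_left_mono variance[OF l]) auto
  also have "\<dots> = ((1 + cmod (\<rho> i j))\<^sup>2 + 1) / (2 * s)"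
    unfolding s(2)[symmetric] using s(1) by (simp add: field_simps)
  finally show ?thesis unfolding s_def .
qed

lemma \<theta>_norm:
  assumes "u \<in> U" "l \<in> L"
  shows "cmod (\<theta> u l) = 1"
proof -
  have l: "fst l < d" "snd l < d" "\<rho> (fst l) (snd l) \<noteq> 0" using L[of "fst l" "snd l"] assms(2) by auto
  have "cmod (u 0 (fst l)) = 1" "cmod (u 0 (snd l)) = 1"
    using V1_norm[OF U_V1[OF assms(1) zero_less_Suc]] l by auto
  then show ?thesis using l(3) by (simp add: \<theta>_def norm_mult norm_sgn)
qed

lemma \<theta>_diff:
  assumes "u \<in> U" "l \<in> L"
  shows "cmod (\<theta> u l - 1) \<le> 2 * cmod (mn u l - \<rho> (fst l) (snd l)) / cmod (\<rho> (fst l) (snd l))"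
proof (cases "mn u l = 0")
  case True
  \<comment> \<open>In the degenerate case the right side equals 2, which bounds the distance
    between any two points of the unit circle.\<close>
  have "cmod (\<theta> u l - 1) \<le> 2" using norm_triangle_ineq4[of "\<theta> u l" 1] \<theta>_norm[OF assms] by simp
  then show ?thesis using True L[of "fst l" "snd l"] assms(2) by simp
next
  case False
  then show ?thesis using sgn_diff_le[of "\<rho> (fst l) (snd l)" "mn u l"] L[of "fst l" "snd l"] assms(2)
    by (simp add: \<theta>_def)
qed

lemma V_norm: "u \<in> U \<Longrightarrow> cmod (V u r) = 1"
  by (simp add: V_def prod_norm[symmetric] norm_power_int \<theta>_norm)

lemma V_diff:
  assumes "u \<in> U"
  shows "cmod (V u r - 1) \<le> (\<Sum>l\<in>L. \<bar>real_of_int (k r l)\<bar> * cmod (\<theta> u l - 1))"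
proof -
  have "cmod ((\<Prod>l\<in>L. \<theta> u l powi k r l) - (\<Prod>l\<in>L. 1)) \<le> (\<Sum>l\<in>L. cmod (\<theta> u l powi k r l - 1))"
    by (rule norm_prod_diff) (simp_all add: norm_power_int \<theta>_norm[OF assms])
  also have "\<dots> \<le> (\<Sum>l\<in>L. \<bar>real_of_int (k r l)\<bar> * cmod (\<theta> u l - 1))"
  proof (rule sum_mono)
    fix l assume "l \<in> L"
    then show "cmod (\<theta> u l powi k r l - 1) \<le> \<bar>real_of_int (k r l)\<bar> * cmod (\<theta> u l - 1)"
      using norm_power_int_diff_1[OF \<theta>_norm[OF assms], of l "k r l"] by simp
  qed
  finally show ?thesis by (simp add: V_def)
qed

lemma V_expectation:
  assumes r: "r < d'"
  shows "(\<Sum>u\<in>U. pR u * cmod (V u r - 1)) \<le> est_const d' \<rho> L k / sqrt (real (Suc m))"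
proof -
  define b where "b l = ((1 + cmod (\<rho> (fst l) (snd l)))\<^sup>2 + 1) / cmod (\<rho> (fst l) (snd l))" for l
  have "(\<Sum>u\<in>U. pR u * cmod (V u r - 1)) \<le> (\<Sum>u\<in>U. pR u * (\<Sum>l\<in>L. \<bar>real_of_int (k r l)\<bar> * 
      (2 * cmod (mn u l - \<rho> (fst l) (snd l)) / cmod (\<rho> (fst l) (snd l)))))"
  proof (intro sum_mono mult_left_mono pR(2))
    fix u assume u: "u \<in> U"
    show "cmod (V u r - 1) \<le> (\<Sum>l\<in>L. \<bar>real_of_int (k r l)\<bar> * 
      (2 * cmod (mn u l - \<rho> (fst l) (snd l)) / cmod (\<rho> (fst l) (snd l))))"
      by (rule order.trans[OF V_diff[OF u]]) (intro sum_mono mult_left_mono \<theta>_diff[OF u] abs_ge_zero)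
  qed
  also have "\<dots> = (\<Sum>l\<in>L. \<Sum>u\<in>U. pR u * (\<bar>real_of_int (k r l)\<bar> * 
      (2 * cmod (mn u l - \<rho> (fst l) (snd l)) / cmod (\<rho> (fst l) (snd l)))))"
    unfolding sum_distrib_left by (rule sum.swap)
  also have "\<dots> = (\<Sum>l\<in>L. \<bar>real_of_int (k r l)\<bar> * (2 / cmod (\<rho> (fst l) (snd l))) *
      (\<Sum>u\<in>U. pR u * cmod (mn u l - \<rho> (fst l) (snd l))))"
    unfolding sum_distrib_left by (intro sum.cong refl) (simp add: mult_ac)
  also have "\<dots> \<le> (\<Sum>l\<in>L. \<bar>real_of_int (k r l)\<bar> * b l / sqrt (real (Suc m)))"
  proof (rule sum_mono)
    fix l assume l: "l \<in> L"
    have "\<bar>real_of_int (k r l)\<bar> * (2 / cmod (\<rho> (fst l) (snd l))) * (\<Sum>u\<in>U. pR u * cmod (mn u l - \<rho> (fst l) (snd l)))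
      \<le> \<bar>real_of_int (k r l)\<bar> * (2 / cmod (\<rho> (fst l) (snd l))) * (((1 + cmod (\<rho> (fst l) (snd l)))\<^sup>2 + 1) / (2 * sqrt (real (Suc m))))"
      using first_moment[of "fst l" "snd l"] l by (intro mult_left_mono) auto
    also have "\<dots> = \<bar>real_of_int (k r l)\<bar> * b l / sqrt (real (Suc m))"
      by (simp add: b_def del: of_nat_Suc)
    finally show "\<bar>real_of_int (k r l)\<bar> * (2 / cmod (\<rho> (fst l) (snd l))) * (\<Sum>u\<in>U. pR u * cmod (mn u l - \<rho> (fst l) (snd l)))
      \<le> \<bar>real_of_int (k r l)\<bar> * b l / sqrt (real (Suc m))" .
  qed
  also have "\<dots> = (\<Sum>l\<in>L. \<bar>real_of_int (k r l)\<bar> * b l) / sqrt (real (Suc m))"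
    by (simp only: sum_divide_distrib)
  also have "\<dots> \<le> est_const d' \<rho> L k / sqrt (real (Suc m))"
  proof (rule divide_right_mono)
    have "(\<Sum>l\<in>L. \<bar>real_of_int (k r l)\<bar> * b l) \<le> (\<Sum>r<d'. \<Sum>l\<in>L. \<bar>real_of_int (k r l)\<bar> * b l)"
      by (rule member_le_sum[where f="\<lambda>r. \<Sum>l\<in>L. \<bar>real_of_int (k r l)\<bar> * b l"]) 
        (use r in \<open>auto intro!: sum_nonneg mult_nonneg_nonneg simp: b_def\<close>)
    then show "(\<Sum>l\<in>L. \<bar>real_of_int (k r l)\<bar> * b l) \<le> est_const d' \<rho> L k" by (simp add: est_const_def b_def)
  qed simp
  finally show ?thesis .
qed

lemma VV_expectation:
  assumes "r < d'" "s < d'"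
  shows "(\<Sum>u\<in>U. pR u * cmod (V u r * cnj (V u s) - 1)) \<le> 2 * est_const d' \<rho> L k / sqrt (real (Suc m))"
proof -
  have "(\<Sum>u\<in>U. pR u * cmod (V u r * cnj (V u s) - 1)) \<le> (\<Sum>u\<in>U. pR u * (cmod (V u r - 1) + cmod (V u s - 1)))"
  proof (intro sum_mono mult_left_mono pR(2))
    fix u assume u: "u \<in> U"
    have "V u r * cnj (V u s) - 1 = (V u r - 1) * cnj (V u s) + cnj (V u s - 1)"
      by (simp add: algebra_simps)
    then have "cmod (V u r * cnj (V u s) - 1) \<le> cmod ((V u r - 1) * cnj (V u s)) + cmod (cnj (V u s - 1))"
      by (simp only: norm_triangle_ineq)
    then show "cmod (V u r * cnj (V u s) - 1) \<le> cmod (V u r - 1) + cmod (V u s - 1)"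
      using V_norm[OF u] by (simp only: norm_mult complex_mod_cnj mult_1_right)
  qed
  also have "\<dots> = (\<Sum>u\<in>U. pR u * cmod (V u r - 1)) + (\<Sum>u\<in>U. pR u * cmod (V u s - 1))"
    by (simp only: distrib_left sum.distrib)
  also have "\<dots> \<le> 2 * est_const d' \<rho> L k / sqrt (real (Suc m))"
    using V_expectation[OF assms(1)] V_expectation[OF assms(2)] by simp
  finally show ?thesis .
qed

lemma \<zeta>_nz: "\<zeta> \<noteq> 0" using \<zeta>_norm by auto

lemma mn_sh: "mn (sh i u) l = \<zeta> powi (of_bool (i = fst l) - of_bool (i = snd l)) * mn u l"
proof -
  have "sh i u p (fst l) * cnj (sh i u p (snd l)) = 
    \<zeta> powi (of_bool (i = fst l) - of_bool (i = snd l)) * (u p (fst l) * cnj (u p (snd l)))" if "p < Suc m" for p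
    unfolding sh_apply[OF that] complex_cnj_mult cnj_powi[OF \<zeta>_norm]
    using \<zeta>_nz by (simp add: power_int_diff power_int_minus divide_inverse)
  then have "(\<Sum>p<Suc m. sh i u p (fst l) * cnj (sh i u p (snd l))) = 
    (\<Sum>p<Suc m. \<zeta> powi (of_bool (i = fst l) - of_bool (i = snd l)) * (u p (fst l) * cnj (u p (snd l))))"
    by (intro sum.cong refl) auto
  then show ?thesis by (simp only: mn_def sum_distrib_left[symmetric] times_divide_eq_right)
qed

text \<open>Both branches of \<open>\<theta>\<close> pick up the same factor: \<open>sgn\<close>
  respects a factor of modulus 1, and vanishing of the mean is preserved, so the case distinction
  itself is invariant.\<close>

lemma \<theta>_sh: "\<theta> (sh i u) l = \<zeta> powi (of_bool (i = fst l) - of_bool (i = snd l)) * \<theta> u l"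
proof -
  define c where "c = \<zeta> powi (of_bool (i = fst l) - of_bool (i = snd l))"
  have c: "cmod c = 1" "c \<noteq> 0" using \<zeta>_nz by (simp_all add: c_def norm_power_int \<zeta>_norm)
  then have sc: "sgn c = c" by (simp add: sgn_div_norm)
  have "sh i u 0 (fst l) * cnj (sh i u 0 (snd l)) = c * (u 0 (fst l) * cnj (u 0 (snd l)))"
    unfolding sh_apply[OF zero_less_Suc] complex_cnj_mult cnj_powi[OF \<zeta>_norm] c_def
    using \<zeta>_nz by (simp add: power_int_diff power_int_minus divide_inverse)
  moreover have "mn (sh i u) l = c * mn u l" unfolding c_def by (rule mn_sh)
  ultimately show ?thesis unfolding \<theta>_def c_def[symmetric] using c(2) sc by (simp add: sgn_mult)
qed

lemma V_sh: "V (sh i u) r = \<zeta> powi (\<kappa> r i) * V u r"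
proof -
  have "V (sh i u) r = (\<Prod>l\<in>L. \<zeta> powi (k r l * (of_bool (i = fst l) - of_bool (i = snd l))) * \<theta> u l powi k r l)"
    unfolding V_def \<theta>_sh by (simp only: power_int_mult_distrib power_int_mult[symmetric] mult.commute)
  then show ?thesis by (simp only: prod.distrib powi_sum[OF \<zeta>_nz] \<kappa>_def V_def)
qed

lemma ff_sh: "f (sh i u) w * cnj (f (sh i u) w') =
  \<zeta> powi (\<Sum>p<Suc m. of_bool (i = w' p) - of_bool (i = w p)) * (f u w * cnj (f u w'))"
proof -
  have "f (sh i u) w * cnj (f (sh i u) w') = (\<Prod>p<Suc m. \<zeta> powi (of_bool (i = w' p) - of_bool (i = w p)) * 
      (cnj (u p (w p)) * u p (w' p) / of_nat (q ^ d)))"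
    unfolding f_cnj_f
  proof (intro prod.cong refl)
    fix p assume "p \<in> {..<Suc m}"
    then have p: "p < Suc m" by simp
    show "cnj (sh i u p (w p)) * sh i u p (w' p) / of_nat (q ^ d) = 
      \<zeta> powi (of_bool (i = w' p) - of_bool (i = w p)) * (cnj (u p (w p)) * u p (w' p) / of_nat (q ^ d))"
      unfolding sh_apply[OF p] complex_cnj_mult cnj_powi[OF \<zeta>_norm]
      using \<zeta>_nz by (simp add: power_int_diff power_int_minus divide_inverse)
  qed
  then show ?thesis unfolding f_cnj_f by (simp only: prod.distrib powi_sum[OF \<zeta>_nz])
qed

text \<open>Summing over the levels undoes the incidence structure of \<open>\<kappa>\<close>; this
  turns balanced level counts back into an energy identity.\<close>

lemma energy_\<kappa>: "(\<Sum>i<d. E i * real_of_int (\<kappa> r i)) = (\<Sum>l\<in>L. real_of_int (k r l) * (E (fst l) - E (snd l)))"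
proof -
  have "(\<Sum>i<d. E i * real_of_int (\<kappa> r i)) = (\<Sum>i<d. \<Sum>l\<in>L. real_of_int (k r l) * (E i * of_bool (i = fst l) - E i * of_bool (i = snd l)))"
    unfolding \<kappa>_def of_int_sum sum_distrib_left
    by (intro sum.cong refl) (simp add: algebra_simps)
  also have "\<dots> = (\<Sum>l\<in>L. real_of_int (k r l) * (\<Sum>i<d. E i * of_bool (i = fst l) - E i * of_bool (i = snd l)))"
    unfolding sum_distrib_left by (rule sum.swap)
  also have "\<dots> = (\<Sum>l\<in>L. real_of_int (k r l) * (E (fst l) - E (snd l)))"
  proof (intro sum.cong refl)
    fix l assume "l \<in> L"
    then have l: "fst l < d" "snd l < d" using L[of "fst l" "snd l"] by auto
    have *: "(\<Sum>i<d. E i * of_bool (i = a)) = E a" if "a < d" for a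
    proof -
      have "(\<Sum>i<d. E i * of_bool (i = a)) = (\<Sum>i<d. if i = a then E a else 0)" by (rule sum.cong) auto
      then show ?thesis using that by simp
    qed
    show "real_of_int (k r l) * (\<Sum>i<d. E i * of_bool (i = fst l) - E i * of_bool (i = snd l)) = real_of_int (k r l) * (E (fst l) - E (snd l))"
      unfolding sum_subtractf *[OF l(1)] *[OF l(2)] ..
  qed
  finally show ?thesis .
qed

text \<open>The averaged rotation. The marginal of the output is the prepared state multiplied by it
  entry by entry, and its unit diagonal keeps the trace.\<close>

definition \<chi> :: "nat \<Rightarrow> nat \<Rightarrow> complex" where
  "\<chi> r s = (\<Sum>u\<in>U. complex_of_real (pR u) * (V u r * cnj (V u s)))"

lemma \<chi>_diag: "\<chi> r r = 1"
proof -
  have "\<chi> r r = (\<Sum>u\<in>U. complex_of_real (pR u))"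
    unfolding \<chi>_def by (rule sum.cong) (simp_all add: norm_1_cnj V_norm)
  then show ?thesis using sum_pR by (simp flip: of_real_sum)
qed

lemma \<chi>_herm: "\<chi> r s = cnj (\<chi> s r)"
  by (simp add: \<chi>_def mult_ac)

lemma \<chi>_diff:
  assumes "r < d'" "s < d'"
  shows "cmod (\<chi> r s - 1) \<le> 2 * est_const d' \<rho> L k / sqrt (real (Suc m))"
proof -
  have "\<chi> r s - 1 = (\<Sum>u\<in>U. complex_of_real (pR u) * (V u r * cnj (V u s))) - (\<Sum>u\<in>U. complex_of_real (pR u))"
    using sum_pR by (simp add: \<chi>_def flip: of_real_sum)
  also have "\<dots> = (\<Sum>u\<in>U. complex_of_real (pR u) * (V u r * cnj (V u s) - 1))"
    by (simp add: sum_subtractf algebra_simps)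
  finally have "cmod (\<chi> r s - 1) \<le> (\<Sum>u\<in>U. cmod (complex_of_real (pR u) * (V u r * cnj (V u s) - 1)))"
    by (simp only: norm_sum)
  also have "\<dots> = (\<Sum>u\<in>U. pR u * cmod (V u r * cnj (V u s) - 1))"
    using pR(2) by (simp add: norm_mult)
  finally show ?thesis using VV_expectation[OF assms] by linarith
qed

text \<open>Rephasing level \<open>i\<close> multiplies the summand by
  \<open>\<zeta> powi N i\<close>, so a nonzero sum forces this factor to be 1. As
  \<open>q_large\<close> keeps \<open>N i\<close> below \<open>q\<close> in absolute value,
  \<open>N i\<close> is 0 for every level, and the combination of these identities with weights
  \<open>E i\<close> is the energy balance.\<close>

lemma conserve:
  assumes supp: "\<And>r s. r < d' \<Longrightarrow> s < d' \<Longrightarrow> R0 r s \<noteq> 0 \<Longrightarrow>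
      E' r - E' s = (\<Sum>l\<in>L. real_of_int (k r l - k s l) * (E (fst l) - E (snd l)))"
    and q_large: "int (Suc m) * (1 + 2 * (\<Sum>r<d'. \<Sum>i<d. \<bar>\<kappa> r i\<bar>)) < int q"
    and w: "w \<in> words (Suc m) d" "w' \<in> words (Suc m) d" and v: "v \<in> words (Suc m) d'" "v' \<in> words (Suc m) d'"
    and nz: "(\<Sum>u\<in>U. f u w * cnj (f u w') * (\<Prod>p<Suc m. V u (v p) * R0 (v p) (v' p) * cnj (V u (v' p)))) \<noteq> 0"
  shows "(\<Sum>p<Suc m. E (w p)) - (\<Sum>p<Suc m. E (w' p)) = (\<Sum>p<Suc m. E' (v p)) - (\<Sum>p<Suc m. E' (v' p))"
proof -
  define F where "F u = f u w * cnj (f u w') * (\<Prod>p<Suc m. V u (v p) * R0 (v p) (v' p) * cnj (V u (v' p)))" for u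
  \<comment> \<open>Net weight of level \<open>i\<close>: occupations in \<open>w'\<close> minus
    those in \<open>w\<close>, plus the weights of the output letters of \<open>v\<close> minus
    those of \<open>v'\<close>.\<close>
  define N where "N i = (\<Sum>p<Suc m. of_bool (i = w' p) - of_bool (i = w p)) + (\<Sum>p<Suc m. \<kappa> (v p) i - \<kappa> (v' p) i)" for i
  have step: "F (sh i u) = \<zeta> powi (N i) * F u" for i u
  proof -
    have "(\<Prod>p<Suc m. V (sh i u) (v p) * R0 (v p) (v' p) * cnj (V (sh i u) (v' p))) =
      (\<Prod>p<Suc m. \<zeta> powi (\<kappa> (v p) i - \<kappa> (v' p) i) * (V u (v p) * R0 (v p) (v' p) * cnj (V u (v' p))))"
    proof (rule prod.cong[OF refl])
      fix p
      have "\<zeta> powi (\<kappa> (v p) i - \<kappa> (v' p) i) = \<zeta> powi (\<kappa> (v p) i) * \<zeta> powi (- \<kappa> (v' p) i)"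
        using \<zeta>_nz by (simp add: power_int_diff power_int_minus divide_inverse)
      then show "V (sh i u) (v p) * R0 (v p) (v' p) * cnj (V (sh i u) (v' p)) = 
        \<zeta> powi (\<kappa> (v p) i - \<kappa> (v' p) i) * (V u (v p) * R0 (v p) (v' p) * cnj (V u (v' p)))"
        unfolding V_sh complex_cnj_mult cnj_powi[OF \<zeta>_norm] by (simp only: mult_ac)
    qed
    also have "\<dots> = \<zeta> powi (\<Sum>p<Suc m. \<kappa> (v p) i - \<kappa> (v' p) i) * (\<Prod>p<Suc m. V u (v p) * R0 (v p) (v' p) * cnj (V u (v' p)))"
      by (simp only: prod.distrib powi_sum[OF \<zeta>_nz])
    finally have prods: "(\<Prod>p<Suc m. V (sh i u) (v p) * R0 (v p) (v' p) * cnj (V (sh i u) (v' p))) = \<dots>" .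
    have "\<zeta> powi N i = \<zeta> powi (\<Sum>p<Suc m. of_bool (i = w' p) - of_bool (i = w p)) * \<zeta> powi (\<Sum>p<Suc m. \<kappa> (v p) i - \<kappa> (v' p) i)"
      unfolding N_def by (rule power_int_add) (simp add: \<zeta>_nz)
    then show ?thesis unfolding F_def ff_sh prods by (simp only: mult_ac)
  qed
  have N0: "N i = 0" if i: "i < d" for i
  proof -
    have "\<zeta> powi (N i) = 1"
      using sum_eq_0_by_shift[where F=F and c="\<zeta> powi (N i)", OF bij_sh[OF i] step] nz unfolding F_def by blast
    moreover have "\<bar>N i\<bar> < int q"
    proof -
      \<comment> \<open>Each copy contributes at most 1 through the occupations and at most
        \<open>2 * ?K\<close> through the weights, which is the origin of
        \<open>q_large\<close>.\<close>
      let ?K = "\<Sum>r<d'. \<Sum>i<d. \<bar>\<kappa> r i\<bar>"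
      have \<kappa>K: "\<bar>\<kappa> r i\<bar> \<le> ?K" if "r < d'" for r
      proof -
        have "\<bar>\<kappa> r i\<bar> \<le> (\<Sum>i<d. \<bar>\<kappa> r i\<bar>)"
          by (rule member_le_sum[where f="\<lambda>i. \<bar>\<kappa> r i\<bar>"]) (use i in auto)
        also have "\<dots> \<le> ?K"
          by (rule member_le_sum[where f="\<lambda>r. \<Sum>i<d. \<bar>\<kappa> r i\<bar>"]) (use that in \<open>auto intro: sum_nonneg\<close>)
        finally show ?thesis .
      qed
      have "\<bar>N i\<bar> \<le> \<bar>\<Sum>p<Suc m. of_bool (i = w' p) - of_bool (i = w p)\<bar> + \<bar>\<Sum>p<Suc m. \<kappa> (v p) i - \<kappa> (v' p) i\<bar>"
        unfolding N_def by (rule abs_triangle_ineq)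
      also have "\<dots> \<le> (\<Sum>p<Suc m. \<bar>of_bool (i = w' p) - of_bool (i = w p)\<bar>) + (\<Sum>p<Suc m. \<bar>\<kappa> (v p) i - \<kappa> (v' p) i\<bar>)"
        by (intro add_mono sum_abs)
      also have "\<dots> \<le> (\<Sum>p<Suc m. 1) + (\<Sum>p<Suc m. 2 * ?K)"
      proof (intro add_mono sum_mono)
        fix p assume "p \<in> {..<Suc m}"
        then have "v p < d'" "v' p < d'" using v words_less by auto
        then show "\<bar>\<kappa> (v p) i - \<kappa> (v' p) i\<bar> \<le> 2 * ?K"
          using \<kappa>K[of "v p"] \<kappa>K[of "v' p"] by linarith
      qed simp
      also have "\<dots> = int (Suc m) * (1 + 2 * ?K)"
        by (simp add: distrib_left del: sum.lessThan_Suc of_nat_Suc)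
      finally show ?thesis using q_large by linarith
    qed
    ultimately show ?thesis by (rule \<zeta>_powi)
  qed
  have supp': "E' (v p) - E' (v' p) = (\<Sum>i<d. E i * real_of_int (\<kappa> (v p) i - \<kappa> (v' p) i))" if p: "p < Suc m" for p
  proof -
    \<comment> \<open>A nonzero sum leaves no position with a vanishing entry of \<open>R0\<close>,
      so the support condition applies at each \<open>p\<close>.\<close>
    have "R0 (v p) (v' p) \<noteq> 0"
    proof
      assume "R0 (v p) (v' p) = 0"
      then have "(\<Prod>p<Suc m. V u (v p) * R0 (v p) (v' p) * cnj (V u (v' p))) = 0" for u
        using p by (intro prod_zero) auto
      then show False using nz by (simp only: mult_zero_right sum.neutral_const)
    qed
    then have "E' (v p) - E' (v' p) = (\<Sum>l\<in>L. real_of_int (k (v p) l - k (v' p) l) * (E (fst l) - E (snd l)))"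
      using supp words_less[OF v(1) p] words_less[OF v(2) p] by blast
    also have "\<dots> = (\<Sum>i<d. E i * real_of_int (\<kappa> (v p) i)) - (\<Sum>i<d. E i * real_of_int (\<kappa> (v' p) i))"
      unfolding energy_\<kappa> by (simp add: left_diff_distrib sum_subtractf)
    finally show ?thesis by (simp add: right_diff_distrib sum_subtractf)
  qed
  have Ew: "E (x p) = (\<Sum>i<d. E i * of_bool (i = x p))" if "x \<in> words (Suc m) d" "p < Suc m" for x p
  proof -
    have "(\<Sum>i<d. E i * of_bool (i = x p)) = (\<Sum>i<d. if i = x p then E (x p) else 0)" by (rule sum.cong) auto
    then show ?thesis using words_less[OF that] by simp
  qed
  have "0 = (\<Sum>i<d. E i * real_of_int (N i))" using N0 by simp
  also have "\<dots> = (\<Sum>i<d. \<Sum>p<Suc m. E i * of_bool (i = w' p) - E i * of_bool (i = w p) + E i * real_of_int (\<kappa> (v p) i - \<kappa> (v' p) i))"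
    unfolding N_def sum.distrib[symmetric] of_int_sum sum_distrib_left
    by (intro sum.cong refl) (simp add: algebra_simps)
  also have "\<dots> = (\<Sum>p<Suc m. \<Sum>i<d. E i * of_bool (i = w' p) - E i * of_bool (i = w p) + E i * real_of_int (\<kappa> (v p) i - \<kappa> (v' p) i))"
    by (rule sum.swap)
  also have "\<dots> = (\<Sum>p<Suc m. E (w' p) - E (w p) + (E' (v p) - E' (v' p)))"
  proof (rule sum.cong[OF refl])
    fix p assume "p \<in> {..<Suc m}"
    then have p: "p < Suc m" by simp
    show "(\<Sum>i<d. E i * of_bool (i = w' p) - E i * of_bool (i = w p) + E i * real_of_int (\<kappa> (v p) i - \<kappa> (v' p) i))
      = E (w' p) - E (w p) + (E' (v p) - E' (v' p))"
      unfolding supp'[OF p] Ew[OF w(1) p] Ew[OF w(2) p] sum.distrib sum_subtractf ..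
  qed
  also have "\<dots> = (\<Sum>p<Suc m. E (w' p)) - (\<Sum>p<Suc m. E (w p)) + ((\<Sum>p<Suc m. E' (v p)) - (\<Sum>p<Suc m. E' (v' p)))"
    by (simp only: sum.distrib sum_subtractf)
  finally show ?thesis by linarith
qed

text \<open>The prepared state \<open>R0\<close> may differ from the target \<open>\<sigma>\<close>,
  which leaves room to compensate the averaged rotation; \<open>bound\<close> charges the estimation
  error and the offset between \<open>R0\<close> and \<open>\<sigma>\<close> separately.\<close>

theorem phase_catalysis:
  assumes gram: "\<And>r s. r < d' \<Longrightarrow> s < d' \<Longrightarrow> R0 r s = (\<Sum>b<d'. v0 r b * cnj (v0 s b))"
    and trace: "(\<Sum>r<d'. R0 r r) = 1"
    and supp: "\<And>r s. r < d' \<Longrightarrow> s < d' \<Longrightarrow> R0 r s \<noteq> 0 \<Longrightarrow>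
      E' r - E' s = (\<Sum>l\<in>L. real_of_int (k r l - k s l) * (E (fst l) - E (snd l)))"
    and q_large: "int (Suc m) * (1 + 2 * (\<Sum>r<d'. \<Sum>i<d. \<bar>\<kappa> r i\<bar>)) < int q"
    and herm: "hermitian d' \<sigma>"
    and bound: "real d' * (\<Sum>r<d'. \<Sum>s<d'. cmod (R0 r s) * (2 * est_const d' \<rho> L k / sqrt (real (Suc m))) + cmod (R0 r s - \<sigma> $$ (r,s))) < \<epsilon>"
  shows "correlated_catalysis d (diagm d (\<lambda>i. complex_of_real (E i))) (mat d d (\<lambda>(i,j). \<rho> i j))
    d' (diagm d' (\<lambda>i. complex_of_real (E' i))) \<sigma> (mat d' d' (\<lambda>(r,s). \<chi> r s * R0 r s)) \<epsilon>"
proof -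
  \<comment> \<open>The prepared states are conjugates of \<open>R0\<close> by the diagonal unitary
    \<open>V u\<close>, so Gram form and trace are inherited.\<close>
  interpret mp: measure_prepare d d' m E E' \<rho> vr U f "\<lambda>u r b. V u r * v0 r b" "\<lambda>u r s. V u r * R0 r s * cnj (V u s)"
  proof
    show "finite U" by (rule U_fin)
    show "\<rho> i j = (\<Sum>b<d. vr i b * cnj (vr j b))" if "i < d" "j < d" for i j by (rule \<rho>_gram[OF that])
    show "(\<Sum>i<d. \<rho> i i) = 1" by (rule \<rho>_trace)
    show "(\<Sum>u\<in>U. cnj (f u w) * f u w') = (if w = w' then 1 else 0)"
      if "w \<in> words (Suc m) d" "w' \<in> words (Suc m) d" for w w' by (rule complete[OF that])
    show "V u r * R0 r s * cnj (V u s) = (\<Sum>b<d'. V u r * v0 r b * cnj (V u s * v0 s b))"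
      if "u \<in> U" "r < d'" "s < d'" for u r s
      unfolding gram[OF that(2,3)] sum_distrib_left sum_distrib_right complex_cnj_mult by (simp only: mult_ac)
    show "(\<Sum>r<d'. V u r * R0 r r * cnj (V u r)) = 1" if "u \<in> U" for u
    proof -
      have "V u r * R0 r r * cnj (V u r) = R0 r r" for r
      proof -
        have "V u r * R0 r r * cnj (V u r) = R0 r r * (V u r * cnj (V u r))" by (simp only: mult_ac)
        then show ?thesis unfolding norm_1_cnj[OF V_norm[OF that]] by simp
      qed
      then show ?thesis using trace by (simp only:)
    qed
    show "(\<Sum>p<Suc m. E (w p)) - (\<Sum>p<Suc m. E (w' p)) = (\<Sum>p<Suc m. E' (v p)) - (\<Sum>p<Suc m. E' (v' p))"
      if "w \<in> words (Suc m) d" "w' \<in> words (Suc m) d" "v \<in> words (Suc m) d'" "v' \<in> words (Suc m) d'"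
        "(\<Sum>u\<in>U. f u w * cnj (f u w') * (\<Prod>p<Suc m. V u (v p) * R0 (v p) (v' p) * cnj (V u (v' p)))) \<noteq> 0" for w w' v v'
      by (rule conserve[OF supp q_large that])
  qed
  have pr: "mp.pr u = complex_of_real (pR u)" for u
    unfolding mp.pr_def pr_eq pR ..
  have "(\<Sum>u\<in>U. Re (mp.pr u) * (\<Sum>r<d'. \<Sum>s<d'. cmod (V u r * R0 r s * cnj (V u s) - \<sigma> $$ (r,s))))
    \<le> (\<Sum>u\<in>U. pR u * (\<Sum>r<d'. \<Sum>s<d'. cmod (R0 r s) * cmod (V u r * cnj (V u s) - 1) + cmod (R0 r s - \<sigma> $$ (r,s))))"
    unfolding pr Re_complex_of_real
  proof (intro sum_mono mult_left_mono pR(2))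
    fix u r s
    have "V u r * R0 r s * cnj (V u s) - \<sigma> $$ (r,s) = R0 r s * (V u r * cnj (V u s) - 1) + (R0 r s - \<sigma> $$ (r,s))"
      by (simp add: algebra_simps)
    then show "cmod (V u r * R0 r s * cnj (V u s) - \<sigma> $$ (r,s)) \<le> cmod (R0 r s) * cmod (V u r * cnj (V u s) - 1) + cmod (R0 r s - \<sigma> $$ (r,s))"
      using norm_triangle_ineq[of "R0 r s * (V u r * cnj (V u s) - 1)" "R0 r s - \<sigma> $$ (r,s)"] by (simp only: norm_mult)
  qed
  also have "\<dots> = (\<Sum>r<d'. \<Sum>s<d'. \<Sum>u\<in>U. pR u * (cmod (R0 r s) * cmod (V u r * cnj (V u s) - 1) + cmod (R0 r s - \<sigma> $$ (r,s))))"
    unfolding sum_distrib_left by (rule sum_swap3)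
  also have "\<dots> = (\<Sum>r<d'. \<Sum>s<d'. cmod (R0 r s) * (\<Sum>u\<in>U. pR u * cmod (V u r * cnj (V u s) - 1)) + cmod (R0 r s - \<sigma> $$ (r,s)))"
  proof (intro sum.cong refl)
    fix r s
    have "(\<Sum>u\<in>U. pR u * (cmod (R0 r s) * cmod (V u r * cnj (V u s) - 1) + cmod (R0 r s - \<sigma> $$ (r,s))))
      = (\<Sum>u\<in>U. cmod (R0 r s) * (pR u * cmod (V u r * cnj (V u s) - 1))) + (\<Sum>u\<in>U. pR u) * cmod (R0 r s - \<sigma> $$ (r,s))"
      unfolding sum_distrib_right sum.distrib[symmetric] by (intro sum.cong refl) (simp add: algebra_simps)
    then show "(\<Sum>u\<in>U. pR u * (cmod (R0 r s) * cmod (V u r * cnj (V u s) - 1) + cmod (R0 r s - \<sigma> $$ (r,s))))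
      = cmod (R0 r s) * (\<Sum>u\<in>U. pR u * cmod (V u r * cnj (V u s) - 1)) + cmod (R0 r s - \<sigma> $$ (r,s))"
      by (simp only: sum_distrib_left sum_pR mult_1)
  qed
  also have "\<dots> \<le> (\<Sum>r<d'. \<Sum>s<d'. cmod (R0 r s) * (2 * est_const d' \<rho> L k / sqrt (real (Suc m))) + cmod (R0 r s - \<sigma> $$ (r,s)))"
    by (intro sum_mono add_right_mono mult_left_mono VV_expectation norm_ge_zero) auto
  finally have "real d' * (\<Sum>u\<in>U. Re (mp.pr u) * (\<Sum>r<d'. \<Sum>s<d'. cmod (V u r * R0 r s * cnj (V u s) - \<sigma> $$ (r,s)))) < \<epsilon>"
    using bound by (meson le_less_trans mult_left_mono of_nat_0_le_iff)
  from mp.correlated_catalysis_diagm[OF herm this]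
  have "correlated_catalysis d (diagm d (\<lambda>i. complex_of_real (E i))) (mat d d (\<lambda>(i,j). \<rho> i j)) d'
   (diagm d' (\<lambda>i. complex_of_real (E' i))) \<sigma> (mat d' d' (\<lambda>(r,s). \<Sum>u\<in>U. mp.pr u * (V u r * R0 r s * cnj (V u s)))) \<epsilon>" .
  moreover have "(\<Sum>u\<in>U. mp.pr u * (V u r * R0 r s * cnj (V u s))) = \<chi> r s * R0 r s" for r s
    unfolding \<chi>_def pr sum_distrib_right by (simp only: mult_ac)
  ultimately show ?thesis by (simp only:)
qed

end

section \<open>Existence of the catalytic transformation\<close>

text \<open>A multiple of the identity dominates both signs of \<open>A\<close>; the factor
  \<open>n\<close> is the trace of the identity.\<close>

lemma trace_norm_le_entries:
  assumes "hermitian n A"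
  shows "trace_norm A \<le> real n * (\<Sum>i<n. \<Sum>j<n. cmod (A $$ (i,j)))"
proof -
  define \<eta> where "\<eta> = (\<Sum>i<n. \<Sum>j<n. cmod (A $$ (i,j)))"
  have A: "A $$ (i,j) = cnj (A $$ (j,i))" if "i < n" "j < n" for i j using hermitianD[OF assms that] .
  have p: "pos {..<n} (\<lambda>i j. diagm n (\<lambda>_. complex_of_real \<eta>) $$ (i,j) + B i j)"
    if "\<And>i j. i < n \<Longrightarrow> j < n \<Longrightarrow> B i j = cnj (B j i)" "(\<Sum>i<n. \<Sum>j<n. cmod (B i j)) \<le> \<eta>" for B
  proof -
    have "pos {..<n} (\<lambda>i j. (if i = j then complex_of_real \<eta> else 0) + B i j)"
      by (rule pos_diag_dominant[OF finite_lessThan _ that(2)]) (rule that(1), auto)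
    then show ?thesis by (subst pos_cong[where L="\<lambda>i j. (if i = j then complex_of_real \<eta> else 0) + B i j"]) auto
  qed
  have "trace_norm A \<le> Re (mtrace (diagm n (\<lambda>_. complex_of_real \<eta>)))"
  proof (rule trace_norm_le[OF assms diagm_carrier])
    show "pos {..<n} (\<lambda>i j. diagm n (\<lambda>_. complex_of_real \<eta>) $$ (i,j) + A $$ (i,j))"
      by (rule p) (rule A, auto simp: \<eta>_def)
    show "pos {..<n} (\<lambda>i j. diagm n (\<lambda>_. complex_of_real \<eta>) $$ (i,j) + - (A $$ (i,j)))"
    proof (rule p)
      show "- (A $$ (i,j)) = cnj (- (A $$ (j,i)))" if "i < n" "j < n" for i j
        unfolding complex_cnj_minus A[OF that, symmetric] ..
    qed (simp add: \<eta>_def)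
  qed
  then show ?thesis by (simp add: mtrace_diagm \<eta>_def)
qed

text \<open>The determinant is the product of the eigenvalues up to the factors from
  \<open>U\<close>, so full rank excludes 0 among them.\<close>

lemma full_rank_eigenvalues_pos:
  assumes "psd n A" "full_rank n A" and U: "unitary n U" and A: "A = U * diagm n (\<lambda>i. complex_of_real (d i)) * adj U"
    and i: "i < n"
  shows "0 < d i"
proof -
  note Uc = unitaryD(1)[OF U]
  have Ac: "A \<in> carrier_mat n n" using assms(1) by (simp add: psd_iff_pos)
  have "det A \<noteq> 0" using vec_space.det_rank_iff[OF Ac] assms(2) by (simp add: full_rank_def)
  moreover have "det A = det U * det (diagm n (\<lambda>i. complex_of_real (d i))) * det (adj U)"
    unfolding A det_mult[OF mult_carrier_mat[OF Uc diagm_carrier] adj_carrier[OF Uc]] det_mult[OF Uc diagm_carrier] ..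
  ultimately have "det (diagm n (\<lambda>i. complex_of_real (d i))) \<noteq> 0" by auto
  moreover have "det (diagm n (\<lambda>i. complex_of_real (d i))) = prod_list (diag_mat (diagm n (\<lambda>i. complex_of_real (d i))))"
    by (rule det_upper_triangular[OF _ diagm_carrier]) (auto simp: upper_triangular_def)
  moreover have "complex_of_real (d i) \<in> set (diag_mat (diagm n (\<lambda>i. complex_of_real (d i))))"
    using i by (auto simp: diag_mat_def intro!: image_eqI[where x=i])
  ultimately have "d i \<noteq> 0" by (auto simp: prod_list_zero_iff)
  moreover have "0 \<le> d i" using psd_eigenvalue_nonneg[OF _ U i] assms(1) A by simp
  ultimately show ?thesis by simp
qed

text \<open>Quantifies full rank by a gap \<open>l\<close>, the margin within which a Hermitian
  perturbation keeps positivity. The unitary \<open>V\<close> appears because the gap is needed in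
  the eigenbasis of the Hamiltonian, not in that of \<open>A\<close>.\<close>

lemma full_rank_lower_bound:
  assumes psd: "psd n A" and fr: "full_rank n A" and V: "unitary n V"
  obtains l where "0 < l" "pos {..<n} (\<lambda>i j. (adj V * A * V) $$ (i,j) - (if i = j then complex_of_real l else 0))"
proof -
  obtain U d where U: "unitary n U" and A: "A = U * diagm n (\<lambda>i. complex_of_real (d i)) * adj U"
    using psd_spectral[OF psd] by metis
  \<comment> \<open>Inserting 1 keeps \<open>Min\<close> meaningful and positive for
    \<open>n = 0\<close>.\<close>
  define l where "l = Min (insert 1 (d ` {..<n}))"
  have l: "0 < l" using full_rank_eigenvalues_pos[OF psd fr U A] by (auto simp: l_def)
  have le: "l \<le> d i" if "i < n" for i using that by (simp add: l_def)
  define T where "T = adj V * U"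
  have T: "unitary n T" unfolding T_def by (rule unitary_mult[OF unitary_adj[OF V] U])
  note Tc = unitaryD(1)[OF T]
  have AT: "adj V * A * V = T * diagm n (\<lambda>i. complex_of_real (d i)) * adj T"
    using conj_conj[OF diagm_carrier unitaryD(1)[OF U] adj_carrier[OF unitaryD(1)[OF V]]] by (simp add: A T_def)
  have "psd n (T * diagm n (\<lambda>i. complex_of_real (d i - l)) * adj T)"
    by (rule psd_conj[OF psd_diagm Tc]) (use le in simp)
  then have "pos {..<n} (\<lambda>i j. (T * diagm n (\<lambda>i. complex_of_real (d i - l)) * adj T) $$ (i,j))"
    by (simp only: psd_iff_pos)
  then have "pos {..<n} (\<lambda>i j. (adj V * A * V) $$ (i,j) - (if i = j then complex_of_real l else 0))"
  proof (rule pos_cong[THEN iffD1, rotated])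
    fix i j assume "i \<in> {..<n}" "j \<in> {..<n}"
    then have i: "i < n" and j: "j < n" by auto
    have "(\<Sum>a<n. T $$ (i,a) * complex_of_real (d a - l) * cnj (T $$ (j,a)))
      = (\<Sum>a<n. T $$ (i,a) * complex_of_real (d a) * cnj (T $$ (j,a))) - complex_of_real l * (\<Sum>a<n. T $$ (i,a) * cnj (T $$ (j,a)))"
      unfolding sum_distrib_left sum_subtractf[symmetric] by (intro sum.cong refl) (simp add: algebra_simps)
    then show "(T * diagm n (\<lambda>i. complex_of_real (d i - l)) * adj T) $$ (i,j) =
      (adj V * A * V) $$ (i,j) - (if i = j then complex_of_real l else 0)"
      unfolding AT diagm_conj_index[OF Tc Tc i j] unitary_orthonormal_rows[OF T i j] by simp
  qed
  with l show ?thesis by (rule that)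
qed

text \<open>Membership in the group generated by the energy differences along \<open>L\<close>.
  Coefficients are indexed by the coherences rather than by the distinct real differences, since
  each coherence has its own estimated phase.\<close>

definition int_span :: "(nat \<Rightarrow> real) \<Rightarrow> (nat \<times> nat) set \<Rightarrow> real \<Rightarrow> bool" where
  "int_span E L x \<longleftrightarrow> (\<exists>k :: nat \<times> nat \<Rightarrow> int. x = (\<Sum>l\<in>L. real_of_int (k l) * (E (fst l) - E (snd l))))"

lemma int_span_0: "int_span E L 0"
  unfolding int_span_def by (intro exI[of _ "\<lambda>_. 0"]) simp

lemma int_span_diff: "int_span E L x \<Longrightarrow> int_span E L y \<Longrightarrow> int_span E L (x - y)"
  unfolding int_span_def
proof (elim exE)
  fix k k' :: "nat \<times> nat \<Rightarrow> int"
  assume "x = (\<Sum>l\<in>L. real_of_int (k l) * (E (fst l) - E (snd l)))" "y = (\<Sum>l\<in>L. real_of_int (k' l) * (E (fst l) - E (snd l)))"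
  then have "x - y = (\<Sum>l\<in>L. real_of_int (k l - k' l) * (E (fst l) - E (snd l)))"
    by (simp add: left_diff_distrib sum_subtractf)
  then show "\<exists>k :: nat \<times> nat \<Rightarrow> int. x - y = (\<Sum>l\<in>L. real_of_int (k l) * (E (fst l) - E (snd l)))"
    by (rule exI[where x="\<lambda>l. k l - k' l"])
qed

lemma int_span_add: "int_span E L x \<Longrightarrow> int_span E L y \<Longrightarrow> int_span E L (x + y)"
  using int_span_diff[of E L x "0 - y"] int_span_diff[OF int_span_0, of E L y] by simp

lemma int_span_scale: "int_span E L x \<Longrightarrow> int_span E L (real_of_int c * x)"
  unfolding int_span_def
proof (elim exE)
  fix k :: "nat \<times> nat \<Rightarrow> int"
  assume "x = (\<Sum>l\<in>L. real_of_int (k l) * (E (fst l) - E (snd l)))"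
  then have "real_of_int c * x = (\<Sum>l\<in>L. real_of_int (c * k l) * (E (fst l) - E (snd l)))"
    by (simp add: sum_distrib_left mult.assoc)
  then show "\<exists>k :: nat \<times> nat \<Rightarrow> int. real_of_int c * x = (\<Sum>l\<in>L. real_of_int (k l) * (E (fst l) - E (snd l)))"
    by (rule exI[where x="\<lambda>l. c * k l"])
qed

lemma int_span_generator:
  assumes "finite L" "l \<in> L"
  shows "int_span E L (E (fst l) - E (snd l))"
proof -
  have "(\<Sum>x\<in>L. real_of_int (of_bool (x = l)) * (E (fst x) - E (snd x))) = (\<Sum>x\<in>L. if x = l then E (fst l) - E (snd l) else 0)"
    by (rule sum.cong) auto
  also have "\<dots> = E (fst l) - E (snd l)" using assms by simp
  finally show ?thesis unfolding int_span_def by metis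
qed

lemma int_span_sum: "finite F \<Longrightarrow> (\<And>x. x \<in> F \<Longrightarrow> int_span E L (h x)) \<Longrightarrow> int_span E L (\<Sum>x\<in>F. h x)"
  by (induction F rule: finite_induct) (auto intro: int_span_0 int_span_add)

text \<open>Fixing a representative energy in every coset of the group makes the integer coordinates
  of energy differences into differences of potentials.\<close>

lemma int_span_potential:
  obtains k :: "nat \<Rightarrow> nat \<times> nat \<Rightarrow> int" where
    "\<And>r s. int_span E L (E' r - E' s) \<Longrightarrow> E' r - E' s = (\<Sum>l\<in>L. real_of_int (k r l - k s l) * (E (fst l) - E (snd l)))"
proof -
  define rep where "rep r = (LEAST t. int_span E L (E' r - E' t))" for r
  have "int_span E L (E' r - E' (rep r))" for r
    unfolding rep_def by (rule LeastI[of _ r]) (simp add: int_span_0)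
  then obtain k where k: "\<And>r. E' r - E' (rep r) = (\<Sum>l\<in>L. real_of_int (k r l) * (E (fst l) - E (snd l)))"
    unfolding int_span_def by metis
  have "E' r - E' s = (\<Sum>l\<in>L. real_of_int (k r l - k s l) * (E (fst l) - E (snd l)))"
    if rs: "int_span E L (E' r - E' s)" for r s
  proof -
    \<comment> \<open>Two indices in one coset admit the same \<open>t\<close>, so
      \<open>LEAST\<close> selects the same representative for both.\<close>
    have "int_span E L (E' r - E' t) \<longleftrightarrow> int_span E L (E' s - E' t)" for t
      using int_span_diff[of E L "E' r - E' t" "E' r - E' s"] int_span_add[of E L "E' s - E' t" "E' r - E' s"] rs by auto
    then have "rep r = rep s" by (simp add: rep_def)
    then have "E' r - E' s = (E' r - E' (rep r)) - (E' s - E' (rep s))" by simp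
    then show ?thesis unfolding k by (simp add: left_diff_distrib sum_subtractf)
  qed
  then show ?thesis by (rule that)
qed

text \<open>The order of quantifiers matters: \<open>C\<close> is chosen before the number of
  copies, and \<open>\<chi>\<close> before the prepared state \<open>R\<close>. The exact case
  divides the target by \<open>\<chi> m\<close> to obtain \<open>R\<close>, which would be circular
  if \<open>\<chi>\<close> depended on \<open>R\<close>.\<close>

theorem asymptotic_phase_catalysis:
  fixes E E' :: "nat \<Rightarrow> real" and L :: "(nat \<times> nat) set"
  assumes \<rho>: "state d \<rho>" and Lfin: "finite L"
    and L: "\<And>i j. (i,j) \<in> L \<Longrightarrow> i < d \<and> j < d \<and> i \<noteq> j \<and> \<rho> $$ (i,j) \<noteq> 0"
  obtains \<chi> :: "nat \<Rightarrow> nat \<Rightarrow> nat \<Rightarrow> complex" and C :: real where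
    "0 \<le> C" "\<And>m r. \<chi> m r r = 1" "\<And>m r s. \<chi> m r s = cnj (\<chi> m s r)"
    "\<And>m r s. r < d' \<Longrightarrow> s < d' \<Longrightarrow> cmod (\<chi> m r s - 1) \<le> C / sqrt (real (Suc m))"
    "\<And>m R \<sigma> \<epsilon>. state d' R \<Longrightarrow> hermitian d' \<sigma> \<Longrightarrow>
      (\<And>r s. r < d' \<Longrightarrow> s < d' \<Longrightarrow> R $$ (r,s) \<noteq> 0 \<Longrightarrow> int_span E L (E' r - E' s)) \<Longrightarrow>
      real d' * (\<Sum>r<d'. \<Sum>s<d'. cmod (R $$ (r,s)) * (C / sqrt (real (Suc m))) + cmod (R $$ (r,s) - \<sigma> $$ (r,s))) < \<epsilon> \<Longrightarrow>
      correlated_catalysis d (diagm d (\<lambda>i. complex_of_real (E i))) \<rho>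
        d' (diagm d' (\<lambda>i. complex_of_real (E' i))) \<sigma> (mat d' d' (\<lambda>(r,s). \<chi> m r s * R $$ (r,s))) \<epsilon>"
proof -
  have \<rho>c: "\<rho> \<in> carrier_mat d d" and \<rho>p: "psd d \<rho>" and \<rho>t: "mtrace \<rho> = 1"
    using \<rho> by (auto simp: state_def psd_iff_pos)
  define \<rho>f where "\<rho>f i j = \<rho> $$ (i,j)" for i j
  have \<rho>m: "mat d d (\<lambda>(i,j). \<rho>f i j) = \<rho>" using \<rho>c by (intro eq_matI) (auto simp: \<rho>f_def)
  obtain vr where vr: "\<And>i j. i < d \<Longrightarrow> j < d \<Longrightarrow> \<rho>f i j = (\<Sum>b<d. vr i b * cnj (vr j b))"
    using psd_gram[OF \<rho>p] unfolding \<rho>f_def by metis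
  obtain k :: "nat \<Rightarrow> nat \<times> nat \<Rightarrow> int" where k: "\<And>r s. int_span E L (E' r - E' s) \<Longrightarrow>
      E' r - E' s = (\<Sum>l\<in>L. real_of_int (k r l - k s l) * (E (fst l) - E (snd l)))"
    using int_span_potential[of E L E'] by blast
  define K where "K = (\<Sum>r<d'. \<Sum>i<d. \<bar>phase_estimation.\<kappa> L k r i\<bar>)"
  \<comment> \<open>Chosen after \<open>m\<close>: it has to exceed the largest imbalance that
    \<open>Suc m\<close> copies can produce, and the added 3 secures
    \<open>3 \<le> q\<close>.\<close>
  define q where "q m = nat (int (Suc m) * (1 + 2 * K)) + 3" for m
  have K: "0 \<le> K" by (simp add: K_def sum_nonneg)
  have pe: "phase_estimation d \<rho>f vr L (q m)" for m
  proof
    show "\<rho>f i j = (\<Sum>b<d. vr i b * cnj (vr j b))" if "i < d" "j < d" for i j using vr[OF that] .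
    show "(\<Sum>i<d. \<rho>f i i) = 1" using \<rho>t \<rho>c by (simp add: mtrace_def \<rho>f_def)
    show "i < d \<and> j < d \<and> i \<noteq> j \<and> \<rho>f i j \<noteq> 0" if "(i,j) \<in> L" for i j using L[OF that] by (simp add: \<rho>f_def)
  qed (simp_all add: Lfin q_def)
  define \<chi> where "\<chi> m = phase_estimation.\<chi> d \<rho>f L k m (q m)" for m
  define C where "C = 2 * est_const d' \<rho>f L k"
  show ?thesis
  proof (rule that[of C \<chi>])
    show "0 \<le> C" unfolding C_def est_const_def
      by (intro mult_nonneg_nonneg sum_nonneg divide_nonneg_nonneg add_nonneg_nonneg) simp_all
    show "\<chi> m r r = 1" for m r unfolding \<chi>_def by (rule phase_estimation.\<chi>_diag[OF pe])
    show "\<chi> m r s = cnj (\<chi> m s r)" for m r s unfolding \<chi>_def by (rule phase_estimation.\<chi>_herm[OF pe])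
    show "cmod (\<chi> m r s - 1) \<le> C / sqrt (real (Suc m))" if "r < d'" "s < d'" for m r s
      unfolding \<chi>_def C_def by (rule phase_estimation.\<chi>_diff[OF pe that])
    fix m R \<sigma> \<epsilon>
    assume R: "state d' R" and \<sigma>: "hermitian d' \<sigma>"
      and supp: "\<And>r s. r < d' \<Longrightarrow> s < d' \<Longrightarrow> R $$ (r,s) \<noteq> 0 \<Longrightarrow> int_span E L (E' r - E' s)"
      and bound: "real d' * (\<Sum>r<d'. \<Sum>s<d'. cmod (R $$ (r,s)) * (C / sqrt (real (Suc m))) + cmod (R $$ (r,s) - \<sigma> $$ (r,s))) < \<epsilon>"
    have Rc: "R \<in> carrier_mat d' d'" and Rp: "psd d' R" and Rt: "mtrace R = 1"
      using R by (auto simp: state_def psd_iff_pos)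
    obtain v0 where v0: "\<And>r s. r < d' \<Longrightarrow> s < d' \<Longrightarrow> R $$ (r,s) = (\<Sum>b<d'. v0 r b * cnj (v0 s b))"
      using psd_gram[OF Rp] by metis
    have "int (Suc m) * (1 + 2 * K) < int (q m)" using K by (simp add: q_def)
    then have q_large: "int (Suc m) * (1 + 2 * (\<Sum>r<d'. \<Sum>i<d. \<bar>phase_estimation.\<kappa> L k r i\<bar>)) < int (q m)"
      by (simp only: K_def)
    have trace: "(\<Sum>r<d'. R $$ (r,r)) = 1" using Rt Rc by (simp add: mtrace_def)
    show "correlated_catalysis d (diagm d (\<lambda>i. complex_of_real (E i))) \<rho>
        d' (diagm d' (\<lambda>i. complex_of_real (E' i))) \<sigma> (mat d' d' (\<lambda>(r,s). \<chi> m r s * R $$ (r,s))) \<epsilon>"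
      unfolding \<rho>m[symmetric] \<chi>_def
      by (rule phase_estimation.phase_catalysis[OF pe, where ?R0.0="\<lambda>r s. R $$ (r,s)" and ?v0.0=v0,
            OF v0 trace k[OF supp] q_large \<sigma> bound[unfolded C_def]])
  qed
qed

lemma exists_small_inverse_sqrt:
  assumes "0 < \<eta>"
  shows "\<exists>m. A / sqrt (real (Suc m)) < \<eta>"
proof -
  obtain m where m: "(\<bar>A\<bar> / \<eta>)\<^sup>2 < real m" using reals_Archimedean2 by blast
  then have "(\<bar>A\<bar> / \<eta>)\<^sup>2 < real (Suc m)" by simp
  then have "\<bar>A\<bar> / \<eta> < sqrt (real (Suc m))" by (rule real_less_rsqrt)
  then have "\<bar>A\<bar> < \<eta> * sqrt (real (Suc m))" using assms by (simp add: pos_divide_less_eq mult.commute)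
  then have "A < \<eta> * sqrt (real (Suc m))" by linarith
  then show ?thesis by (intro exI[of _ m]) (simp add: pos_divide_less_eq del: of_nat_Suc)
qed

lemma correlated_catalysis_approx:
  assumes "correlated_catalysis dS HS \<rho> dS' HS' \<rho>' \<sigma> \<epsilon>" "trace_norm (\<sigma> - \<rho>') < \<delta>"
  shows "\<exists>dC HC c \<Lambda>. hermitian dC HC \<and> state dC c \<and>
            channel (dS*dC) (dS'*dC) \<Lambda> \<and>
            covariant (dS*dC) (ham_sum dS HS dC HC) (dS'*dC) (ham_sum dS' HS' dC HC) \<Lambda> \<and>
            (let \<tau> = \<Lambda> (kron \<rho> c) in
               trace_norm (ptrace_B dS' dC \<tau> - \<rho>') < \<delta> \<and>
               ptrace_A dS' dC \<tau> = c \<and>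
               trace_norm (\<tau> - kron \<rho>' c) < \<epsilon>)"
  using assms unfolding correlated_catalysis_def Let_def by (elim exE conjE) (intro exI conjI, simp_all)

theorem theorem2:
  fixes dS dS' :: nat and HS HS' \<rho> \<rho>' :: "complex mat"
  assumes "hermitian dS HS" and "hermitian dS' HS'"
    and "state dS \<rho>" and "state dS' \<rho>'"
    and "coh_group dS' HS' \<rho>' \<subseteq> coh_group dS HS \<rho>"
  shows "(\<forall>\<delta>>0. \<forall>\<epsilon>>0. \<exists>dC HC c \<Lambda>. hermitian dC HC \<and> state dC c \<and>
            channel (dS*dC) (dS'*dC) \<Lambda> \<and>
            covariant (dS*dC) (ham_sum dS HS dC HC) (dS'*dC) (ham_sum dS' HS' dC HC) \<Lambda> \<and>
            (let \<tau> = \<Lambda> (kron \<rho> c) in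
               trace_norm (ptrace_B dS' dC \<tau> - \<rho>') < \<delta> \<and>
               ptrace_A dS' dC \<tau> = c \<and>
               trace_norm (\<tau> - kron \<rho>' c) < \<epsilon>))
       \<and> (full_rank dS' \<rho>' \<longrightarrow>
          (\<forall>\<epsilon>>0. \<exists>dC HC c \<Lambda>. hermitian dC HC \<and> state dC c \<and>
            channel (dS*dC) (dS'*dC) \<Lambda> \<and>
            covariant (dS*dC) (ham_sum dS HS dC HC) (dS'*dC) (ham_sum dS' HS' dC HC) \<Lambda> \<and>
            (let \<tau> = \<Lambda> (kron \<rho> c) in
               ptrace_B dS' dC \<tau> = \<rho>' \<and>
               ptrace_A dS' dC \<tau> = c \<and>
               trace_norm (\<tau> - kron \<rho>' c) < \<epsilon>)))"
proof -
  obtain U E where U: "unitary dS U" and HS: "HS = U * diagm dS (\<lambda>i. complex_of_real (E i)) * adj U"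
    using spectral_theorem[OF assms(1)] by metis
  obtain U' E' where U': "unitary dS' U'" and HS': "HS' = U' * diagm dS' (\<lambda>i. complex_of_real (E' i)) * adj U'"
    using spectral_theorem[OF assms(2)] by metis
  note Uc = unitaryD(1)[OF U] and Uc' = unitaryD(1)[OF U']
  have \<rho>p: "psd dS \<rho>" "psd dS' \<rho>'" using assms(3,4) by (auto simp: state_def)
  then have \<rho>c: "\<rho> \<in> carrier_mat dS dS" "\<rho>' \<in> carrier_mat dS' dS'" by (auto simp: psd_iff_pos)
  define \<rho>0 where "\<rho>0 = adj U * \<rho> * U"
  define \<rho>1 where "\<rho>1 = adj U' * \<rho>' * U'"
  have \<rho>0: "state dS \<rho>0" unfolding \<rho>0_def by (rule state_conj[OF assms(3) U])
  have \<rho>1: "state dS' \<rho>1" unfolding \<rho>1_def by (rule state_conj[OF assms(4) U'])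
  then have \<rho>1p: "psd dS' \<rho>1" and \<rho>1t: "mtrace \<rho>1 = 1" by (auto simp: state_def)
  note \<rho>1h = psd_hermitian[OF \<rho>1p]
  have \<rho>1c: "\<rho>1 \<in> carrier_mat dS' dS'" using \<rho>1p by (simp add: psd_iff_pos)
  have \<rho>'1: "\<rho>' = U' * \<rho>1 * adj U'" unfolding \<rho>1_def by (rule unitary_cancel(1)[OF U' \<rho>c(2), symmetric])
  \<comment> \<open>All nonzero off-diagonal entries in the eigenbasis, including those between
    levels of equal energy.\<close>
  define L where "L = {(i,j). i < dS \<and> j < dS \<and> i \<noteq> j \<and> \<rho>0 $$ (i,j) \<noteq> 0}"
  have Lfin: "finite L" by (rule finite_subset[of _ "{..<dS} \<times> {..<dS}"]) (auto simp: L_def)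
  have L: "i < dS \<and> j < dS \<and> i \<noteq> j \<and> \<rho>0 $$ (i,j) \<noteq> 0" if "(i,j) \<in> L" for i j using that by (simp add: L_def)
  \<comment> \<open>Diagonal entries give the difference 0, so the off-diagonal ones generate the
    whole group.\<close>
  have coh: "int_span E L x" if x: "x \<in> coh_group dS HS \<rho>" for x
  proof -
    obtain F k where F: "finite F" "F \<subseteq> modes dS HS \<rho>" "x = (\<Sum>y\<in>F. of_int (k y) * y)"
      using x unfolding coh_group_def by blast
    have "int_span E L y" if y: "y \<in> modes dS HS \<rho>" for y
    proof -
      obtain i j where ij: "y = E i - E j" "i < dS" "j < dS" "\<rho>0 $$ (i,j) \<noteq> 0"
        using y unfolding modes_eq[OF U HS \<rho>c(1)] \<rho>0_def by blast
      show ?thesis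
      proof (cases "i = j")
        case False
        then have "(i,j) \<in> L" using ij by (simp add: L_def)
        then show ?thesis using int_span_generator[OF Lfin, of "(i,j)" E] ij by simp
      qed (simp add: ij int_span_0)
    qed
    then show ?thesis unfolding F(3) using F(1,2) by (intro int_span_sum int_span_scale) auto
  qed
  have supp: "int_span E L (E' r - E' s)" if "r < dS'" "s < dS'" "\<rho>1 $$ (r,s) \<noteq> 0" for r s
  proof -
    have "E' r - E' s \<in> modes dS' HS' \<rho>'"
      unfolding modes_eq[OF U' HS' \<rho>c(2)] using that unfolding \<rho>1_def by blast
    then have "E' r - E' s \<in> coh_group dS' HS' \<rho>'"
      unfolding coh_group_def by (intro CollectI exI[of _ "{E' r - E' s}"] exI[of _ "\<lambda>_. 1"]) simp
    then show ?thesis using assms(5) by (intro coh) blast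
  qed
  obtain \<chi> C where C: "0 \<le> C" and \<chi>_diag: "\<And>m r. \<chi> m r r = 1" and \<chi>_herm: "\<And>m r s. \<chi> m r s = cnj (\<chi> m s r)"
    and \<chi>_diff: "\<And>m r s. r < dS' \<Longrightarrow> s < dS' \<Longrightarrow> cmod (\<chi> m r s - 1) \<le> C / sqrt (real (Suc m))"
    and cat: "\<And>m R \<sigma> \<epsilon>. state dS' R \<Longrightarrow> hermitian dS' \<sigma> \<Longrightarrow>
      (\<And>r s. r < dS' \<Longrightarrow> s < dS' \<Longrightarrow> R $$ (r,s) \<noteq> 0 \<Longrightarrow> int_span E L (E' r - E' s)) \<Longrightarrow>
      real dS' * (\<Sum>r<dS'. \<Sum>s<dS'. cmod (R $$ (r,s)) * (C / sqrt (real (Suc m))) + cmod (R $$ (r,s) - \<sigma> $$ (r,s))) < \<epsilon> \<Longrightarrow>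
      correlated_catalysis dS (diagm dS (\<lambda>i. complex_of_real (E i))) \<rho>0
        dS' (diagm dS' (\<lambda>i. complex_of_real (E' i))) \<sigma> (mat dS' dS' (\<lambda>(r,s). \<chi> m r s * R $$ (r,s))) \<epsilon>"
    by (rule asymptotic_phase_catalysis[OF \<rho>0 Lfin L, where d'=dS' and E=E and E'=E']) blast+
  \<comment> \<open>Transport to the original bases. The prepared \<open>R\<close> may be any state
    supported where \<open>\<rho>1\<close> is, which keeps its energy differences in the
    span.\<close>
  have cat': "correlated_catalysis dS HS \<rho> dS' HS' \<rho>' (U' * mat dS' dS' (\<lambda>(r,s). \<chi> m r s * R $$ (r,s)) * adj U') \<epsilon>"
    if R: "state dS' R" "\<And>r s. r < dS' \<Longrightarrow> s < dS' \<Longrightarrow> R $$ (r,s) \<noteq> 0 \<Longrightarrow> \<rho>1 $$ (r,s) \<noteq> 0"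
      and bound: "real dS' * (\<Sum>r<dS'. \<Sum>s<dS'. cmod (R $$ (r,s)) * (C / sqrt (real (Suc m))) + cmod (R $$ (r,s) - \<rho>1 $$ (r,s))) < \<epsilon>"
    for m R \<epsilon>
    unfolding HS HS'
  proof (rule correlated_catalysis_conj[OF U U' hermitian_diagm hermitian_diagm \<rho>p])
    let ?M = "mat dS' dS' (\<lambda>(r,s). \<chi> m r s * R $$ (r,s))"
    have M: "?M \<in> carrier_mat dS' dS'" by simp
    show "U' * ?M * adj U' \<in> carrier_mat dS' dS'"
      by (rule mult_carrier_mat[OF mult_carrier_mat[OF Uc' M] adj_carrier[OF Uc']])
    show "correlated_catalysis dS (diagm dS (\<lambda>i. complex_of_real (E i))) (adj U * \<rho> * U) dS'
     (diagm dS' (\<lambda>i. complex_of_real (E' i))) (adj U' * \<rho>' * U') (adj U' * (U' * ?M * adj U') * U') \<epsilon>"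
      unfolding unitary_cancel(2)[OF U' M] \<rho>0_def[symmetric] \<rho>1_def[symmetric]
      by (rule cat[OF R(1) \<rho>1h supp bound]) (use R(2) in auto)
  qed
  define S where "S = (\<Sum>r<dS'. \<Sum>s<dS'. cmod (\<rho>1 $$ (r,s)))"
  have S: "0 \<le> S" by (simp add: S_def sum_nonneg)
  show ?thesis
  proof (intro conjI impI allI)
    fix \<delta> \<epsilon> :: real assume "0 < \<delta>" "0 < \<epsilon>"
    then obtain m where m: "(real dS' * S * C) / sqrt (real (Suc m)) < min \<delta> \<epsilon>"
      using exists_small_inverse_sqrt[of "min \<delta> \<epsilon>"] by auto
    let ?M = "mat dS' dS' (\<lambda>(r,s). \<chi> m r s * \<rho>1 $$ (r,s))"
    have Mh: "hermitian dS' ?M"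
      unfolding hermitian_def
    proof
      show "adj ?M = ?M"
      proof (rule eq_matI)
        fix i j assume "i < dim_row ?M" "j < dim_col ?M"
        then have ij: "i < dS'" "j < dS'" by auto
        have "cnj (\<chi> m j i * \<rho>1 $$ (j,i)) = \<chi> m i j * \<rho>1 $$ (i,j)"
          unfolding complex_cnj_mult \<chi>_herm[of m i j, symmetric] hermitianD[OF \<rho>1h ij, symmetric] ..
        then show "adj ?M $$ (i,j) = ?M $$ (i,j)" using ij by simp
      qed auto
    qed simp
    have Mc: "?M \<in> carrier_mat dS' dS'" by simp
    \<comment> \<open>Here the target itself is prepared, so the offset vanishes and only the
      estimation error remains.\<close>
    have "correlated_catalysis dS HS \<rho> dS' HS' \<rho>' (U' * ?M * adj U') \<epsilon>"
    proof (rule cat'[OF \<rho>1])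
      have "real dS' * (\<Sum>r<dS'. \<Sum>s<dS'. cmod (\<rho>1 $$ (r,s)) * (C / sqrt (real (Suc m))) + cmod (\<rho>1 $$ (r,s) - \<rho>1 $$ (r,s)))
        = (real dS' * S * C) / sqrt (real (Suc m))"
        by (simp add: S_def sum_distrib_right[symmetric] sum_divide_distrib[symmetric] del: of_nat_Suc)
      then show "real dS' * (\<Sum>r<dS'. \<Sum>s<dS'. cmod (\<rho>1 $$ (r,s)) * (C / sqrt (real (Suc m))) + cmod (\<rho>1 $$ (r,s) - \<rho>1 $$ (r,s))) < \<epsilon>"
        using m by linarith
    qed
    moreover have "trace_norm (U' * ?M * adj U' - \<rho>') < \<delta>"
    proof -
      have "U' * ?M * adj U' - \<rho>' = U' * (?M - \<rho>1) * adj U'"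
        unfolding \<rho>'1 mult_minus_distrib_mat[OF Uc' Mc \<rho>1c]
        by (rule minus_mult_distrib_mat[OF mult_carrier_mat[OF Uc' Mc] mult_carrier_mat[OF Uc' \<rho>1c] adj_carrier[OF Uc'], symmetric])
      then have "trace_norm (U' * ?M * adj U' - \<rho>') = trace_norm (?M - \<rho>1)"
        using trace_norm_conj[OF U' hermitian_minus[OF Mh \<rho>1h]] by simp
      also have "\<dots> \<le> real dS' * (\<Sum>r<dS'. \<Sum>s<dS'. cmod ((?M - \<rho>1) $$ (r,s)))"
        by (rule trace_norm_le_entries[OF hermitian_minus[OF Mh \<rho>1h]])
      also have "\<dots> \<le> real dS' * (\<Sum>r<dS'. \<Sum>s<dS'. cmod (\<rho>1 $$ (r,s)) * (C / sqrt (real (Suc m))))"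
      proof (intro mult_left_mono sum_mono)
        fix r s assume "r \<in> {..<dS'}" "s \<in> {..<dS'}"
        then have rs: "r < dS'" "s < dS'" by auto
        have "(?M - \<rho>1) $$ (r,s) = \<rho>1 $$ (r,s) * (\<chi> m r s - 1)"
          using rs \<rho>1c by (simp add: algebra_simps)
        then have "cmod ((?M - \<rho>1) $$ (r,s)) = cmod (\<rho>1 $$ (r,s)) * cmod (\<chi> m r s - 1)"
          by (simp only: norm_mult)
        also have "\<dots> \<le> cmod (\<rho>1 $$ (r,s)) * (C / sqrt (real (Suc m)))"
          by (intro mult_left_mono \<chi>_diff[OF rs] norm_ge_zero)
        finally show "cmod ((?M - \<rho>1) $$ (r,s)) \<le> cmod (\<rho>1 $$ (r,s)) * (C / sqrt (real (Suc m)))" .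
      qed simp
      also have "\<dots> = (real dS' * S * C) / sqrt (real (Suc m))"
        by (simp add: S_def sum_distrib_right[symmetric] sum_divide_distrib[symmetric] del: of_nat_Suc)
      finally show ?thesis using m by linarith
    qed
    ultimately show "\<exists>dC HC c \<Lambda>. hermitian dC HC \<and> state dC c \<and>
            channel (dS*dC) (dS'*dC) \<Lambda> \<and>
            covariant (dS*dC) (ham_sum dS HS dC HC) (dS'*dC) (ham_sum dS' HS' dC HC) \<Lambda> \<and>
            (let \<tau> = \<Lambda> (kron \<rho> c) in
               trace_norm (ptrace_B dS' dC \<tau> - \<rho>') < \<delta> \<and>
               ptrace_A dS' dC \<tau> = c \<and>
               trace_norm (\<tau> - kron \<rho>' c) < \<epsilon>)"
      by (rule correlated_catalysis_approx)
  next
    fix \<epsilon> :: real assume fr: "full_rank dS' \<rho>'" and "0 < \<epsilon>"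
    obtain l where l: "0 < l" and lower: "pos {..<dS'} (\<lambda>i j. \<rho>1 $$ (i,j) - (if i = j then complex_of_real l else 0))"
      using full_rank_lower_bound[OF \<rho>p(2) fr U'] unfolding \<rho>1_def by blast
    \<comment> \<open>Three demands are met by one choice of \<open>m\<close>: the correlation
      bound, positivity of the corrected state against the gap \<open>l\<close>, and
      \<open>t \<le> 1 / 2\<close>, which keeps \<open>\<chi>\<close> away from 0.\<close>
    define A where "A = real dS' * (4 * S * C) + 2 * S * C + 2 * C"
    obtain m where m: "A / sqrt (real (Suc m)) < min \<epsilon> (min l 1)"
      using exists_small_inverse_sqrt[of "min \<epsilon> (min l 1)" A] \<open>0 < \<epsilon>\<close> l by auto
    define t where "t = C / sqrt (real (Suc m))"
    have t: "0 \<le> t" using C by (simp add: t_def)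
    have At: "A / sqrt (real (Suc m)) = real dS' * (4 * S * t) + 2 * S * t + 2 * t"
      by (simp add: A_def t_def add_divide_distrib)
    have nn: "0 \<le> real dS' * (4 * S * t)" "0 \<le> 2 * S * t" using S t by simp_all
    have small: "real dS' * (4 * S * t) < \<epsilon>" "2 * S * t \<le> l" "t \<le> 1 / 2"
      using m nn t unfolding At by linarith+
    define \<Delta> where "\<Delta> r s = \<rho>1 $$ (r,s) / \<chi> m r s - \<rho>1 $$ (r,s)" for r s
    have \<chi>nz: "1 / 2 \<le> cmod (\<chi> m r s)" if "r < dS'" "s < dS'" for r s
    proof -
      have "cmod (\<chi> m r s - 1) \<le> t" unfolding t_def by (rule \<chi>_diff[OF that])
      moreover have "1 - cmod (\<chi> m r s) \<le> cmod (\<chi> m r s - 1)"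
        using norm_triangle_ineq2[of 1 "\<chi> m r s"] by (simp add: norm_minus_commute)
      ultimately show ?thesis using small(3) by linarith
    qed
    have \<Delta>: "cmod (\<Delta> r s) \<le> cmod (\<rho>1 $$ (r,s)) * (2 * t)" if "r < dS'" "s < dS'" for r s
    proof -
      have nz: "\<chi> m r s \<noteq> 0" using \<chi>nz[OF that] by auto
      have "\<Delta> r s = \<rho>1 $$ (r,s) * ((1 - \<chi> m r s) / \<chi> m r s)"
        using nz by (simp add: \<Delta>_def field_simps)
      then have "cmod (\<Delta> r s) = cmod (\<rho>1 $$ (r,s)) * (cmod (\<chi> m r s - 1) / cmod (\<chi> m r s))"
        by (simp only: norm_mult norm_divide norm_minus_commute)
      also have "\<dots> \<le> cmod (\<rho>1 $$ (r,s)) * (t / (1 / 2))"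
        using \<chi>_diff[OF that, of m, folded t_def] \<chi>nz[OF that] t
        by (intro mult_left_mono frac_le norm_ge_zero) simp_all
      finally show ?thesis by simp
    qed
    define R where "R = mat dS' dS' (\<lambda>(r,s). \<rho>1 $$ (r,s) / \<chi> m r s)"
    have R_index: "R $$ (r,s) = \<rho>1 $$ (r,s) + \<Delta> r s" if "r < dS'" "s < dS'" for r s
      using that by (simp add: R_def \<Delta>_def)
    have sum_\<Delta>: "(\<Sum>r<dS'. \<Sum>s<dS'. cmod (\<Delta> r s)) \<le> 2 * S * t"
    proof -
      have "(\<Sum>r<dS'. \<Sum>s<dS'. cmod (\<Delta> r s)) \<le> (\<Sum>r<dS'. \<Sum>s<dS'. cmod (\<rho>1 $$ (r,s)) * (2 * t))"
        by (intro sum_mono \<Delta>) auto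
      also have "\<dots> = 2 * S * t" by (simp add: S_def sum_distrib_right[symmetric])
      finally show ?thesis .
    qed
    \<comment> \<open>The gap pays for the correction: \<open>R\<close> is the sum of
      \<open>\<rho>1\<close> minus \<open>l\<close> times the identity and of \<open>l\<close> times
      the identity plus \<open>\<Delta>\<close>, both positive.\<close>
    have "pos {..<dS'} (\<lambda>r s. (if r = s then complex_of_real l else 0) + \<Delta> r s)"
    proof (rule pos_diag_dominant)
      fix r s assume "r \<in> {..<dS'}" "s \<in> {..<dS'}"
      then have rs: "r < dS'" "s < dS'" by auto
      show "\<Delta> r s = cnj (\<Delta> s r)"
        unfolding \<Delta>_def complex_cnj_diff complex_cnj_divide \<chi>_herm[of m r s, symmetric] hermitianD[OF \<rho>1h rs, symmetric] ..
    qed (use sum_\<Delta> small(2) in auto)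
    from pos_add[OF lower this] have "pos {..<dS'} (\<lambda>r s. R $$ (r,s))"
      by (rule pos_cong[THEN iffD1, rotated]) (simp add: R_index)
    then have "psd dS' R" by (simp add: psd_iff_pos R_def)
    moreover have "mtrace R = 1" using \<rho>1t \<rho>1c by (simp add: mtrace_def R_def \<chi>_diag)
    ultimately have R: "state dS' R" by (simp add: state_def)
    have "correlated_catalysis dS HS \<rho> dS' HS' \<rho>' (U' * mat dS' dS' (\<lambda>(r,s). \<chi> m r s * R $$ (r,s)) * adj U') \<epsilon>"
    proof (rule cat'[OF R])
      show "\<rho>1 $$ (r,s) \<noteq> 0" if "r < dS'" "s < dS'" "R $$ (r,s) \<noteq> 0" for r s
        using that by (auto simp: R_def)
      \<comment> \<open>Relative to \<open>\<rho>1\<close>, each entry costs \<open>2 * t\<close>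
        for the estimation, as \<open>R\<close> is at most twice as large, and \<open>2 * t\<close>
        for the offset; together they are the 4 in \<open>A\<close>.\<close>
      have "(\<Sum>r<dS'. \<Sum>s<dS'. cmod (R $$ (r,s)) * (C / sqrt (real (Suc m))) + cmod (R $$ (r,s) - \<rho>1 $$ (r,s)))
        \<le> (\<Sum>r<dS'. \<Sum>s<dS'. cmod (\<rho>1 $$ (r,s)) * (4 * t))"
      proof (intro sum_mono)
        fix r s assume "r \<in> {..<dS'}" "s \<in> {..<dS'}"
        then have rs: "r < dS'" "s < dS'" by auto
        have "cmod (R $$ (r,s)) \<le> cmod (\<rho>1 $$ (r,s)) + cmod (\<Delta> r s)"
          unfolding R_index[OF rs] by (rule norm_triangle_ineq)
        also have "\<dots> \<le> cmod (\<rho>1 $$ (r,s)) * (1 + 2 * t)" using \<Delta>[OF rs] by (simp add: algebra_simps)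
        also have "\<dots> \<le> cmod (\<rho>1 $$ (r,s)) * 2" using small(3) by (intro mult_left_mono) auto
        finally have "cmod (R $$ (r,s)) * t \<le> cmod (\<rho>1 $$ (r,s)) * 2 * t" using t by (rule mult_right_mono)
        moreover have "cmod (R $$ (r,s) - \<rho>1 $$ (r,s)) \<le> cmod (\<rho>1 $$ (r,s)) * (2 * t)"
          unfolding R_index[OF rs] using \<Delta>[OF rs] by simp
        ultimately show "cmod (R $$ (r,s)) * (C / sqrt (real (Suc m))) + cmod (R $$ (r,s) - \<rho>1 $$ (r,s)) \<le> cmod (\<rho>1 $$ (r,s)) * (4 * t)"
          unfolding t_def[symmetric] by (simp add: algebra_simps)
      qed
      also have "\<dots> = 4 * S * t" by (simp add: S_def sum_distrib_right[symmetric])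
      finally have "real dS' * (\<Sum>r<dS'. \<Sum>s<dS'. cmod (R $$ (r,s)) * (C / sqrt (real (Suc m))) + cmod (R $$ (r,s) - \<rho>1 $$ (r,s)))
        \<le> real dS' * (4 * S * t)" by (intro mult_left_mono) auto
      then show "real dS' * (\<Sum>r<dS'. \<Sum>s<dS'. cmod (R $$ (r,s)) * (C / sqrt (real (Suc m))) + cmod (R $$ (r,s) - \<rho>1 $$ (r,s))) < \<epsilon>"
        using small(1) by linarith
    qed
    moreover have "mat dS' dS' (\<lambda>(r,s). \<chi> m r s * R $$ (r,s)) = \<rho>1"
    proof (rule eq_matI)
      fix r s assume "r < dim_row \<rho>1" "s < dim_col \<rho>1"
      then have rs: "r < dS'" "s < dS'" using \<rho>1c by auto
      have "\<chi> m r s \<noteq> 0" using \<chi>nz[OF rs] by auto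
      then show "mat dS' dS' (\<lambda>(r,s). \<chi> m r s * R $$ (r,s)) $$ (r,s) = \<rho>1 $$ (r,s)" using rs by (simp add: R_def)
    qed (use \<rho>1c in auto)
    ultimately have "correlated_catalysis dS HS \<rho> dS' HS' \<rho>' \<rho>' \<epsilon>" by (simp only: \<rho>'1[symmetric])
    then show "\<exists>dC HC c \<Lambda>. hermitian dC HC \<and> state dC c \<and>
            channel (dS*dC) (dS'*dC) \<Lambda> \<and>
            covariant (dS*dC) (ham_sum dS HS dC HC) (dS'*dC) (ham_sum dS' HS' dC HC) \<Lambda> \<and>
            (let \<tau> = \<Lambda> (kron \<rho> c) in
               ptrace_B dS' dC \<tau> = \<rho>' \<and>
               ptrace_A dS' dC \<tau> = c \<and>
               trace_norm (\<tau> - kron \<rho>' c) < \<epsilon>)"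
      unfolding correlated_catalysis_def .
  qed
qed

end
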